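(* Let $I_{c,n}:=\max\{I(K): K\text{ is a cap body in }\mathbb{E}^n\}$. As $n\to\infty$, the estimate $$I_{c,n}<\left(\frac{1}{\cos\alpha}+o(1)\right)^n$$ holds, where $\alpha\approx 0.583808$ is the solution of the equation $$\frac1{\cos\alpha}=\left(\frac{1+\sin2\alpha}{2\sin2\alpha}\right)^{\frac{1+\sin2\alpha}{2\sin2\alpha}}\left(\frac{2\sin2\alpha}{1-\sin2\alpha}\right)^{\frac{1-\sin2\alpha}{2\sin2\alpha}},\quad 0<\alpha<\frac\pi4.$$ In particular, there exists $n_0$ such that $I_{c,n}<1.19851^n$ for all $n\ge n_0$.
   Context: $\mathbb{E}^n$ is $n$-dimensional Euclidean space, $\mathbb{B}^n$ its closed unit ball and $\mathbb{S}^{n-1}$ its unit sphere. For a compact $K\subset\mathbb{E}^n$, a boundary point $x$ of $K$ is illuminated by a direction $u\in\mathbb{S}^{n-1}$ if the half line originating at $x$ in the direction of $u$ intersects the interior of $K$ at points arbitrarily close to $x$. The illumination number $I(K)$ is the smallest number of directions needed to illuminate all boundary points of $K$ (each boundary point is illuminated by at least one of the directions). For points $x_1,\dots,x_m\in\mathbb{E}^n\setminus\mathbb{B}^n$ the spiky ball is $$\mathrm{Sp}[x_1,\dots,x_m]:=\bigcup_{i=1}^m \mathrm{conv}(\mathbb{B}^n\cup\{x_i\}),$$ where $\mathrm{conv}$ is the convex hull; it is always assumed (without loss of generality) that each $x_i$ is a vertex, i.e., $\mathrm{Sp}[x_1,\dots,x_m]\neq \mathrm{Sp}[x_1,\dots,x_{i-1},x_{i+1},\dots,x_m]$.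 A cap body is a spiky ball which is a convex body (convex compact set with non-empty interior). The term $o(1)$ depends only on $n$ and tends to $0$ as $n\to\infty$. *)

theory Defs
  imports "HOL-Analysis.Analysis"
begin

text \<open>
  The dimension \<open>n\<close> has to tend to infinity inside a formula, so it cannot be a type. All the spaces
  \<open>E\<^sup>n\<close> are therefore realised as subspaces of one inner product space, that of the finitely
  supported real sequences: \<open>E\<^sup>n\<close> consists of the sequences that vanish from index \<open>n\<close> on.
\<close>

typedef fseq = "{f :: nat \<Rightarrow> real. finite {i. f i \<noteq> 0}}"
  morphisms coord Abs_fseq
  by (rule exI[of _ "\<lambda>_. 0"]) simp

lemma finite_coord: "finite {i. coord x i \<noteq> 0}"
  using coord[of x] by simp

lemma fseq_eqI: "(\<And>i. coord x i = coord y i) \<Longrightarrow> x = y"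
  by (simp add: coord_inject[symmetric] fun_eq_iff)

lemma fseq_eq_iff: "x = y \<longleftrightarrow> (\<forall>i. coord x i = coord y i)"
  by (auto intro: fseq_eqI)

lemma coord_Abs_fseq: "finite {i. f i \<noteq> 0} \<Longrightarrow> coord (Abs_fseq f) i = f i"
  by (simp add: Abs_fseq_inverse)

instantiation fseq :: real_vector
begin

definition zero_fseq :: fseq where
  "0 = Abs_fseq (\<lambda>_. 0)"

definition plus_fseq :: "fseq \<Rightarrow> fseq \<Rightarrow> fseq" where
  "x + y = Abs_fseq (\<lambda>i. coord x i + coord y i)"

definition minus_fseq :: "fseq \<Rightarrow> fseq \<Rightarrow> fseq" where
  "x - y = Abs_fseq (\<lambda>i. coord x i - coord y i)"

definition uminus_fseq :: "fseq \<Rightarrow> fseq" where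
  "- x = Abs_fseq (\<lambda>i. - coord x i)"

definition scaleR_fseq :: "real \<Rightarrow> fseq \<Rightarrow> fseq" where
  "r *\<^sub>R x = Abs_fseq (\<lambda>i. r * coord x i)"

lemma coord_zero [simp]: "coord 0 i = 0"
  by (simp add: zero_fseq_def coord_Abs_fseq)

lemma coord_add [simp]: "coord (x + y) i = coord x i + coord y i"
  unfolding plus_fseq_def
  by (rule coord_Abs_fseq,
      rule finite_subset[OF _ finite_UnI[OF finite_coord[of x] finite_coord[of y]]]) auto

lemma coord_diff [simp]: "coord (x - y) i = coord x i - coord y i"
  unfolding minus_fseq_def
  by (rule coord_Abs_fseq,
      rule finite_subset[OF _ finite_UnI[OF finite_coord[of x] finite_coord[of y]]]) auto

lemma coord_minus [simp]: "coord (- x) i = - coord x i"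
  unfolding uminus_fseq_def
  by (rule coord_Abs_fseq, rule finite_subset[OF _ finite_coord[of x]]) auto

lemma coord_scaleR [simp]: "coord (r *\<^sub>R x) i = r * coord x i"
  unfolding scaleR_fseq_def
  by (rule coord_Abs_fseq, rule finite_subset[OF _ finite_coord[of x]]) auto

instance
  by standard (auto simp: fseq_eq_iff algebra_simps)

end

instantiation fseq :: real_inner
begin

definition inner_fseq :: "fseq \<Rightarrow> fseq \<Rightarrow> real" where
  "inner x y = (\<Sum>i | coord x i \<noteq> 0. coord x i * coord y i)"

definition norm_fseq :: "fseq \<Rightarrow> real" where
  "norm (x :: fseq) = sqrt (inner x x)"

definition sgn_fseq :: "fseq \<Rightarrow> fseq" where
  "sgn (x :: fseq) = x /\<^sub>R norm x"

definition dist_fseq :: "fseq \<Rightarrow> fseq \<Rightarrow> real" where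
  "dist (x :: fseq) y = norm (x - y)"

definition uniformity_fseq :: "(fseq \<times> fseq) filter" where
  "uniformity = (INF e\<in>{0 <..}. principal {(x :: fseq, y). dist x y < e})"

definition open_fseq :: "fseq set \<Rightarrow> bool" where
  "open (U :: fseq set) \<longleftrightarrow> (\<forall>x\<in>U. \<forall>\<^sub>F (x', y) in uniformity. x' = x \<longrightarrow> y \<in> U)"

lemma inner_fseq_superset:
  "finite A \<Longrightarrow> {i. coord x i \<noteq> 0} \<subseteq> A \<Longrightarrow> inner x y = (\<Sum>i\<in>A. coord x i * coord y i)"
  unfolding inner_fseq_def by (rule sum.mono_neutral_left) auto

instance
proof
  fix x y z :: fseq and r :: real
  define A where "A = {i. coord x i \<noteq> 0} \<union> {i. coord y i \<noteq> 0}"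
  have A: "finite A" "{i. coord x i \<noteq> 0} \<subseteq> A" "{i. coord y i \<noteq> 0} \<subseteq> A"
      "{i. coord (x + y) i \<noteq> 0} \<subseteq> A" "{i. coord (r *\<^sub>R x) i \<noteq> 0} \<subseteq> A"
    by (auto simp: A_def finite_coord)
  show "inner x y = inner y x"
    using A by (simp add: inner_fseq_superset[of A] mult.commute)
  show "inner (x + y) z = inner x z + inner y z"
    using A by (simp add: inner_fseq_superset[of A] distrib_right sum.distrib)
  show "inner (r *\<^sub>R x) y = r * inner x y"
    using A by (simp add: inner_fseq_superset[of A] sum_distrib_left mult.assoc)
  show "0 \<le> inner x x"
    unfolding inner_fseq_def by (rule sum_nonneg) simp
  show "inner x x = 0 \<longleftrightarrow> x = 0"
    unfolding inner_fseq_def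
    by (subst sum_nonneg_eq_0_iff) (auto simp: finite_coord fseq_eq_iff)
qed (simp_all only: norm_fseq_def sgn_fseq_def dist_fseq_def uniformity_fseq_def open_fseq_def)

end

definition euc :: "nat \<Rightarrow> fseq set" where
  "euc n = {x. \<forall>i\<ge>n. coord x i = 0}"

text \<open>
  As \<open>euc n\<close> is not open in the ambient space, interiors and boundaries are always taken
  in the subspace topology of \<open>euc n\<close>.
\<close>

definition euc_interior :: "nat \<Rightarrow> fseq set \<Rightarrow> fseq set" where
  "euc_interior n K = top_of_set (euc n) interior_of K"

definition euc_boundary :: "nat \<Rightarrow> fseq set \<Rightarrow> fseq set" where
  "euc_boundary n K = top_of_set (euc n) frontier_of K"

definition euc_ball :: "nat \<Rightarrow> fseq set" where
  "euc_ball n = cball 0 1 \<inter> euc n"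

definition euc_sphere :: "nat \<Rightarrow> fseq set" where
  "euc_sphere n = sphere 0 1 \<inter> euc n"

definition illuminates :: "nat \<Rightarrow> fseq set \<Rightarrow> fseq \<Rightarrow> fseq \<Rightarrow> bool" where
  "illuminates n K u x \<longleftrightarrow>
     (\<forall>\<delta>>0. \<exists>t\<ge>0. x + t *\<^sub>R u \<in> euc_interior n K \<and> dist x (x + t *\<^sub>R u) < \<delta>)"

text \<open>The value is \<open>\<infinity>\<close> if no finite set of directions illuminates the whole boundary.\<close>

definition illumination_number :: "nat \<Rightarrow> fseq set \<Rightarrow> enat" where
  "illumination_number n K =
     Inf {enat (card U) | U. finite U \<and> U \<subseteq> euc_sphere n \<and>
            (\<forall>x\<in>euc_boundary n K. \<exists>u\<in>U. illuminates n K u x)}"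

definition spiky :: "nat \<Rightarrow> fseq set \<Rightarrow> fseq set" where
  "spiky n X = (\<Union>x\<in>X. convex hull (euc_ball n \<union> {x}))"

text \<open>
  The points \<open>x\<^sub>1, \<dots>, x\<^sub>m\<close> form a finite set \<open>X\<close>: the last condition says that each of them is a
  vertex, and it already excludes repetitions among them.
\<close>

definition spiky_ball :: "nat \<Rightarrow> fseq set \<Rightarrow> bool" where
  "spiky_ball n K \<longleftrightarrow>
     (\<exists>X. finite X \<and> X \<noteq> {} \<and> X \<subseteq> euc n - euc_ball n \<and> K = spiky n X \<and>
          (\<forall>x\<in>X. spiky n X \<noteq> spiky n (X - {x})))"

definition cap_body :: "nat \<Rightarrow> fseq set \<Rightarrow> bool" where
  "cap_body n K \<longleftrightarrow> spiky_ball n K \<and> convex K \<and> compact K \<and> euc_interior n K \<noteq> {}"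

text \<open>
  The maximum of \<open>I(K)\<close> over all cap bodies. It is written as a supremum in \<^typ>\<open>enat\<close>, which is
  attained as soon as it is finite and there is a cap body at all, i.e. \<open>n \<ge> 1\<close>.
\<close>

definition cap_illumination_number :: "nat \<Rightarrow> enat" where
  "cap_illumination_number n = (SUP K\<in>{K. cap_body n K}. illumination_number n K)"

definition cap_angle :: "real \<Rightarrow> bool" where
  "cap_angle \<alpha> \<longleftrightarrow> 0 < \<alpha> \<and> \<alpha> < pi / 4 \<and>
     1 / cos \<alpha> =
       ((1 + sin (2 * \<alpha>)) / (2 * sin (2 * \<alpha>))) powr ((1 + sin (2 * \<alpha>)) / (2 * sin (2 * \<alpha>))) *
       (2 * sin (2 * \<alpha>) / (1 - sin (2 * \<alpha>))) powr ((1 - sin (2 * \<alpha>)) / (2 * sin (2 * \<alpha>)))"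

end

theory Submission
  imports Defs
begin

text \<open>
  Let \<open>x\<close> run through the vertices of a cap body \<open>K\<close> and write \<open>norm x = 1 / cos \<phi>\<close>, so that \<open>\<phi>\<close> is
  the angular radius of the cap of the sphere that the spike over \<open>x\<close> hides. A direction \<open>u\<close> that
  carries \<open>x\<close> into the open unit ball carries all points of that spike off the unit sphere into it
  as well, and by convexity of \<open>K\<close> it then illuminates them; it does so if the angle between \<open>- u\<close>
  and \<open>x\<close> is less than \<open>\<pi> / 2 - \<phi>\<close>. The boundary points on the unit sphere itself only ask for a
  direction with negative inner product, and the \<open>2 n\<close> vectors \<open>\<plusminus> e\<^sub>i\<close> supply one. So the problem is to
  pierce, by few directions, the caps of radius \<open>\<pi> / 2 - \<phi>\<close> around the normalised vertices.

  Fix an angle \<open>\<alpha> < \<pi> / 4\<close>. All vertices with \<open>\<phi> < \<alpha>\<close> are dealt with at once by a set of directions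
  that meets every cap of radius \<open>\<pi> / 2 - \<alpha>\<close>; roughly \<open>(1 / cos \<alpha>) ^ n\<close> directions are enough
  (\<open>sphere_cap_cover\<close>). Each vertex with \<open>\<phi> \<ge> \<alpha>\<close> gets a direction of its own. There are few of
  them: convexity of \<open>K\<close> forces the segment between two vertices to meet the unit ball
  (\<open>segment_meets_ball\<close>), hence their hidden caps do not overlap, hence the normalised vertices form
  a spherical code of minimal angle at least \<open>2 \<alpha>\<close> (\<open>wide_caps_separated\<close>), and the bound of
  Kabatiansky and Levenshtein (\<open>kabatiansky_levenshtein\<close>) limits the size of such a code. As \<open>\<alpha>\<close>
  grows the first count increases and the second decreases; \<open>cap_angle\<close> says that the two
  exponential rates are equal. Together this is \<open>cap_illumination_bound\<close> and its asymptotic form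
  \<open>cap_illumination_rate\<close>.

  Both counts are proved by finite combinatorial means. For the code bound, Delsarte's linear
  programming method needs that the Gegenbauer polynomials \<open>Q\<^sub>j\<close> give positive semidefinite kernels
  \<open>Q\<^sub>j (x \<bullet> y)\<close> of controlled rank. Here \<open>Q\<^sub>j (x \<bullet> y)\<close> is exhibited as a Fischer inner product of two
  harmonic polynomials, computed with the commutation relations of multiplications and derivatives
  on coefficients (\<open>gegenbauer_kernel\<close>). For the covering, integer points in large balls replace
  volume (\<open>cap_density\<close>), and a greedy choice replaces a random one (\<open>greedy_cover\<close>).

  The angle itself is located by Taylor bounds for sine and cosine and series bounds for the
  logarithm, sharp enough to separate the two sides of the defining equation at the ends of the
  interval of length \<open>10\<^sup>-\<^sup>6\<close>.
\<close>

section \<open>Polynomials as coefficient functions\<close>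

text \<open>
  A polynomial in countably many variables is given by its coefficients, indexed by exponent
  vectors. Infinite supports are admitted, so that the exponential series \<open>mexp\<close> below is an
  object of the same kind.
\<close>

type_synonym mpoly = "(nat \<Rightarrow> nat) \<Rightarrow> real"

definition mulX :: "nat \<Rightarrow> mpoly \<Rightarrow> mpoly" where
  "mulX i c a = (if a i = 0 then 0 else c (a(i := a i - 1)))"

definition derivX :: "nat \<Rightarrow> mpoly \<Rightarrow> mpoly" where
  "derivX i c a = real (Suc (a i)) * c (a(i := Suc (a i)))"

definition mulL :: "nat \<Rightarrow> (nat \<Rightarrow> real) \<Rightarrow> mpoly \<Rightarrow> mpoly" where
  "mulL n y c a = (\<Sum>i<n. y i * mulX i c a)"

definition derivL :: "nat \<Rightarrow> (nat \<Rightarrow> real) \<Rightarrow> mpoly \<Rightarrow> mpoly" where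
  "derivL n y c a = (\<Sum>i<n. y i * derivX i c a)"

definition mulSq :: "nat \<Rightarrow> mpoly \<Rightarrow> mpoly" where
  "mulSq n c a = (\<Sum>i<n. mulX i (mulX i c) a)"

definition laplace :: "nat \<Rightarrow> mpoly \<Rightarrow> mpoly" where
  "laplace n c a = (\<Sum>i<n. derivX i (derivX i c) a)"

lemma mulX_lin: "mulX i (\<lambda>a. u * f a + v * g a) = (\<lambda>a. u * mulX i f a + v * mulX i g a)"
  by (auto simp: mulX_def fun_eq_iff)

lemma derivX_lin: "derivX i (\<lambda>a. u * f a + v * g a) = (\<lambda>a. u * derivX i f a + v * derivX i g a)"
  by (auto simp: derivX_def fun_eq_iff algebra_simps)

lemma mulX_add: "mulX i (\<lambda>a. f a + g a) = (\<lambda>a. mulX i f a + mulX i g a)"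
  using mulX_lin[of i 1 f 1 g] by simp

lemma derivX_add: "derivX i (\<lambda>a. f a + g a) = (\<lambda>a. derivX i f a + derivX i g a)"
  using derivX_lin[of i 1 f 1 g] by simp

lemma mulX_sum: "mulX i (\<lambda>a. \<Sum>l\<in>I. u l * f l a) = (\<lambda>a. \<Sum>l\<in>I. u l * mulX i (f l) a)"
  by (auto simp: mulX_def fun_eq_iff)

lemma derivX_sum: "derivX i (\<lambda>a. \<Sum>l\<in>I. u l * f l a) = (\<lambda>a. \<Sum>l\<in>I. u l * derivX i (f l) a)"
  by (auto simp: derivX_def fun_eq_iff sum_distrib_left algebra_simps)

lemma derivX_sum1: "derivX i (\<lambda>a. \<Sum>l\<in>I. f l a) = (\<lambda>a. \<Sum>l\<in>I. derivX i (f l) a)"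
  using derivX_sum[of i "\<lambda>_. 1" f I] by simp

lemma mulX_sum1: "mulX i (\<lambda>a. \<Sum>l\<in>I. f l a) = (\<lambda>a. \<Sum>l\<in>I. mulX i (f l) a)"
  using mulX_sum[of i "\<lambda>_. 1" f I] by simp

text \<open>
  The canonical commutation relation of the Weyl algebra. The relations for directional
  derivatives, the Laplacian and the multiplication by \<open>|x|\<^sup>2\<close> come from it by summation.
\<close>

lemma derivX_mulX:
  "derivX i (mulX l c) = (\<lambda>a. mulX l (derivX i c) a + (if i = l then c a else 0))"
proof (cases "i = l")
  case True
  have "a(l := 0) = a" if "a l = 0" for a :: "nat \<Rightarrow> nat" using that by (auto simp: fun_eq_iff)
  thus ?thesis using True by (auto simp: fun_eq_iff derivX_def mulX_def algebra_simps)
next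
  case False
  thus ?thesis by (auto simp: fun_eq_iff derivX_def mulX_def fun_upd_twist)
qed

lemma derivX_commute: "derivX i (derivX l c) = derivX l (derivX i c)"
  by (cases "i = l") (auto simp: fun_eq_iff derivX_def fun_upd_twist)

lemma mulX_derivX: "mulX i (derivX i c) a = real (a i) * c a"
  by (auto simp: derivX_def mulX_def)

lemma derivL_lin: "derivL n y (\<lambda>a. u * f a + v * g a) = (\<lambda>a. u * derivL n y f a + v * derivL n y g a)"
  by (simp add: fun_eq_iff derivL_def derivX_lin sum.distrib sum_distrib_left algebra_simps)

lemma mulL_lin: "mulL n y (\<lambda>a. u * f a + v * g a) = (\<lambda>a. u * mulL n y f a + v * mulL n y g a)"
  by (simp add: fun_eq_iff mulL_def mulX_lin sum.distrib sum_distrib_left algebra_simps)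

lemma mulSq_lin: "mulSq n (\<lambda>a. u * f a + v * g a) = (\<lambda>a. u * mulSq n f a + v * mulSq n g a)"
  by (simp add: fun_eq_iff mulSq_def mulX_lin sum.distrib sum_distrib_left algebra_simps)

lemma laplace_lin: "laplace n (\<lambda>a. u * f a + v * g a) = (\<lambda>a. u * laplace n f a + v * laplace n g a)"
  by (simp add: fun_eq_iff laplace_def derivX_lin sum.distrib sum_distrib_left algebra_simps)

lemma derivL_mulL:
  "derivL n y (mulL n z c) = (\<lambda>a. mulL n z (derivL n y c) a + (\<Sum>i<n. y i * z i) * c a)"
proof
  fix a
  have "derivL n y (mulL n z c) a = (\<Sum>i<n. \<Sum>l<n. y i * (z l * (mulX l (derivX i c) a + (if i = l then c a else 0))))"
    unfolding derivL_def mulL_def[abs_def] by (simp add: derivX_sum derivX_mulX sum_distrib_left)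
  also have "\<dots> = (\<Sum>i<n. \<Sum>l<n. z l * (y i * mulX l (derivX i c) a)) + (\<Sum>i<n. y i * z i * c a)"
    by (simp add: algebra_simps sum.distrib if_distrib[of "\<lambda>t. _ * t"] cong: if_cong)
  also have "(\<Sum>i<n. \<Sum>l<n. z l * (y i * mulX l (derivX i c) a)) = mulL n z (derivL n y c) a"
    unfolding mulL_def derivL_def[abs_def] by (subst sum.swap) (simp add: mulX_sum sum_distrib_left)
  finally show "derivL n y (mulL n z c) a = mulL n z (derivL n y c) a + (\<Sum>i<n. y i * z i) * c a"
    by (simp add: sum_distrib_right)
qed

lemma derivX_mulSq:
  assumes "i < n"
  shows "derivX i (mulSq n c) = (\<lambda>a. mulSq n (derivX i c) a + 2 * mulX i c a)"
proof
  fix a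
  have "derivX i (mulSq n c) a
      = (\<Sum>l<n. mulX l (mulX l (derivX i c)) a + (if i = l then 2 * mulX i c a else 0))"
    unfolding mulSq_def[abs_def] derivX_sum1 derivX_mulX mulX_add
    by (rule sum.cong) (auto simp: mulX_def)
  thus "derivX i (mulSq n c) a = mulSq n (derivX i c) a + 2 * mulX i c a"
    using assms by (simp add: sum.distrib mulSq_def)
qed

lemma derivL_mulSq:
  "derivL n y (mulSq n c) = (\<lambda>a. mulSq n (derivL n y c) a + 2 * mulL n y c a)"
proof
  fix a
  have "mulSq n (derivL n y c) a = (\<Sum>i<n. y i * mulSq n (derivX i c) a)"
    unfolding mulSq_def derivL_def[abs_def] mulX_sum sum_distrib_left by (rule sum.swap)
  thus "derivL n y (mulSq n c) a = mulSq n (derivL n y c) a + 2 * mulL n y c a"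
    unfolding derivL_def[of n y "mulSq n c"]
    by (simp add: derivX_mulSq mulL_def algebra_simps sum.distrib sum_distrib_left)
qed

lemma laplace_mulL:
  "laplace n (mulL n y c) = (\<lambda>a. mulL n y (laplace n c) a + 2 * derivL n y c a)"
proof
  fix a
  have 1: "derivX i (derivX i (mulL n y c)) a
      = mulL n y (derivX i (derivX i c)) a + 2 * (y i * derivX i c a)" if "i < n" for i
  proof -
    have "derivX i (derivX i (mulL n y c)) a
        = (\<Sum>l<n. y l * (mulX l (derivX i (derivX i c)) a + (if i = l then 2 * derivX i c a else 0)))"
      unfolding mulL_def[abs_def] derivX_sum derivX_mulX derivX_add
      by (rule sum.cong) (auto simp: derivX_def)
    thus ?thesis using that by (simp add: distrib_left sum.distrib mulL_def if_distrib[of "\<lambda>t. _ * t"] cong: if_cong)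
  qed
  have "mulL n y (laplace n c) a = (\<Sum>i<n. mulL n y (derivX i (derivX i c)) a)"
    unfolding mulL_def laplace_def[abs_def] mulX_sum1 sum_distrib_left by (rule sum.swap)
  thus "laplace n (mulL n y c) a = mulL n y (laplace n c) a + 2 * derivL n y c a"
    unfolding laplace_def[of n "mulL n y c"]
    by (simp add: 1 derivL_def sum.distrib sum_distrib_left)
qed

text \<open>
  This is \<open>[\<Delta>, |x|\<^sup>2] = 4 E + 2 n\<close>, where the Euler operator \<open>E\<close> multiplies the coefficient at \<open>a\<close>
  by the total degree of \<open>a\<close>.
\<close>

lemma laplace_mulSq:
  "laplace n (mulSq n c) a = mulSq n (laplace n c) a + (4 * (\<Sum>i<n. real (a i)) + 2 * real n) * c a"
proof -
  have 1: "derivX i (derivX i (mulSq n c)) a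
      = mulSq n (derivX i (derivX i c)) a + (4 * real (a i) * c a + 2 * c a)" if "i < n" for i
  proof -
    have "derivX i (derivX i (mulSq n c)) a
        = derivX i (mulSq n (derivX i c)) a + 2 * derivX i (mulX i c) a"
      using that derivX_lin[of i 1 "mulSq n (derivX i c)" 2 "mulX i c"] by (simp add: derivX_mulSq)
    thus ?thesis using that by (simp add: derivX_mulSq derivX_mulX mulX_derivX)
  qed
  have "mulSq n (laplace n c) a = (\<Sum>i<n. mulSq n (derivX i (derivX i c)) a)"
    unfolding mulSq_def laplace_def[abs_def] mulX_sum1 by (rule sum.swap)
  thus ?thesis unfolding laplace_def[of n "mulSq n c"]
    by (simp add: 1 sum.distrib sum_distrib_left sum_distrib_right algebra_simps)
qed

lemma laplace_derivL: "laplace n (derivL n y c) = derivL n y (laplace n c)"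
proof
  fix a
  have 1: "derivX i (derivX i (derivX l c)) = derivX l (derivX i (derivX i c))" for i l
    using derivX_commute[of i l c] derivX_commute[of i l "derivX i c"] by simp
  have "laplace n (derivL n y c) a = (\<Sum>i<n. \<Sum>l<n. y l * derivX l (derivX i (derivX i c)) a)"
    unfolding laplace_def derivL_def[abs_def] derivX_sum 
    by (intro sum.cong refl arg_cong2[where f="(*)"] fun_cong[OF 1])
  also have "\<dots> = derivL n y (laplace n c) a"
    unfolding derivL_def laplace_def[abs_def] derivX_sum1 sum_distrib_left by (rule sum.swap)
  finally show "laplace n (derivL n y c) a = derivL n y (laplace n c) a" .
qed

definition homogeneous :: "nat \<Rightarrow> nat \<Rightarrow> mpoly \<Rightarrow> bool" where
  "homogeneous n j c \<longleftrightarrow> (\<forall>a. c a \<noteq> 0 \<longrightarrow> (\<Sum>i<n. a i) = j)"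

lemma homogeneous_lin:
  "homogeneous n j f \<Longrightarrow> homogeneous n j g \<Longrightarrow> homogeneous n j (\<lambda>a. u * f a + v * g a)"
  unfolding homogeneous_def by force

lemma homogeneous_sum:
  assumes "\<And>i. i \<in> I \<Longrightarrow> homogeneous n j (f i)"
  shows "homogeneous n j (\<lambda>a. \<Sum>i\<in>I. u i * f i a)"
  unfolding homogeneous_def
proof (intro allI impI)
  fix a assume "(\<Sum>i\<in>I. u i * f i a) \<noteq> 0"
  then obtain i where "i \<in> I" "u i * f i a \<noteq> 0" by (meson sum.neutral)
  thus "(\<Sum>l<n. a l) = j" using assms unfolding homogeneous_def by auto
qed

lemma homogeneous_mulX:
  assumes "homogeneous n j c" "i < n"
  shows "homogeneous n (Suc j) (mulX i c)"
  unfolding homogeneous_def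
proof (intro allI impI)
  fix a assume nz: "mulX i c a \<noteq> 0"
  hence *: "a i \<noteq> 0" "(\<Sum>l<n. (a(i := a i - 1)) l) = j"
    using assms unfolding mulX_def homogeneous_def by (auto split: if_splits)
  have "(\<Sum>l<n. a l) = (\<Sum>l<n. (a(i := a i - 1)) l) + (\<Sum>l<n. if l = i then 1 else 0)"
    unfolding sum.distrib[symmetric] using * by (intro sum.cong) auto
  thus "(\<Sum>l<n. a l) = Suc j" using * assms by simp
qed

lemma homogeneous_mulL: "homogeneous n j c \<Longrightarrow> homogeneous n (Suc j) (mulL n y c)"
  unfolding mulL_def[abs_def] by (intro homogeneous_sum homogeneous_mulX) auto

lemma homogeneous_mulSq: "homogeneous n j c \<Longrightarrow> homogeneous n (Suc (Suc j)) (mulSq n c)"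
  unfolding mulSq_def[abs_def]
  using homogeneous_sum[of "{..<n}" n "Suc (Suc j)" "\<lambda>i. mulX i (mulX i c)" "\<lambda>_. 1"]
  by (simp add: homogeneous_mulX)

lemma laplace_mulSq_homogeneous:
  assumes "homogeneous n j c"
  shows "laplace n (mulSq n c) = (\<lambda>a. mulSq n (laplace n c) a + (4 * real j + 2 * real n) * c a)"
proof
  fix a
  show "laplace n (mulSq n c) a = mulSq n (laplace n c) a + (4 * real j + 2 * real n) * c a"
    using assms laplace_mulSq[of n c a] unfolding homogeneous_def of_nat_sum[symmetric]
    by (cases "c a = 0") auto
qed

section \<open>Zonal harmonics and their Gegenbauer recurrence\<close>

text \<open>
  The Gegenbauer polynomials of parameter \<open>(n - 2) / 2\<close>, normalised by \<open>Q\<^sub>j 1 = 1\<close>, satisfy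
  \<open>(j + n - 2) Q\<^bsub>j+1\<^esub> = (2 j + n - 2) t Q\<^sub>j - j Q\<^bsub>j-1\<^esub>\<close>. The next two definitions are the coefficients
  of this recurrence after division by \<open>j + n - 2\<close>.
\<close>

definition rec_lead :: "nat \<Rightarrow> nat \<Rightarrow> real" where
  "rec_lead n j = (2 * real j + real n - 2) / (real j + real n - 2)"

definition rec_trail :: "nat \<Rightarrow> nat \<Rightarrow> real" where
  "rec_trail n j = real j / (real j + real n - 2)"

text \<open>
  For a unit vector \<open>y\<close>, the polynomial \<open>zonal n y j\<close> is the function \<open>x \<mapsto> Q\<^sub>j (x \<bullet> y)\<close> on the unit
  sphere, continued to a homogeneous polynomial of degree \<open>j\<close>; this is why \<open>|x|\<^sup>2\<close> appears in the
  second term of the recurrence.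
\<close>

fun zonal :: "nat \<Rightarrow> (nat \<Rightarrow> real) \<Rightarrow> nat \<Rightarrow> mpoly" where
  "zonal n y 0 = (\<lambda>a. if \<forall>i. a i = 0 then 1 else 0)"
| "zonal n y (Suc 0) = mulL n y (zonal n y 0)"
| "zonal n y (Suc (Suc j)) =
     (\<lambda>a. rec_lead n (Suc j) * mulL n y (zonal n y (Suc j)) a + (- rec_trail n (Suc j)) * mulSq n (zonal n y j) a)"

fun gegenbauer :: "nat \<Rightarrow> nat \<Rightarrow> real \<Rightarrow> real" where
  "gegenbauer n 0 t = 1"
| "gegenbauer n (Suc 0) t = t"
| "gegenbauer n (Suc (Suc j)) t = rec_lead n (Suc j) * (t * gegenbauer n (Suc j) t) - rec_trail n (Suc j) * gegenbauer n j t"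

lemma homogeneous_zonal: "homogeneous n j (zonal n y j)"
proof (induction j rule: induct_nat_012)
  case 0 thus ?case by (simp add: homogeneous_def)
next
  case 1
  have "homogeneous n 0 (zonal n y 0)" by (simp add: homogeneous_def)
  thus ?case using homogeneous_mulL[of n 0 "zonal n y 0" y] by (simp del: zonal.simps(1))
next
  case (ge2 j)
  thus ?case unfolding zonal.simps by (intro homogeneous_lin homogeneous_mulL homogeneous_mulSq)
qed

lemma derivX_zero: "derivX i (\<lambda>a. 0) = (\<lambda>a. 0)"
  by (simp add: fun_eq_iff derivX_def)

lemma mulX_zero: "mulX i (\<lambda>a. 0) = (\<lambda>a. 0)"
  by (simp add: fun_eq_iff mulX_def)

lemma derivX_zonal_0: "derivX i (zonal n y 0) = (\<lambda>a. 0)"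
proof
  fix a :: "nat \<Rightarrow> nat"
  have "\<not> (\<forall>l. (a(i := Suc (a i))) l = 0)" by (metis fun_upd_same nat.simps(3))
  thus "derivX i (zonal n y 0) a = 0" by (simp add: derivX_def del: fun_upd_apply)
qed

lemma derivL_zonal_0: "derivL n y (zonal n y 0) = (\<lambda>a. 0)"
  by (simp add: fun_eq_iff derivL_def derivX_zonal_0 del: zonal.simps(1))

lemma laplace_zonal_0: "laplace n (zonal n y 0) = (\<lambda>a. 0)"
  by (simp add: fun_eq_iff laplace_def derivX_zonal_0 derivX_zero del: zonal.simps(1))

lemma mulL_zero [simp]: "mulL n y (\<lambda>a. 0) = (\<lambda>a. 0)"
  by (auto simp: fun_eq_iff mulL_def mulX_def)

lemma mulSq_zero [simp]: "mulSq n (\<lambda>a. 0) = (\<lambda>a. 0)"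
  by (simp add: fun_eq_iff mulSq_def mulX_zero)

lemma mulL_scale: "mulL n y (\<lambda>a. u * f a) = (\<lambda>a. u * mulL n y f a)"
  using mulL_lin[of n y u f 0 f] by simp

lemma mulSq_scale: "mulSq n (\<lambda>a. u * f a) = (\<lambda>a. u * mulSq n f a)"
  using mulSq_lin[of n u f 0 f] by simp

text \<open>
  The two claims are proved together because each feeds the other. Commuting the derivative in
  the direction of the pole, or the Laplacian, past the recurrence produces only lower zonal
  polynomials, and the coefficients of the recurrence are such that the derivative is
  \<open>(j + 1) Q\<^sub>j\<close> and the terms of the Laplacian cancel.
\<close>

lemma zonal_derivL_laplace:
  assumes n: "n \<ge> 3" and y: "(\<Sum>i<n. y i * y i) = 1"
  shows "derivL n y (zonal n y (Suc j)) = (\<lambda>a. real (Suc j) * zonal n y j a)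
       \<and> laplace n (zonal n y (Suc j)) = (\<lambda>a. 0)"
proof (induction j rule: less_induct)
  case (less j)
  show ?case
  proof (cases j)
    case 0
    thus ?thesis
      by (simp add: derivL_mulL laplace_mulL derivL_zonal_0 laplace_zonal_0 y del: zonal.simps(1))
  next
    case (Suc m)
    have d1: "derivL n y (zonal n y (Suc m)) = (\<lambda>a. real (Suc m) * zonal n y m a)"
      and l1: "laplace n (zonal n y (Suc m)) = (\<lambda>a. 0)" using less[of m] Suc by auto
    have l0: "laplace n (zonal n y m) = (\<lambda>a. 0)"
      using less[of "m - 1"] Suc laplace_zonal_0 by (cases m) auto
    have pos: "real (Suc m) + real n - 2 > 0" "real m + real n - 2 > 0" using n by auto
    have lap: "laplace n (zonal n y (Suc (Suc m))) = (\<lambda>a. 0)"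
    proof
      fix a
      have "rec_lead n (Suc m) * (2 * real (Suc m)) - rec_trail n (Suc m) * (4 * real m + 2 * real n) = 0"
        using pos unfolding rec_lead_def rec_trail_def by (simp add: field_simps)
      moreover have "laplace n (zonal n y (Suc (Suc m))) a
        = (rec_lead n (Suc m) * (2 * real (Suc m)) - rec_trail n (Suc m) * (4 * real m + 2 * real n)) * zonal n y m a"
        unfolding zonal.simps laplace_lin
        using l1 l0 d1 by (simp add: laplace_mulL laplace_mulSq_homogeneous[OF homogeneous_zonal] algebra_simps)
      ultimately show "laplace n (zonal n y (Suc (Suc m))) a = 0" by simp
    qed
    have der: "derivL n y (zonal n y (Suc (Suc m))) = (\<lambda>a. real (Suc (Suc m)) * zonal n y (Suc m) a)"
    proof (cases m)
      case 0
      have p: "real n - 1 > 0" using n by auto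
      show ?thesis
      proof
        fix a
        have "derivL n y (zonal n y (Suc (Suc m))) a =
          (2 * rec_lead n 1 - 2 * rec_trail n 1) * mulL n y (zonal n y 0) a"
          unfolding 0 zonal.simps(2,3) derivL_lin using d1 0
          by (simp add: derivL_mulL derivL_mulSq y derivL_zonal_0 algebra_simps del: zonal.simps(1))
        also have "2 * rec_lead n 1 - 2 * rec_trail n 1 = 2"
          using p unfolding rec_lead_def rec_trail_def by (simp add: divide_simps)
        finally show "derivL n y (zonal n y (Suc (Suc m))) a = real (Suc (Suc m)) * zonal n y (Suc m) a"
          using 0 by (simp del: zonal.simps(1))
      qed
    next
      case (Suc p)
      have d0: "derivL n y (zonal n y (Suc p)) = (\<lambda>a. real (Suc p) * zonal n y p a)"
        using less[of p] \<open>j = Suc m\<close> Suc by auto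
      show ?thesis
      proof
        fix a
        define L where "L = mulL n y (zonal n y (Suc p)) a"
        define S where "S = mulSq n (zonal n y p) a"
        define Z where "Z = zonal n y (Suc (Suc p)) a"
        have Z: "Z = rec_lead n (Suc p) * L - rec_trail n (Suc p) * S"
          unfolding Z_def L_def S_def by simp
        define N where "N = real p + real n"
        have N: "N - 1 \<noteq> 0" "N \<noteq> 0" using n by (auto simp: N_def)
        have d: "real (Suc p) + real n - 2 = N - 1" "real (Suc (Suc p)) + real n - 2 = N"
          by (auto simp: N_def)
        have g1: "(N - 1) * rec_lead n (Suc p) = 2 * real p + real n" "(N - 1) * rec_trail n (Suc p) = real p + 1"
          unfolding rec_lead_def rec_trail_def d using N by (simp_all add: add.commute)
        have g2: "N * rec_lead n (Suc m) = 2 * real p + real n + 2" "N * rec_trail n (Suc m) = real p + 2"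
          unfolding rec_lead_def rec_trail_def Suc d using N by simp_all
        have Z': "(N - 1) * Z = (2 * real p + real n) * L - (real p + 1) * S"
          unfolding Z g1[symmetric] by (simp add: algebra_simps)
        have "derivL n y (zonal n y (Suc (Suc m))) a =
          rec_lead n (Suc m) * (real (Suc m) * L + Z) - rec_trail n (Suc m) * (real (Suc p) * S + 2 * L)"
          unfolding zonal.simps(3)[of n y m] derivL_lin using d1 d0 Suc
          by (simp add: derivL_mulL derivL_mulSq y mulL_scale mulSq_scale L_def S_def Z_def
               del: zonal.simps)
        also have "\<dots> = real (Suc (Suc m)) * Z"
        proof -
          have "N * (rec_lead n (Suc m) * (real (Suc m) * L + Z) - rec_trail n (Suc m) * (real (Suc p) * S + 2 * L))
             = N * rec_lead n (Suc m) * (real (Suc m) * L + Z) - N * rec_trail n (Suc m) * (real (Suc p) * S + 2 * L)"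
            by (simp add: algebra_simps)
          also have "\<dots> = (2 * real p + real n + 2) * ((real p + 2) * L + Z) - (real p + 2) * ((real p + 1) * S + 2 * L)"
            unfolding g2 by (simp add: Suc add.commute)
          also have "\<dots> = N * ((real p + 3) * Z)"
            using Z' N_def by algebra
          finally show ?thesis using N(2) unfolding mult_cancel_left by (simp add: Suc)
        qed
        finally show "derivL n y (zonal n y (Suc (Suc m))) a = real (Suc (Suc m)) * zonal n y (Suc m) a"
          unfolding Z_def Suc .
      qed
    qed
    show ?thesis using lap der Suc by simp
  qed
qed

lemma laplace_zonal:
  "n \<ge> 3 \<Longrightarrow> (\<Sum>i<n. y i * y i) = 1 \<Longrightarrow> laplace n (zonal n y j) = (\<lambda>a. 0)"
  using laplace_zonal_0 zonal_derivL_laplace by (cases j) auto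

section \<open>The Fischer inner product and positive definiteness\<close>

definition mindex :: "nat \<Rightarrow> nat \<Rightarrow> (nat \<Rightarrow> nat) set" where
  "mindex n j = {a. (\<forall>i\<ge>n. a i = 0) \<and> (\<Sum>i<n. a i) = j}"

definition mfact :: "nat \<Rightarrow> (nat \<Rightarrow> nat) \<Rightarrow> real" where
  "mfact n a = (\<Prod>i<n. fact (a i))"

text \<open>
  The Fischer inner product \<open>\<Sum> a! c\<^sub>a d\<^sub>a\<close> on the homogeneous parts of degree \<open>j\<close>. The weight
  \<open>a!\<close> is what makes multiplication by a variable adjoint to the partial derivative.
\<close>

definition fischer :: "nat \<Rightarrow> nat \<Rightarrow> mpoly \<Rightarrow> mpoly \<Rightarrow> real" where
  "fischer n j c d = (\<Sum>a\<in>mindex n j. mfact n a * c a * d a)"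

lemma mindex_le: "a \<in> mindex n j \<Longrightarrow> a i \<le> j"
  unfolding mindex_def
  by (cases "i < n") (auto intro: member_le_sum)

lemma finite_mindex: "finite (mindex n j)"
proof (rule finite_subset)
  show "mindex n j \<subseteq> {a. \<forall>i. (i \<in> {..<n} \<longrightarrow> a i \<in> {..j}) \<and> (i \<notin> {..<n} \<longrightarrow> a i = 0)}"
  proof
    fix a assume a: "a \<in> mindex n j"
    show "a \<in> {a. \<forall>i. (i \<in> {..<n} \<longrightarrow> a i \<in> {..j}) \<and> (i \<notin> {..<n} \<longrightarrow> a i = 0)}"
      using mindex_le[OF a] a by (simp add: mindex_def)
  qed
  show "finite {a. \<forall>i. (i \<in> {..<n} \<longrightarrow> a i \<in> {..j}) \<and> (i \<notin> {..<n} \<longrightarrow> a i = 0)}"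
    by (rule finite_set_of_finite_funs) auto
qed

lemma fischer_adjoint:
  assumes i: "i < n"
  shows "fischer n (Suc j) (mulX i c) d = fischer n j c (derivX i d)"
proof -
  have inj: "inj_on (\<lambda>a. a(i := Suc (a i))) (mindex n j)"
    by (rule inj_onI) (metis fun_upd_idem_iff fun_upd_same fun_upd_upd nat.inject fun_upd_triv)
  have sm: "(\<Sum>l<n. (a(i := b)) l) + a i = (\<Sum>l<n. a l) + b" for a :: "nat \<Rightarrow> nat" and b
  proof -
    have "(\<Sum>l<n. (a(i := b)) l) = b + (\<Sum>l\<in>{..<n} - {i}. a l)"
      using i by (subst sum.remove[of _ i]) auto
    moreover have "(\<Sum>l<n. a l) = a i + (\<Sum>l\<in>{..<n} - {i}. a l)"
      using i by (subst sum.remove[of _ i]) auto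
    ultimately show ?thesis by simp
  qed
  have im: "(\<lambda>a. a(i := Suc (a i))) ` mindex n j = {a \<in> mindex n (Suc j). a i \<noteq> 0}"
  proof (intro equalityI subsetI)
    fix b assume "b \<in> (\<lambda>a. a(i := Suc (a i))) ` mindex n j"
    then obtain a where a: "a \<in> mindex n j" "b = a(i := Suc (a i))" by auto
    show "b \<in> {a \<in> mindex n (Suc j). a i \<noteq> 0}"
      using a sm[of a "Suc (a i)"] i unfolding mindex_def by auto
  next
    fix b assume b: "b \<in> {a \<in> mindex n (Suc j). a i \<noteq> 0}"
    have "b(i := b i - 1) \<in> mindex n j"
      using b sm[of b "b i - 1"] i unfolding mindex_def by auto
    moreover have "b = (b(i := b i - 1))(i := Suc ((b(i := b i - 1)) i))" using b by auto
    ultimately show "b \<in> (\<lambda>a. a(i := Suc (a i))) ` mindex n j" by blast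
  qed
  have mf: "mfact n (a(i := Suc (a i))) = real (Suc (a i)) * mfact n a" for a
  proof -
    have "mfact n (a(i := Suc (a i))) = fact (Suc (a i)) * (\<Prod>l\<in>{..<n} - {i}. fact (a l))"
      unfolding mfact_def using i by (subst prod.remove[of _ i]) (auto intro!: prod.cong)
    moreover have "mfact n a = fact (a i) * (\<Prod>l\<in>{..<n} - {i}. fact (a l))"
      unfolding mfact_def using i by (subst prod.remove[of _ i]) auto
    ultimately show ?thesis by simp
  qed
  have "fischer n (Suc j) (mulX i c) d = (\<Sum>a\<in>{a \<in> mindex n (Suc j). a i \<noteq> 0}. mfact n a * mulX i c a * d a)"
    unfolding fischer_def by (rule sum.mono_neutral_right) (auto simp: finite_mindex mulX_def)
  also have "\<dots> = (\<Sum>a\<in>mindex n j. mfact n a * c a * derivX i d a)"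
    unfolding im[symmetric] sum.reindex[OF inj] o_def mf
    by (rule sum.cong) (auto simp: mulX_def derivX_def)
  finally show ?thesis unfolding fischer_def .
qed

lemma fischer_commute: "fischer n j c d = fischer n j d c"
  unfolding fischer_def by (simp add: mult.commute mult.left_commute)

lemma fischer_sum_right:
  "fischer n j c (\<lambda>a. \<Sum>l\<in>I. u l * f l a) = (\<Sum>l\<in>I. u l * fischer n j c (f l))"
  unfolding fischer_def sum_distrib_left by (subst sum.swap) (simp add: algebra_simps)

lemma fischer_lin_right:
  "fischer n j c (\<lambda>a. u * f a + v * g a) = u * fischer n j c f + v * fischer n j c g"
  unfolding fischer_def sum_distrib_left sum.distrib[symmetric] by (simp add: algebra_simps)

lemma fischer_mulL: "fischer n (Suc j) (mulL n y c) d = fischer n j c (derivL n y d)"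
proof -
  have "fischer n (Suc j) (mulL n y c) d = (\<Sum>l<n. y l * fischer n (Suc j) (mulX l c) d)"
    unfolding mulL_def[abs_def] by (subst (1 2) fischer_commute) (rule fischer_sum_right)
  thus ?thesis unfolding derivL_def[abs_def] by (simp add: fischer_sum_right fischer_adjoint)
qed

lemma fischer_mulSq: "fischer n (Suc (Suc j)) (mulSq n c) d = fischer n j c (laplace n d)"
proof -
  have "fischer n (Suc (Suc j)) (mulSq n c) d = (\<Sum>l<n. fischer n (Suc (Suc j)) (mulX l (mulX l c)) d)"
    unfolding mulSq_def[abs_def]
    using fischer_sum_right[of n "Suc (Suc j)" d "\<lambda>_. 1" "\<lambda>l. mulX l (mulX l c)" "{..<n}"]
    by (simp add: fischer_commute)
  also have "\<dots> = (\<Sum>l<n. fischer n j c (derivX l (derivX l d)))"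
    by (simp add: fischer_adjoint)
  finally show ?thesis
    using fischer_sum_right[of n j c "\<lambda>_. 1" "\<lambda>l. derivX l (derivX l d)" "{..<n}"]
    unfolding laplace_def[abs_def] by simp
qed

text \<open>
  The series \<open>exp (x \<bullet> y)\<close> as a polynomial in \<open>y\<close>. It is a common eigenvector of all partial
  derivatives, so by adjointness the Fischer product with it evaluates a polynomial at \<open>x\<close>.
\<close>

definition mexp :: "nat \<Rightarrow> (nat \<Rightarrow> real) \<Rightarrow> mpoly" where
  "mexp n x a = (\<Prod>i<n. x i ^ a i / fact (a i))"

lemma derivX_mexp:
  assumes "i < n"
  shows "derivX i (mexp n x) = (\<lambda>a. x i * mexp n x a)"
proof
  fix a
  have "mexp n x (a(i := Suc (a i))) = (x i ^ Suc (a i) / fact (Suc (a i))) * (\<Prod>l\<in>{..<n} - {i}. x l ^ a l / fact (a l))"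
    unfolding mexp_def using assms by (subst prod.remove[of _ i]) (auto intro!: prod.cong)
  moreover have "mexp n x a = (x i ^ a i / fact (a i)) * (\<Prod>l\<in>{..<n} - {i}. x l ^ a l / fact (a l))"
    unfolding mexp_def using assms by (subst prod.remove[of _ i]) auto
  moreover have "real (Suc (a i)) * (x i ^ Suc (a i) / fact (Suc (a i))) = x i * (x i ^ a i / fact (a i))"
    by simp
  ultimately show "derivX i (mexp n x) a = x i * mexp n x a"
    unfolding derivX_def by (simp only: mult.assoc[symmetric])
qed

lemma mulX_mexp: "i < n \<Longrightarrow> x i * mulX i (mexp n x) a = real (a i) * mexp n x a"
  using mulX_derivX[of i "mexp n x" a] mulX_lin[of i "x i" "mexp n x" 0 "mexp n x"]
  by (simp add: derivX_mexp)

lemma fischer_mexp_mulL: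
  "fischer n (Suc j) (mexp n x) (mulL n y c) = (\<Sum>i<n. x i * y i) * fischer n j (mexp n x) c"
proof -
  have "derivL n y (mexp n x) = (\<lambda>a. (\<Sum>i<n. x i * y i) * mexp n x a)"
    by (simp add: fun_eq_iff derivL_def derivX_mexp sum_distrib_right sum_distrib_left mult_ac)
  hence "fischer n j c (derivL n y (mexp n x)) = (\<Sum>i<n. x i * y i) * fischer n j c (mexp n x)"
    using fischer_lin_right[of n j c "\<Sum>i<n. x i * y i" "mexp n x" 0 "mexp n x"] by simp
  thus ?thesis by (metis fischer_commute fischer_mulL)
qed

lemma fischer_mexp_mulSq:
  "fischer n (Suc (Suc j)) (mexp n x) (mulSq n c) = (\<Sum>i<n. x i * x i) * fischer n j (mexp n x) c"
proof -
  have "derivX i (derivX i (mexp n x)) = (\<lambda>a. x i * x i * mexp n x a)" if "i < n" for i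
    using derivX_lin[of i "x i" "mexp n x" 0 "mexp n x"] that by (simp add: derivX_mexp mult.assoc)
  hence "laplace n (mexp n x) = (\<lambda>a. (\<Sum>i<n. x i * x i) * mexp n x a)"
    by (simp add: fun_eq_iff laplace_def sum_distrib_right)
  hence "fischer n j c (laplace n (mexp n x)) = (\<Sum>i<n. x i * x i) * fischer n j c (mexp n x)"
    using fischer_lin_right[of n j c "\<Sum>i<n. x i * x i" "mexp n x" 0 "mexp n x"] by simp
  thus ?thesis by (metis fischer_commute fischer_mulSq)
qed

lemma mindex_0: "mindex n 0 = {\<lambda>_. 0}"
  unfolding mindex_def by (auto simp: fun_eq_iff) (metis lessThan_iff not_le)

lemma fischer_mexp_zonal:
  assumes "(\<Sum>i<n. x i * x i) = 1"
  shows "fischer n j (mexp n x) (zonal n y j) = gegenbauer n j (\<Sum>i<n. x i * y i)"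
proof (induction j rule: induct_nat_012)
  case 0 thus ?case by (simp add: fischer_def mindex_0 mfact_def mexp_def)
next
  case 1
  have "fischer n 0 (mexp n x) (zonal n y 0) = 1"
    by (simp add: fischer_def mindex_0 mfact_def mexp_def)
  thus ?case by (simp add: fischer_mexp_mulL del: zonal.simps(1))
next
  case (ge2 j)
  thus ?case unfolding zonal.simps fischer_lin_right
    by (simp add: fischer_mexp_mulL fischer_mexp_mulSq assms del: zonal.simps)
qed

fun zonal_const :: "nat \<Rightarrow> nat \<Rightarrow> real" where
  "zonal_const n 0 = 1"
| "zonal_const n (Suc j) = rec_lead n j * zonal_const n j * real (Suc j)"

lemma zonal_const_pos: "n \<ge> 3 \<Longrightarrow> zonal_const n j > 0"
  by (induction j) (auto simp: rec_lead_def intro!: mult_pos_pos divide_pos_pos)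

text \<open>
  Euler's identity for homogeneous polynomials, read through the evaluation functional.
\<close>

lemma fischer_mexp_derivL:
  "fischer n j (mexp n x) (derivL n x h) = real (Suc j) * fischer n (Suc j) (mexp n x) h"
proof -
  have "fischer n j (mexp n x) (derivL n x h) = fischer n (Suc j) (mulL n x (mexp n x)) h"
    by (simp add: fischer_mulL)
  also have "\<dots> = (\<Sum>a\<in>mindex n (Suc j). mfact n a * (real (\<Sum>i<n. a i) * mexp n x a) * h a)"
    unfolding fischer_def mulL_def by (simp add: mulX_mexp sum_distrib_right)
  also have "\<dots> = (\<Sum>a\<in>mindex n (Suc j). real (Suc j) * (mfact n a * mexp n x a * h a))"
    by (rule sum.cong) (auto simp: mindex_def)
  finally show ?thesis unfolding fischer_def sum_distrib_left .
qed

text \<open>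
  On harmonic polynomials, zonal polynomials evaluate at their pole up to a constant. The second
  term of the recurrence is a multiple of \<open>|x|\<^sup>2\<close>, hence orthogonal to harmonic polynomials, as
  multiplication by \<open>|x|\<^sup>2\<close> is adjoint to the Laplacian. The first term is moved to the other side as
  a directional derivative, which is harmonic again, and Euler's identity evaluates it.
\<close>

lemma zonal_reproducing:
  assumes n: "n \<ge> 3"
  shows "laplace n h = (\<lambda>a. 0) \<Longrightarrow> fischer n j (zonal n x j) h = zonal_const n j * fischer n j (mexp n x) h"
proof (induction j arbitrary: h)
  case 0 thus ?case by (simp add: fischer_def mindex_0 mfact_def mexp_def)
next
  case (Suc j)
  have "fischer n (Suc j) (zonal n x (Suc j)) h = rec_lead n j * fischer n (Suc j) (mulL n x (zonal n x j)) h"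
  proof (cases j)
    case 0
    have "rec_lead n 0 = 1" using n by (simp add: rec_lead_def)
    thus ?thesis using 0 by (simp del: zonal.simps(1))
  next
    case (Suc m)
    have "fischer n (Suc j) (mulSq n (zonal n x m)) h = 0"
      unfolding Suc fischer_mulSq \<open>laplace n h = _\<close> by (simp add: fischer_def)
    thus ?thesis unfolding Suc zonal.simps fischer_commute[of _ _ _ h] fischer_lin_right by simp
  qed
  also have "\<dots> = rec_lead n j * fischer n j (zonal n x j) (derivL n x h)"
    by (simp add: fischer_mulL)
  also have "fischer n j (zonal n x j) (derivL n x h) = zonal_const n j * fischer n j (mexp n x) (derivL n x h)"
  proof (rule Suc.IH)
    show "laplace n (derivL n x h) = (\<lambda>a. 0)"
      unfolding laplace_derivL Suc.prems by (simp add: fun_eq_iff derivL_def derivX_def)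
  qed
  finally show ?case by (simp add: fischer_mexp_derivL)
qed

definition zonal_feature :: "nat \<Rightarrow> nat \<Rightarrow> (nat \<Rightarrow> real) \<Rightarrow> (nat \<Rightarrow> nat) \<Rightarrow> real" where
  "zonal_feature n j x a = sqrt (mfact n a / zonal_const n j) * zonal n x j a"

text \<open>
  The reproducing property, applied to the zonal polynomial with pole \<open>y\<close>, which is harmonic
  itself, turns \<open>Q\<^sub>j (x \<bullet> y)\<close> into a positive multiple of the Fischer product of two zonal
  polynomials. So \<open>Q\<^sub>j\<close> is a positive semidefinite kernel on the sphere, and its rank is at most
  the number of monomials of degree \<open>j\<close>.
\<close>

theorem gegenbauer_kernel:
  assumes n: "n \<ge> 3" and x: "(\<Sum>i<n. x i * x i) = 1" and y: "(\<Sum>i<n. y i * y i) = 1"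
  shows "gegenbauer n j (\<Sum>i<n. x i * y i) = (\<Sum>a\<in>mindex n j. zonal_feature n j x a * zonal_feature n j y a)"
proof -
  have "zonal_const n j * gegenbauer n j (\<Sum>i<n. x i * y i) = fischer n j (zonal n x j) (zonal n y j)"
    using zonal_reproducing[OF n laplace_zonal[OF n y]] fischer_mexp_zonal[OF x] by simp
  moreover have "zonal_const n j > 0" by (rule zonal_const_pos[OF n])
  moreover have "mfact n a / zonal_const n j \<ge> 0" for a
    using zonal_const_pos[OF n, of j] by (auto simp: mfact_def intro!: divide_nonneg_pos prod_nonneg)
  hence "(\<Sum>a\<in>mindex n j. zonal_feature n j x a * zonal_feature n j y a)
      = fischer n j (zonal n x j) (zonal n y j) / zonal_const n j"
    unfolding fischer_def sum_divide_distrib zonal_feature_def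
    by (intro sum.cong refl) (simp add: algebra_simps flip: power2_eq_square)
  ultimately show ?thesis by (metis less_irrefl nonzero_mult_div_cancel_left)
qed

lemma rec_coeffs_Suc:
  assumes "n \<ge> 3"
  shows "rec_lead n (Suc m) = (2 * real m + real n) / (real m + real n - 1)"
    and "rec_trail n (Suc m) = (real m + 1) / (real m + real n - 1)"
  using assms by (simp_all add: rec_lead_def rec_trail_def algebra_simps)

lemma gegenbauer_1:
  assumes n: "n \<ge> 3"
  shows "gegenbauer n j 1 = 1"
proof (induction j rule: induct_nat_012)
  case (ge2 j)
  have "real j + real n - 1 \<noteq> 0" using n by auto
  hence "rec_lead n (Suc j) - rec_trail n (Suc j) = 1"
    unfolding rec_coeffs_Suc[OF n] diff_divide_distrib[symmetric] by simp
  thus ?case using ge2 by simp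
qed auto

lemma gegenbauer_recurrence:
  assumes "n \<ge> 3"
  shows "t * gegenbauer n j t = (real j + real n - 2) / (2 * real j + real n - 2) * gegenbauer n (Suc j) t
                       + real j / (2 * real j + real n - 2) * gegenbauer n (j - 1) t"
proof (cases j)
  case 0
  thus ?thesis using assms by simp
next
  case (Suc m)
  define N D where "N = real m + real n - 1" and "D = 2 * real m + real n"
  have ND: "N \<noteq> 0" "D \<noteq> 0" using assms by (auto simp: N_def D_def)
  have g: "rec_lead n (Suc m) = D / N" "rec_trail n (Suc m) = (real m + 1) / N"
    using rec_coeffs_Suc[OF assms, of m] by (auto simp: N_def D_def)
  have r: "real j + real n - 2 = N" "2 * real j + real n - 2 = D" "real j = real m + 1"
    by (auto simp: N_def D_def Suc)
  show ?thesis
    unfolding r(1,2) unfolding r(3) Suc gegenbauer.simps g using ND by (simp add: field_simps)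
qed

section \<open>The linear programming bound for spherical codes\<close>

text \<open>
  The product is a single term of the series \<open>(\<Sum>k. z ^ k) ^ n = (1 - z) powr - n\<close>, multiplied by
  the inverse of its sum. The choice \<open>z = \<rho> / (1 + \<rho>)\<close> at \<open>j = \<rho> n\<close> gives the rate \<open>kl_rate \<rho>\<close>.
\<close>

lemma card_mindex:
  assumes z: "0 < z" "z < 1"
  shows "real (card (mindex n j)) * z ^ j * (1 - z) ^ n \<le> 1"
proof (induction n arbitrary: j)
  case 0
  have "mindex 0 j \<subseteq> {\<lambda>_. 0}" by (auto simp: mindex_def)
  hence "card (mindex 0 j) \<le> 1" using card_mono[of "{\<lambda>_. 0}" "mindex 0 j"] by simp
  moreover have "z ^ j \<le> 1" using z by (simp add: power_le_one)
  ultimately have "real (card (mindex 0 j)) * z ^ j \<le> 1 * 1" using z by (intro mult_mono) auto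
  thus ?case by simp
next
  case (Suc n)
  have "mindex (Suc n) j \<subseteq> (\<Union>i\<in>{..j}. (\<lambda>a. a(n := i)) ` mindex n (j - i))"
  proof
    fix a assume a: "a \<in> mindex (Suc n) j"
    hence an: "a n \<le> j" by (rule mindex_le)
    have "a(n := 0) \<in> mindex n (j - a n)" using a by (auto simp: mindex_def)
    moreover have "a = (a(n := 0))(n := a n)" by simp
    ultimately show "a \<in> (\<Union>i\<in>{..j}. (\<lambda>a. a(n := i)) ` mindex n (j - i))" using an by blast
  qed
  hence "card (mindex (Suc n) j) \<le> card (\<Union>i\<in>{..j}. (\<lambda>a. a(n := i)) ` mindex n (j - i))"
    by (intro card_mono) (auto simp: finite_mindex)
  also have "\<dots> \<le> (\<Sum>i\<le>j. card ((\<lambda>a. a(n := i)) ` mindex n (j - i)))"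
    by (rule card_UN_le) auto
  also have "\<dots> \<le> (\<Sum>i\<le>j. card (mindex n (j - i)))"
    by (intro sum_mono card_image_le finite_mindex)
  finally have "real (card (mindex (Suc n) j)) \<le> (\<Sum>i\<le>j. real (card (mindex n (j - i))))"
    by (metis of_nat_le_iff of_nat_sum)
  hence "real (card (mindex (Suc n) j)) * (z ^ j * (1 - z) ^ Suc n)
      \<le> (\<Sum>i\<le>j. real (card (mindex n (j - i)))) * (z ^ j * (1 - z) ^ Suc n)"
    using z by (intro mult_right_mono) auto
  also have "\<dots> = (\<Sum>i\<le>j. (real (card (mindex n (j - i))) * z ^ (j - i) * (1 - z) ^ n) * (z ^ i * (1 - z)))"
    unfolding sum_distrib_right
  proof (rule sum.cong)
    fix i assume "i \<in> {..j}"
    hence "z ^ j = z ^ (j - i) * z ^ i" by (simp flip: power_add)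
    thus "real (card (mindex n (j - i))) * (z ^ j * (1 - z) ^ Suc n)
      = (real (card (mindex n (j - i))) * z ^ (j - i) * (1 - z) ^ n) * (z ^ i * (1 - z))"
      by simp
  qed simp
  also have "\<dots> \<le> (\<Sum>i\<le>j. 1 * (z ^ i * (1 - z)))"
    using z by (intro sum_mono mult_right_mono Suc.IH) auto
  also have "\<dots> = 1 - z ^ Suc j"
    unfolding mult_1 sum_distrib_right[symmetric] sum_gp0 using z by simp
  also have "\<dots> \<le> 1" using z by simp
  finally show ?case by (simp add: mult.assoc)
qed

lemma mindex_nonempty: "n > 0 \<Longrightarrow> mindex n j \<noteq> {}"
proof -
  assume "n > 0"
  hence "(\<lambda>i. if i = 0 then j else 0) \<in> mindex n j" by (auto simp: mindex_def)
  thus ?thesis by blast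
qed

lemma inner_euc: "x \<in> euc n \<Longrightarrow> inner x y = (\<Sum>i<n. coord x i * coord y i)"
  by (rule inner_fseq_superset) (auto simp: euc_def not_le[symmetric])

lemma sphere_inner: "x \<in> euc_sphere n \<Longrightarrow> inner x x = 1"
  by (simp add: euc_sphere_def norm_eq_sqrt_inner)

text \<open>
  The entrywise product of two Gram matrices is again a Gram matrix, in its tensor features; the
  total of its entries is a sum of squares.
\<close>

lemma gram_product_sum:
  fixes \<phi> \<psi> :: "'v \<Rightarrow> 'i \<Rightarrow> real"
  shows "(\<Sum>x\<in>V. \<Sum>y\<in>V. (\<Sum>a\<in>A. \<phi> x a * \<phi> y a) * (\<Sum>b\<in>B. \<psi> x b * \<psi> y b))
       = (\<Sum>a\<in>A. \<Sum>b\<in>B. (\<Sum>x\<in>V. \<phi> x a * \<psi> x b)\<^sup>2)"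
proof -
  have "(\<Sum>x\<in>V. \<Sum>y\<in>V. (\<Sum>a\<in>A. \<phi> x a * \<phi> y a) * (\<Sum>b\<in>B. \<psi> x b * \<psi> y b))
      = (\<Sum>x\<in>V. \<Sum>y\<in>V. \<Sum>a\<in>A. \<Sum>b\<in>B. (\<phi> x a * \<psi> x b) * (\<phi> y a * \<psi> y b))"
    by (simp add: sum_product mult_ac)
  also have "\<dots> = (\<Sum>a\<in>A. \<Sum>b\<in>B. \<Sum>x\<in>V. \<Sum>y\<in>V. (\<phi> x a * \<psi> x b) * (\<phi> y a * \<psi> y b))"
    by (simp add: sum.swap[of _ A V] sum.swap[of _ B V])
  finally show ?thesis by (simp add: power2_eq_square sum_product)
qed

lemma gegenbauer_inner:
  assumes "n \<ge> 3" "x \<in> euc_sphere n" "y \<in> euc_sphere n"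
  shows "gegenbauer n j (inner x y) = (\<Sum>a\<in>mindex n j. zonal_feature n j (coord x) a * zonal_feature n j (coord y) a)"
proof -
  have *: "x \<in> euc n" "y \<in> euc n" using assms by (auto simp: euc_sphere_def)
  show ?thesis unfolding inner_euc[OF *(1)]
    using assms sphere_inner inner_euc[OF *(1), of x] inner_euc[OF *(2), of y] by (intro gegenbauer_kernel) auto
qed

definition gegenbauer_sum :: "nat \<Rightarrow> fseq set \<Rightarrow> nat \<Rightarrow> nat \<Rightarrow> real" where
  "gegenbauer_sum n V i j = (\<Sum>x\<in>V. \<Sum>y\<in>V. gegenbauer n i (inner x y) * gegenbauer n j (inner x y))"

lemma gegenbauer_sum_squares:
  assumes "n \<ge> 3" "V \<subseteq> euc_sphere n"
  shows "gegenbauer_sum n V i j = (\<Sum>a\<in>mindex n i. \<Sum>b\<in>mindex n j.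
           (\<Sum>x\<in>V. zonal_feature n i (coord x) a * zonal_feature n j (coord x) b)\<^sup>2)"
  unfolding gegenbauer_sum_def gram_product_sum[symmetric]
  using assms by (intro sum.cong refl) (simp add: gegenbauer_inner subset_iff)

lemma gegenbauer_sum_nonneg: "n \<ge> 3 \<Longrightarrow> V \<subseteq> euc_sphere n \<Longrightarrow> gegenbauer_sum n V i j \<ge> 0"
  by (simp add: gegenbauer_sum_squares sum_nonneg)

text \<open>
  A positive semidefinite matrix with rank \<open>d\<close> and trace \<open>T\<close> has squared Frobenius norm at least
  \<open>T\<^sup>2 / d\<close>. In Delsarte's method this estimate takes the place of the constant term in the
  Gegenbauer expansion of \<open>Q\<^sub>i\<^sup>2\<close>.
\<close>

lemma gegenbauer_sum_diag:
  assumes "n \<ge> 3" "V \<subseteq> euc_sphere n"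
  shows "(real (card V))\<^sup>2 \<le> real (card (mindex n i)) * gegenbauer_sum n V i i"
proof -
  define f where "f a = (\<Sum>x\<in>V. zonal_feature n i (coord x) a * zonal_feature n i (coord x) a)" for a
  have "(\<Sum>a\<in>mindex n i. f a) = (\<Sum>x\<in>V. gegenbauer n i (inner x x))"
    unfolding f_def using assms by (subst sum.swap) (auto intro!: sum.cong simp: gegenbauer_inner subset_iff)
  also have "\<dots> = real (card V)"
    using sphere_inner[of _ n] assms by (simp add: gegenbauer_1 subset_iff)
  finally have "(real (card V))\<^sup>2 = (\<Sum>a\<in>mindex n i. 1 * f a)\<^sup>2" by simp
  also have "\<dots> \<le> (\<Sum>a\<in>mindex n i. 1\<^sup>2) * (\<Sum>a\<in>mindex n i. (f a)\<^sup>2)"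
    by (rule Cauchy_Schwarz_ineq_sum)
  also have "\<dots> \<le> real (card (mindex n i)) * gegenbauer_sum n V i i"
    unfolding gegenbauer_sum_squares[OF assms]
  proof (simp, intro mult_left_mono sum_mono)
    fix a assume a: "a \<in> mindex n i"
    show "(f a)\<^sup>2 \<le> (\<Sum>b\<in>mindex n i. (\<Sum>x\<in>V. zonal_feature n i (coord x) a * zonal_feature n i (coord x) b)\<^sup>2)"
      unfolding f_def using a finite_mindex
      by (intro member_le_sum[where f = "\<lambda>b. (\<Sum>x\<in>V. zonal_feature n i (coord x) a * zonal_feature n i (coord x) b)\<^sup>2"]) auto
  qed auto
  finally show ?thesis .
qed

definition jacobi_up :: "nat \<Rightarrow> nat \<Rightarrow> real" where
  "jacobi_up n j = (real j + real n - 2) / (2 * real j + real n - 2)"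

definition jacobi_down :: "nat \<Rightarrow> nat \<Rightarrow> real" where
  "jacobi_down n j = real j / (2 * real j + real n - 2)"

lemma gegenbauer_times: "n \<ge> 3 \<Longrightarrow> t * gegenbauer n j t = jacobi_up n j * gegenbauer n (Suc j) t + jacobi_down n j * gegenbauer n (j - 1) t"
  unfolding jacobi_up_def jacobi_down_def by (rule gegenbauer_recurrence)

text \<open>
  The coefficients of \<open>t * (\<Sum>i. g i * Q\<^sub>i t)\<close> in the basis of the \<open>Q\<^sub>i\<close>; up to normalisation, \<open>jacobi n\<close>
  is the Jacobi matrix of the Gegenbauer polynomials.
\<close>

definition jacobi :: "nat \<Rightarrow> (nat \<Rightarrow> real) \<Rightarrow> nat \<Rightarrow> real" where
  "jacobi n g i = (if i = 0 then 0 else jacobi_up n (i - 1) * g (i - 1)) + jacobi_down n (Suc i) * g (Suc i)"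

lemma gegenbauer_expansion_times:
  assumes n: "n \<ge> 3" and g0: "\<And>i. i \<ge> N \<Longrightarrow> g i = 0"
  shows "t * (\<Sum>i<N. g i * gegenbauer n i t) = (\<Sum>i<Suc N. jacobi n g i * gegenbauer n i t)"
proof -
  have "t * (\<Sum>i<N. g i * gegenbauer n i t) = (\<Sum>i<N. g i * (t * gegenbauer n i t))"
    by (simp add: sum_distrib_left mult_ac)
  also have "\<dots> = (\<Sum>i<N. jacobi_up n i * g i * gegenbauer n (Suc i) t) + (\<Sum>i<N. jacobi_down n i * g i * gegenbauer n (i - 1) t)"
    by (simp add: gegenbauer_times[OF n] distrib_left sum.distrib mult_ac)
  also have "(\<Sum>i<N. jacobi_up n i * g i * gegenbauer n (Suc i) t)
      = (\<Sum>i<Suc N. (if i = 0 then 0 else jacobi_up n (i - 1) * g (i - 1)) * gegenbauer n i t)"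
    by (subst sum.lessThan_Suc_shift) simp
  also have "(\<Sum>i<N. jacobi_down n i * g i * gegenbauer n (i - 1) t) = (\<Sum>i<Suc (Suc N). jacobi_down n i * g i * gegenbauer n (i - 1) t)"
    by (simp add: g0)
  also have "\<dots> = (\<Sum>i<Suc N. jacobi_down n (Suc i) * g (Suc i) * gegenbauer n i t)"
    by (subst sum.lessThan_Suc_shift) (simp add: jacobi_down_def)
  finally show ?thesis
    unfolding jacobi_def by (simp only: sum.distrib[symmetric] distrib_right)
qed

text \<open>
  Delsarte's method with the polynomial \<open>f t = (t - s) * (P t)\<^sup>2\<close>, where \<open>P = \<Sum>i. g i * Q\<^sub>i\<close>. Summed
  over all pairs of code points, \<open>f\<close> gives at most the diagonal contribution \<open>card V * f 1\<close>, as
  \<open>f \<le> 0\<close> on the other pairs. On the other hand the hypothesis on \<open>jacobi\<close> says that \<open>(t - s) * P\<close>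
  has coefficients at least \<open>\<eta> * g i \<ge> 0\<close>, so every product \<open>Q\<^sub>i Q\<^sub>j\<close> enters with a nonnegative
  weight and the products \<open>Q\<^sub>i\<^sup>2\<close> alone contribute \<open>\<eta> * (card V)\<^sup>2 * (\<Sum>i. (g i)\<^sup>2 / d\<^sub>i)\<close> with the
  ranks \<open>d\<^sub>i\<close>. The Cauchy-Schwarz inequality compares this with \<open>f 1 = (1 - s) * (\<Sum>i. g i)\<^sup>2\<close>.
\<close>

theorem linear_programming_bound:
  assumes n: "n \<ge> 3" and V: "finite V" "V \<subseteq> euc_sphere n"
    and s: "\<And>x y. x \<in> V \<Longrightarrow> y \<in> V \<Longrightarrow> x \<noteq> y \<Longrightarrow> inner x y \<le> s"
    and g: "\<And>i. g i \<ge> 0" "\<And>i. i \<notin> I \<Longrightarrow> g i = 0" and I: "finite I" "i0 \<in> I" "g i0 > 0"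
    and \<eta>: "\<eta> > 0" "\<And>i. jacobi n g i \<ge> (s + \<eta>) * g i" and s1: "s \<le> 1"
  shows "real (card V) \<le> (1 - s) / \<eta> * (\<Sum>i\<in>I. real (card (mindex n i)))"
proof (cases "V = {}")
  case True
  thus ?thesis using s1 \<eta>(1) by (simp add: sum_nonneg)
next
  case False
  define M where "M = real (card V)"
  have M: "M > 0" using False V by (simp add: M_def card_gt_0_iff)
  define D where "D i = real (card (mindex n i))" for i
  have D: "D i > 0" for i
    unfolding D_def using mindex_nonempty[of n i] n finite_mindex by (simp add: card_gt_0_iff)
  obtain N where N: "\<And>i. i \<in> I \<Longrightarrow> i < N"
    using finite_nat_set_iff_bounded[of I] I by auto
  have gN: "g i = 0" if "i \<ge> N" for i using N[of i] g(2)[of i] that by fastforce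
  define P where "P t = (\<Sum>i<N. g i * gegenbauer n i t)" for t
  define h where "h i = jacobi n g i - s * g i" for i
  have h: "h i \<ge> \<eta> * g i" for i using \<eta>(2)[of i] unfolding h_def by (simp add: algebra_simps)
  have h0: "h i \<ge> 0" for i using h[of i] \<eta>(1) g(1)[of i] by (smt (verit) mult_nonneg_nonneg)
  have hP: "(t - s) * P t = (\<Sum>i<Suc N. h i * gegenbauer n i t)" for t
  proof -
    have "s * P t = (\<Sum>i<Suc N. s * g i * gegenbauer n i t)"
      by (simp add: P_def gN sum_distrib_left mult_ac)
    thus ?thesis unfolding h_def left_diff_distrib sum_subtractf
      by (simp only: P_def gegenbauer_expansion_times[OF n gN])
  qed
  define W where "W = (\<Sum>x\<in>V. \<Sum>y\<in>V. (inner x y - s) * (P (inner x y))\<^sup>2)"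
  have up: "W \<le> M * ((1 - s) * (\<Sum>i<N. g i)\<^sup>2)"
  proof -
    have "(\<Sum>y\<in>V. (inner x y - s) * (P (inner x y))\<^sup>2) \<le> (1 - s) * (\<Sum>i<N. g i)\<^sup>2" if x: "x \<in> V" for x
    proof -
      have "(\<Sum>y\<in>V - {x}. (inner x y - s) * (P (inner x y))\<^sup>2) \<le> 0"
        using s x by (intro sum_nonpos mult_nonpos_nonneg) auto
      moreover have "(inner x x - s) * (P (inner x x))\<^sup>2 = (1 - s) * (\<Sum>i<N. g i)\<^sup>2"
        using sphere_inner[of x n] V(2) x by (simp add: P_def gegenbauer_1[OF n] subset_iff)
      ultimately show ?thesis using V(1) x by (subst sum.remove[of _ x]) auto
    qed
    hence "W \<le> (\<Sum>x\<in>V. (1 - s) * (\<Sum>i<N. g i)\<^sup>2)" unfolding W_def by (rule sum_mono)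
    thus ?thesis by (simp add: M_def)
  qed
  have "W = (\<Sum>x\<in>V. \<Sum>y\<in>V. (\<Sum>i<Suc N. h i * gegenbauer n i (inner x y)) * (\<Sum>j<N. g j * gegenbauer n j (inner x y)))"
    unfolding W_def power2_eq_square mult.assoc[symmetric] hP by (simp only: P_def)
  also have "\<dots> = (\<Sum>x\<in>V. \<Sum>y\<in>V. \<Sum>i<Suc N. \<Sum>j<N. h i * g j * (gegenbauer n i (inner x y) * gegenbauer n j (inner x y)))"
    unfolding sum_product by (simp only: mult_ac)
  also have "\<dots> = (\<Sum>i<Suc N. \<Sum>j<N. h i * g j * gegenbauer_sum n V i j)"
    unfolding gegenbauer_sum_def sum_distrib_left
    by (simp only: sum.swap[of _ "{..<Suc N}" V] sum.swap[of _ "{..<N}" V])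
  also have "\<dots> \<ge> (\<Sum>i<N. \<Sum>j<N. h i * g j * gegenbauer_sum n V i j)"
    using h0 g(1) gegenbauer_sum_nonneg[OF n V(2)] by (simp add: sum_nonneg)
  finally have "W \<ge> (\<Sum>i<N. \<Sum>j<N. h i * g j * gegenbauer_sum n V i j)" .
  moreover have "(\<Sum>j<N. h i * g j * gegenbauer_sum n V i j) \<ge> \<eta> * ((g i)\<^sup>2 / D i) * M\<^sup>2" if i: "i < N" for i
  proof -
    have "M\<^sup>2 / D i \<le> gegenbauer_sum n V i i"
      using gegenbauer_sum_diag[OF n V(2), of i] D[of i] by (simp add: M_def D_def pos_divide_le_eq mult.commute)
    hence "(\<eta> * g i * g i) * (M\<^sup>2 / D i) \<le> (h i * g i) * gegenbauer_sum n V i i"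
      using h[of i] g(1)[of i] D[of i] \<eta>(1) h0[of i] by (intro mult_mono mult_right_mono) auto
    also have "\<dots> \<le> (\<Sum>j<N. h i * g j * gegenbauer_sum n V i j)"
      using i h0 g(1) gegenbauer_sum_nonneg[OF n V(2)]
      by (intro member_le_sum[where f = "\<lambda>j. h i * g j * gegenbauer_sum n V i j"]) auto
    finally show ?thesis by (simp add: power2_eq_square)
  qed
  hence "(\<Sum>i<N. \<eta> * ((g i)\<^sup>2 / D i) * M\<^sup>2) \<le> (\<Sum>i<N. \<Sum>j<N. h i * g j * gegenbauer_sum n V i j)"
    by (intro sum_mono) auto
  ultimately have low: "\<eta> * (\<Sum>i<N. (g i)\<^sup>2 / D i) * M\<^sup>2 \<le> W"
    by (simp add: sum_distrib_left sum_distrib_right)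
  have sub: "I \<subseteq> {..<N}" using N by auto
  have e1: "(\<Sum>i<N. (g i)\<^sup>2 / D i) = (\<Sum>i\<in>I. (g i)\<^sup>2 / D i)"
    and e2: "(\<Sum>i<N. g i) = (\<Sum>i\<in>I. g i)"
    using sub g(2) by (auto intro!: sum.mono_neutral_right)
  define G where "G = (\<Sum>i\<in>I. (g i)\<^sup>2 / D i)"
  have "(g i0)\<^sup>2 / D i0 \<le> G" unfolding G_def using I D
    by (intro member_le_sum[where f = "\<lambda>i. (g i)\<^sup>2 / D i"]) (auto intro!: divide_nonneg_pos)
  hence G: "G > 0" using I(3) D[of i0] by (smt (verit) divide_pos_pos zero_less_power)
  have CS: "(\<Sum>i\<in>I. g i)\<^sup>2 \<le> G * (\<Sum>i\<in>I. D i)"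
  proof -
    have "(\<Sum>i\<in>I. g i)\<^sup>2 = (\<Sum>i\<in>I. (g i / sqrt (D i)) * sqrt (D i))\<^sup>2"
      using D by (simp add: less_imp_neq[symmetric])
    also have "\<dots> \<le> (\<Sum>i\<in>I. (g i / sqrt (D i))\<^sup>2) * (\<Sum>i\<in>I. (sqrt (D i))\<^sup>2)"
      by (rule Cauchy_Schwarz_ineq_sum)
    also have "\<dots> = G * (\<Sum>i\<in>I. D i)"
      unfolding G_def using D by (simp add: power_divide less_imp_le)
    finally show ?thesis .
  qed
  have "(\<eta> * M) * (G * M) \<le> W" using low e1 by (simp add: G_def power2_eq_square mult_ac)
  also have "\<dots> \<le> M * ((1 - s) * (G * (\<Sum>i\<in>I. D i)))"
    using up CS M s1 unfolding e2
    by (meson diff_ge_0_iff_ge less_eq_real_def mult_left_mono order_trans)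
  finally have "(\<eta> * M) * (G * M) \<le> ((1 - s) * (\<Sum>i\<in>I. D i)) * (G * M)" by (simp add: mult_ac)
  hence "\<eta> * M \<le> (1 - s) * (\<Sum>i\<in>I. D i)" using G M by (simp only: mult_le_cancel_right) (auto simp: zero_less_mult_iff)
  thus ?thesis using \<eta>(1) unfolding M_def D_def by (simp add: field_simps)
qed

section \<open>The Kabatiansky-Levenshtein bound\<close>

text \<open>
  The exponential growth rate, as \<open>n \<rightarrow> \<infinity>\<close>, of the number of monomials of degree \<open>\<rho> n\<close> in \<open>n\<close>
  variables.
\<close>

definition kl_rate :: "real \<Rightarrow> real" where
  "kl_rate \<rho> = (1 + \<rho>) * ((1 + \<rho>) / \<rho>) powr \<rho>"

text \<open>
  Near the index \<open>\<rho> n\<close> the two off-diagonals of the Jacobi matrix are almost constant, and after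
  conjugation with the powers of \<open>r\<close> both become \<open>c0 = sqrt (\<rho> (1 + \<rho>)) / (1 + 2 \<rho>)\<close>. On a window of
  fixed length \<open>L\<close> the matrix is therefore close to \<open>c0\<close> times the adjacency matrix of a path, whose
  positive eigenvector is a sine wave with eigenvalue \<open>2 cos (\<pi> / (L + 1))\<close>. For large \<open>L\<close> the product
  \<open>2 c0 cos (\<pi> / (L + 1))\<close> exceeds \<open>s\<close>, and the sine wave is the weight vector \<open>g\<close> of
  \<open>linear_programming_bound\<close>. The ranks that occur are those near degree \<open>\<rho> n\<close>.
\<close>

theorem kabatiansky_levenshtein:
  assumes \<rho>: "\<rho> > 0" and s: "0 \<le> s" "s < 2 * sqrt (\<rho> * (1 + \<rho>)) / (1 + 2 * \<rho>)"
  shows "\<exists>C>0. \<forall>\<^sub>F n in sequentially. \<forall>V. finite V \<longrightarrow> V \<subseteq> euc_sphere n \<longrightarrow>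
           (\<forall>x\<in>V. \<forall>y\<in>V. x \<noteq> y \<longrightarrow> inner x y \<le> s) \<longrightarrow> real (card V) \<le> C * kl_rate \<rho> ^ n"
proof -
  define c0 where "c0 = sqrt (\<rho> * (1 + \<rho>)) / (1 + 2 * \<rho>)"
  define r where "r = sqrt ((1 + \<rho>) / \<rho>)"
  have r: "r > 0" "r\<^sup>2 = (1 + \<rho>) / \<rho>" using \<rho> by (auto simp: r_def)
  have c0r: "c0 * r = (1 + \<rho>) / (1 + 2 * \<rho>)" "c0 / r = \<rho> / (1 + 2 * \<rho>)"
  proof -
    have "sqrt (\<rho> * (1 + \<rho>)) * r = sqrt ((1 + \<rho>)\<^sup>2)"
      unfolding r_def real_sqrt_mult[symmetric] using \<rho> by (simp add: power2_eq_square)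
    thus "c0 * r = (1 + \<rho>) / (1 + 2 * \<rho>)" using \<rho> by (simp add: c0_def)
    have "sqrt (\<rho> * (1 + \<rho>)) / r = sqrt (\<rho>\<^sup>2)"
      unfolding r_def real_sqrt_divide[symmetric] using \<rho> by (simp add: power2_eq_square)
    moreover have "c0 / r = (sqrt (\<rho> * (1 + \<rho>)) / r) / (1 + 2 * \<rho>)" by (simp add: c0_def)
    ultimately show "c0 / r = \<rho> / (1 + 2 * \<rho>)" using \<rho> by simp
  qed
  have "s / 2 < c0" using s(2) by (simp add: c0_def mult.commute)
  then obtain a where a: "s / 2 < a" "a < c0" using dense by blast
  have a0: "a > 0" using a s by auto
  have "((\<lambda>L. 2 * a * cos (pi / real (Suc L))) \<longlongrightarrow> 2 * a * cos 0) sequentially"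
    by (intro tendsto_intros LIMSEQ_Suc[OF lim_const_over_n])
  hence "\<forall>\<^sub>F L in sequentially. 2 * a * cos (pi / real (Suc L)) > s"
    using a by (intro order_tendstoD(1)[where y = "2 * a * cos 0"]) auto
  then obtain L where L: "2 * a * cos (pi / real (Suc L)) > s" "L \<ge> 1"
    using eventually_ge_at_top[of 1] by (metis (no_types, lifting) eventually_conj eventually_happens sequentially_bot)
  define w where "w = pi / real (Suc L)"
  define \<eta> where "\<eta> = 2 * a * cos w - s"
  have \<eta>: "\<eta> > 0" using L by (simp add: \<eta>_def w_def)
  define \<gamma> where "\<gamma> m = sin (w * real m)" for m :: nat
  have \<gamma>0: "\<gamma> 0 = 0" "\<gamma> (Suc L) = 0" by (auto simp: \<gamma>_def w_def)
  have \<gamma>nn: "\<gamma> m \<ge> 0" if "m \<le> Suc L" for m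
  proof -
    have "pi * real m \<le> pi * real (Suc L)" using that by (intro mult_left_mono) auto
    hence "w * real m \<le> pi" by (simp add: w_def pos_divide_le_eq)
    thus ?thesis unfolding \<gamma>_def by (intro sin_ge_zero) (auto simp: w_def)
  qed
  have \<gamma>1: "\<gamma> 1 > 0"
  proof -
    have "w < pi" using L(2) pi_gt_zero by (simp add: w_def divide_less_eq)
    thus ?thesis unfolding \<gamma>_def by (intro sin_gt_zero) (auto simp: w_def)
  qed
  have \<gamma>rec: "\<gamma> (m - 1) + \<gamma> (Suc m) = 2 * cos w * \<gamma> m" if "m \<ge> 1" for m
  proof -
    have e: "w * real (m - 1) = w * real m - w" "w * real (Suc m) = w * real m + w"
      using that by (auto simp: algebra_simps of_nat_diff)
    show ?thesis unfolding \<gamma>_def e sin_diff sin_add by simp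
  qed
  define \<delta> where "\<delta> = 1 + \<rho> - a * r * (1 + 2 * \<rho>)"
  have ar: "a * r < (1 + \<rho>) / (1 + 2 * \<rho>)" using a r(1) c0r(1) by (metis mult_less_cancel_right_pos)
  hence \<delta>: "\<delta> > 0" using \<rho> by (simp add: \<delta>_def field_simps)
  have "(1 + \<rho>) / (1 + 2 * \<rho>) < 1" using \<rho> by simp
  hence ar1: "0 < a * r" "a * r < 1" using ar a0 r(1) by auto
  have adr: "a / r < \<rho> / (1 + 2 * \<rho>)" 
    unfolding c0r(2)[symmetric] using a r(1) by (simp add: divide_strict_right_mono)
  hence adr': "(a / r) * (1 + 2 * \<rho>) < \<rho>" using \<rho> by (simp add: field_simps)
  have "\<rho> / (1 + 2 * \<rho>) < 1 / 2" using \<rho> by simp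
  hence adr2: "0 < a / r" "a / r < 1 / 2" using adr a0 r(1) by (simp, linarith)
  define C where "C = (1 - s) / \<eta> * real L * (r\<^sup>2) ^ (L + 1)"
  have s1: "s < 1"
  proof -
    have "sqrt (\<rho> * (1 + \<rho>)) < sqrt ((\<rho> + 1 / 2)\<^sup>2)"
      by (rule real_sqrt_less_mono) (simp add: power2_eq_square algebra_simps)
    hence "2 * sqrt (\<rho> * (1 + \<rho>)) < 1 + 2 * \<rho>" using \<rho> by simp
    hence "2 * sqrt (\<rho> * (1 + \<rho>)) / (1 + 2 * \<rho>) < 1" using \<rho> by simp
    thus ?thesis using s(2) by simp
  qed
  have C: "C > 0" unfolding C_def using s1 \<eta> L(2) r(1) by (intro mult_pos_pos divide_pos_pos) auto
  have "\<forall>\<^sub>F n in sequentially. real n \<ge> (real L + 4) / \<delta>"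
    by (rule eventually_compose_filterlim[OF eventually_ge_at_top filterlim_real_sequentially])
  hence ev: "\<forall>\<^sub>F n in sequentially. real L + 4 \<le> \<delta> * real n \<and> n \<ge> 3"
    using eventually_ge_at_top[of "3::nat"]
    by eventually_elim (use \<delta> in \<open>simp add: field_simps\<close>)
  have "\<forall>\<^sub>F n in sequentially. \<forall>V. finite V \<longrightarrow> V \<subseteq> euc_sphere n \<longrightarrow>
           (\<forall>x\<in>V. \<forall>y\<in>V. x \<noteq> y \<longrightarrow> inner x y \<le> s) \<longrightarrow> real (card V) \<le> C * kl_rate \<rho> ^ n"
    using ev
  proof (eventually_elim, intro allI impI, elim conjE)
    fix n V
    assume nL: "real L + 4 \<le> \<delta> * real n" and n: "n \<ge> 3" and V: "finite V" "V \<subseteq> euc_sphere n"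
      and code: "\<forall>x\<in>V. \<forall>y\<in>V. x \<noteq> y \<longrightarrow> inner x y \<le> s"
    define k where "k = nat \<lceil>\<rho> * real n\<rceil>"
    have k: "\<rho> * real n \<le> real k" "real k \<le> \<rho> * real n + 1"
      unfolding k_def using \<rho> by (auto simp: real_nat_ceiling_ge)
    \<comment> \<open>The sine vanishes at both ends \<open>k\<close> and \<open>k + L + 1\<close>, so \<open>g\<close> is supported on \<open>I\<close>.\<close>
    define g where "g i = (if k \<le> i \<and> i \<le> k + Suc L then r ^ i * \<gamma> (i - k) else 0)" for i
    define I where "I = {Suc k..k + L}"
    have gI: "g i = 0" if "i \<notin> I" for i
    proof -
      have "i = k \<or> i = k + Suc L \<or> \<not> (k \<le> i \<and> i \<le> k + Suc L)" using that by (auto simp: I_def)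
      thus ?thesis unfolding g_def using \<gamma>0 by auto
    qed
    have gnn: "g i \<ge> 0" for i unfolding g_def using r(1) \<gamma>nn[of "i - k"] by auto
    have up: "jacobi_up n i \<ge> a * r" if i: "k \<le> i" "i \<le> k + Suc L" for i
    proof -
      define e where "e = real i - \<rho> * real n"
      have e: "0 \<le> e" "e \<le> real L + 2" using i k by (auto simp: e_def)
      have "e * (2 * (a * r) - 1) \<le> e" using e ar1 mult_left_mono[of "2 * (a * r) - 1" 1 e] by simp
      hence "0 \<le> \<delta> * real n - 2 * (1 - a * r) - e * (2 * (a * r) - 1)"
      proof -
        have "0 \<le> y - 2 * (1 - q) - x"
          if "x \<le> e" "q > 0" "real L + 4 \<le> y" for x q y :: real
          using e that by argo
        thus ?thesis using \<open>e * _ \<le> e\<close> ar1(1) nL by blast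
      qed
      also have "\<dots> = (real i + real n - 2) - a * r * (2 * real i + real n - 2)"
        unfolding \<delta>_def e_def by (simp add: algebra_simps)
      finally show ?thesis unfolding jacobi_up_def using n by (simp add: pos_le_divide_eq)
    qed
    have down: "jacobi_down n i \<ge> a / r" if i: "k \<le> i" for i
    proof -
      have "(a / r) * real n * (1 + 2 * \<rho>) \<le> \<rho> * real n"
        using adr' mult_right_mono[of "(a / r) * (1 + 2 * \<rho>)" \<rho> "real n"] by (simp add: mult_ac)
      hence "(a / r) * real n \<le> \<rho> * real n * (1 - 2 * (a / r))" by (simp add: algebra_simps)
      also have "\<dots> \<le> real i * (1 - 2 * (a / r))"
      proof (rule mult_right_mono)
        show "\<rho> * real n \<le> real i" using k i by linarith
        show "0 \<le> 1 - 2 * (a / r)" using adr2 by linarith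
      qed
      finally have "(a / r) * real n \<le> real i * (1 - 2 * (a / r))" .
      moreover have "b * (2 * x + y - 2) \<le> x" if "b * y \<le> x * (1 - 2 * b)" "b > 0" for b x y :: real
        using that by (simp add: algebra_simps)
      ultimately have "(a / r) * (2 * real i + real n - 2) \<le> real i" using adr2(1) by blast
      thus ?thesis unfolding jacobi_down_def using n by (simp add: pos_le_divide_eq)
    qed
    have jnn: "jacobi_up n i \<ge> 0" "jacobi_down n i \<ge> 0" for i using n by (auto simp: jacobi_up_def jacobi_down_def)
    have jac: "jacobi n g i \<ge> (s + \<eta>) * g i" for i
    proof (cases "i \<in> I")
      case False
      thus ?thesis using gI gnn jnn by (simp add: jacobi_def)
    next
      case True
      define m where "m = i - k"
      have m: "i = k + m" "1 \<le> m" "m \<le> L" using True by (auto simp: m_def I_def)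
      have g1: "g (i - 1) = r ^ (i - 1) * \<gamma> (m - 1)" "g (Suc i) = r ^ Suc i * \<gamma> (Suc m)" "g i = r ^ i * \<gamma> m"
        unfolding g_def using m by auto
      have "(s + \<eta>) * g i = r ^ i * (a * (2 * cos w * \<gamma> m))"
        unfolding g1 \<eta>_def by simp
      also have "\<dots> = r ^ i * a * \<gamma> (m - 1) + r ^ i * a * \<gamma> (Suc m)"
        unfolding \<gamma>rec[OF m(2), symmetric] by (simp add: algebra_simps)
      also have "r ^ i * a * \<gamma> (m - 1) = (a * r) * g (i - 1)"
      proof -
        have "r ^ i = r * r ^ (i - 1)" using m by (subst power_Suc[symmetric]) simp
        thus ?thesis unfolding g1 by simp
      qed
      also have "r ^ i * a * \<gamma> (Suc m) = (a / r) * g (Suc i)"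
        unfolding g1 using r(1) by simp
      also have "(a * r) * g (i - 1) + (a / r) * g (Suc i) \<le> jacobi_up n (i - 1) * g (i - 1) + jacobi_down n (Suc i) * g (Suc i)"
        using m by (intro add_mono mult_right_mono up down gnn) auto
      also have "\<dots> = jacobi n g i" using m by (simp add: jacobi_def)
      finally show ?thesis .
    qed
    have "real (card V) \<le> (1 - s) / \<eta> * (\<Sum>i\<in>I. real (card (mindex n i)))"
    proof (rule linear_programming_bound[OF n V])
      show "Suc k \<in> I" using L(2) by (auto simp: I_def)
      show "g (Suc k) > 0" using \<gamma>1 r(1) by (simp add: g_def)
      show "finite I" by (simp add: I_def)
    qed (use code gnn gI \<eta> jac s1 in auto)
    also have "\<dots> \<le> (1 - s) / \<eta> * (\<Sum>i\<in>I. kl_rate \<rho> ^ n * (r\<^sup>2) ^ (L + 1))"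
    proof (intro mult_left_mono sum_mono)
      fix i assume i: "i \<in> I"
      have r1: "r\<^sup>2 \<ge> 1" unfolding r using \<rho> by simp
      have "real (card (mindex n i)) * (\<rho> / (1 + \<rho>)) ^ i * (1 - \<rho> / (1 + \<rho>)) ^ n \<le> 1"
        using \<rho> by (intro card_mindex) auto
      also have "1 - \<rho> / (1 + \<rho>) = inverse (1 + \<rho>)" using \<rho> by (simp add: field_simps)
      also have "\<rho> / (1 + \<rho>) = inverse (r\<^sup>2)" unfolding r by (simp add: inverse_eq_divide)
      finally have "real (card (mindex n i)) \<le> (r\<^sup>2) ^ i * (1 + \<rho>) ^ n"
        using r(1) \<rho> by (simp add: field_simps power_inverse)
      also have "(r\<^sup>2) ^ i \<le> (r\<^sup>2) powr (\<rho> * real n + (real L + 1))"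
      proof -
        have "real i \<le> \<rho> * real n + (real L + 1)" using i k by (auto simp: I_def)
        hence "(r\<^sup>2) powr (real i) \<le> (r\<^sup>2) powr (\<rho> * real n + (real L + 1))" using r1 by (intro powr_mono) auto
        thus ?thesis using r(1) by (simp add: powr_realpow)
      qed
      also have "\<dots> = ((r\<^sup>2) powr \<rho>) ^ n * (r\<^sup>2) ^ (L + 1)"
      proof -
        have "(r\<^sup>2) powr (\<rho> * real n) = ((r\<^sup>2) powr \<rho>) ^ n"
          using r(1) by (simp add: powr_powr[symmetric] powr_realpow)
        moreover have "(r\<^sup>2) powr (real L + 1) = (r\<^sup>2) ^ (L + 1)"
          using r(1) powr_realpow[of "r\<^sup>2" "L + 1"] by (simp add: add.commute)
        ultimately show ?thesis by (simp add: powr_add)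
      qed
      finally have "real (card (mindex n i)) \<le> ((r\<^sup>2) powr \<rho>) ^ n * (r\<^sup>2) ^ (L + 1) * (1 + \<rho>) ^ n"
        using \<rho> by (auto intro: mult_right_mono)
      also have "\<dots> = kl_rate \<rho> ^ n * (r\<^sup>2) ^ (L + 1)"
        unfolding kl_rate_def r(2)[symmetric] by (simp add: power_mult_distrib)
      finally show "real (card (mindex n i)) \<le> kl_rate \<rho> ^ n * (r\<^sup>2) ^ (L + 1)" .
    qed (use s1 \<eta> in auto)
    also have "\<dots> = C * kl_rate \<rho> ^ n" by (simp add: C_def I_def)
    finally show "real (card V) \<le> C * kl_rate \<rho> ^ n" .
  qed
  thus ?thesis using C by blast
qed

section \<open>Integer points in balls\<close>

lemma euc_add: "x \<in> euc n \<Longrightarrow> y \<in> euc n \<Longrightarrow> x + y \<in> euc n"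
  and euc_diff: "x \<in> euc n \<Longrightarrow> y \<in> euc n \<Longrightarrow> x - y \<in> euc n"
  and euc_scaleR: "x \<in> euc n \<Longrightarrow> c *\<^sub>R x \<in> euc n"
  and euc_uminus: "x \<in> euc n \<Longrightarrow> - x \<in> euc n"
  and euc_0: "0 \<in> euc n"
  by (auto simp: euc_def)

lemma euc_sgn: "x \<in> euc n \<Longrightarrow> sgn x \<in> euc n"
  by (simp add: sgn_div_norm euc_scaleR)

lemma norm_euc: "x \<in> euc n \<Longrightarrow> (norm x)\<^sup>2 = (\<Sum>i<n. (coord x i)\<^sup>2)"
  unfolding power2_norm_eq_inner by (simp add: inner_euc power2_eq_square)

lemma coord_le_norm: "\<bar>coord x i\<bar> \<le> norm x"
proof -
  have "(coord x i)\<^sup>2 \<le> inner x x"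
  proof (cases "coord x i = 0")
    case False
    have "coord x i * coord x i \<le> (\<Sum>i | coord x i \<noteq> 0. coord x i * coord x i)"
      using False finite_coord by (intro member_le_sum) auto
    thus ?thesis by (simp add: inner_fseq_def power2_eq_square)
  qed simp
  hence "\<bar>coord x i\<bar>\<^sup>2 \<le> (norm x)\<^sup>2" by (simp add: power2_norm_eq_inner)
  thus ?thesis by (rule power2_le_imp_le) simp
qed

lemma norm_le_dim:
  assumes "x \<in> euc n" "\<And>i. \<bar>coord x i\<bar> \<le> 1"
  shows "norm x \<le> real n"
proof -
  have "(norm x)\<^sup>2 \<le> (\<Sum>i<n. 1)"
    unfolding norm_euc[OF assms(1)] using assms(2) by (intro sum_mono) (simp add: abs_square_le_1)
  also have "\<dots> \<le> (real n)\<^sup>2" by (cases n) (auto simp: power2_eq_square)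
  finally show ?thesis by (rule power2_le_imp_le) simp
qed

definition euc_vec :: "nat \<Rightarrow> (nat \<Rightarrow> real) \<Rightarrow> fseq" where
  "euc_vec n f = Abs_fseq (\<lambda>i. if i < n then f i else 0)"

lemma coord_euc_vec: "coord (euc_vec n f) i = (if i < n then f i else 0)"
  unfolding euc_vec_def by (rule coord_Abs_fseq, rule finite_subset[of _ "{..<n}"]) auto

lemma euc_vec_in: "euc_vec n f \<in> euc n"
  by (simp add: euc_def coord_euc_vec)

definition round_down :: "nat \<Rightarrow> fseq \<Rightarrow> fseq" where
  "round_down n x = euc_vec n (\<lambda>i. of_int \<lfloor>coord x i\<rfloor>)"

lemma round_down_in: "round_down n x \<in> euc n"
  by (simp add: round_down_def euc_vec_in)

lemma round_down_Ints: "coord (round_down n x) i \<in> \<int>"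
  by (simp add: round_down_def coord_euc_vec)

lemma coord_zero_euc: "x \<in> euc n \<Longrightarrow> \<not> i < n \<Longrightarrow> coord x i = 0"
  by (simp add: euc_def)

lemma norm_round_down:
  assumes "x \<in> euc n"
  shows "norm (round_down n x - x) \<le> real n"
proof (rule norm_le_dim)
  fix i
  have "\<bar>of_int \<lfloor>coord x i\<rfloor> - coord x i\<bar> \<le> 1" by linarith
  thus "\<bar>coord (round_down n x - x) i\<bar> \<le> 1"
    using coord_zero_euc[OF assms, of i] by (simp add: round_down_def coord_euc_vec)
qed (use assms in \<open>auto intro: euc_diff round_down_in\<close>)

text \<open>
  The number of integer points in a large ball plays the part of its volume.
\<close>

definition int_points :: "nat \<Rightarrow> real \<Rightarrow> fseq set" where
  "int_points n R = {z \<in> euc n. (\<forall>i. coord z i \<in> \<int>) \<and> norm z \<le> R}"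

lemma finite_card_int_points:
  assumes "R \<ge> 0"
  shows "finite (int_points n R) \<and> real (card (int_points n R)) \<le> (2 * R + 1) ^ n"
proof -
  define F where "F = {..<n} \<rightarrow>\<^sub>E {-\<lfloor>R\<rfloor>..\<lfloor>R\<rfloor>}"
  have fin: "finite F" unfolding F_def by (intro finite_PiE) auto
  have sub: "int_points n R \<subseteq> (\<lambda>f. euc_vec n (\<lambda>i. of_int (f i))) ` F"
  proof
    fix z assume z: "z \<in> int_points n R"
    define f where "f = (\<lambda>i\<in>{..<n}. \<lfloor>coord z i\<rfloor>)"
    have "\<bar>coord z i\<bar> \<le> R" for i using coord_le_norm[of z i] z by (simp add: int_points_def)
    hence b: "coord z i \<le> R" "- R \<le> coord z i" for i by (simp_all add: abs_le_iff minus_le_iff)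
    have "\<lfloor>coord z i\<rfloor> \<in> {-\<lfloor>R\<rfloor>..\<lfloor>R\<rfloor>}" for i
    proof -
      obtain k where k: "coord z i = of_int k" using z by (auto simp: int_points_def elim: Ints_cases)
      have "k \<le> \<lfloor>R\<rfloor>" "- k \<le> \<lfloor>R\<rfloor>" using b[of i] k by (auto simp: le_floor_iff)
      thus ?thesis using k by auto
    qed
    hence "f \<in> F" unfolding F_def f_def by auto
    moreover have "z = euc_vec n (\<lambda>i. of_int (f i))"
    proof (rule fseq_eqI)
      fix i
      have "coord z i \<in> \<int>" "i \<ge> n \<Longrightarrow> coord z i = 0" using z by (auto simp: int_points_def euc_def)
      thus "coord z i = coord (euc_vec n (\<lambda>i. of_int (f i))) i"
        by (auto simp: coord_euc_vec f_def)
    qed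
    ultimately show "z \<in> (\<lambda>f. euc_vec n (\<lambda>i. of_int (f i))) ` F" by blast
  qed
  have "card (int_points n R) \<le> card F"
    using card_mono[OF finite_imageI[OF fin] sub] card_image_le[OF fin] le_trans by blast
  also have "card F = nat (2 * \<lfloor>R\<rfloor> + 1) ^ n"
    unfolding F_def by (subst card_PiE) (auto simp: algebra_simps)
  finally have "real (card (int_points n R)) \<le> real (nat (2 * \<lfloor>R\<rfloor> + 1)) ^ n"
    by (metis of_nat_le_iff of_nat_power)
  also have "\<dots> \<le> (2 * R + 1) ^ n"
  proof (rule power_mono)
    have "\<lfloor>R\<rfloor> \<ge> 0" using assms by simp
    hence "real (nat (2 * \<lfloor>R\<rfloor> + 1)) = 2 * of_int \<lfloor>R\<rfloor> + 1" by simp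
    thus "real (nat (2 * \<lfloor>R\<rfloor> + 1)) \<le> 2 * R + 1" by linarith
  qed simp
  finally show ?thesis using finite_subset[OF sub finite_imageI[OF fin]] by simp
qed

lemma finite_int_points: "finite (int_points n R)"
proof (cases "R \<ge> 0")
  case False
  have "int_points n R = {}" using False by (auto simp: int_points_def intro: order_trans[OF norm_ge_zero])
  thus ?thesis by simp
qed (use finite_card_int_points in auto)

lemma card_int_points_le: "R \<ge> 0 \<Longrightarrow> real (card (int_points n R)) \<le> (2 * R + 1) ^ n"
  using finite_card_int_points by blast

lemma card_int_points_ge_1: "R \<ge> 0 \<Longrightarrow> card (int_points n R) \<ge> 1"
proof -
  assume "R \<ge> 0"
  hence "0 \<in> int_points n R" by (simp add: int_points_def euc_0)
  thus ?thesis using finite_int_points[of n R] by (metis One_nat_def Suc_leI card_gt_0_iff empty_iff)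
qed

text \<open>
  The net consists of one unit vector from every nonempty cell of the grid of mesh \<open>1 / T\<close>.
\<close>

lemma sphere_net:
  assumes n: "n \<ge> 1" and T: "T \<ge> (1::nat)"
  shows "\<exists>W. finite W \<and> W \<subseteq> euc_sphere n \<and> real (card W) \<le> (2 * (real T + real n) + 1) ^ n
           \<and> (\<forall>v\<in>euc_sphere n. \<exists>w\<in>W. norm (v - w) \<le> real n / real T)"
proof -
  define cell where "cell v = round_down n (real T *\<^sub>R v)" for v
  define rep where "rep z = (SOME v. v \<in> euc_sphere n \<and> cell v = z)" for z
  define W where "W = rep ` (cell ` euc_sphere n)"
  have rep: "rep (cell v) \<in> euc_sphere n \<and> cell (rep (cell v)) = cell v" if "v \<in> euc_sphere n" for v
    unfolding rep_def by (rule someI[of _ v]) (use that in auto)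
  have sub: "cell ` euc_sphere n \<subseteq> int_points n (real T + real n)"
  proof
    fix z assume "z \<in> cell ` euc_sphere n"
    then obtain v where v: "v \<in> euc n" "norm v = 1" "z = cell v" by (auto simp: euc_sphere_def)
    have "norm z \<le> norm (z - real T *\<^sub>R v) + norm (real T *\<^sub>R v)" by (metis diff_add_cancel norm_triangle_ineq)
    also have "\<dots> \<le> real n + real T"
      using norm_round_down[of "real T *\<^sub>R v" n] v by (simp add: cell_def euc_scaleR)
    finally show "z \<in> int_points n (real T + real n)"
      using v by (simp add: int_points_def cell_def round_down_in round_down_Ints)
  qed
  have fin: "finite (cell ` euc_sphere n)" using finite_subset[OF sub finite_int_points] .
  have "real (card W) \<le> real (card (int_points n (real T + real n)))"
    unfolding W_def using card_image_le[OF fin, of rep] card_mono[OF finite_int_points sub] by linarith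
  also have "\<dots> \<le> (2 * (real T + real n) + 1) ^ n" by (rule card_int_points_le) simp
  finally have card: "real (card W) \<le> (2 * (real T + real n) + 1) ^ n" .
  have close: "\<exists>w\<in>W. norm (v - w) \<le> real n / real T" if v: "v \<in> euc_sphere n" for v
  proof
    define w where "w = rep (cell v)"
    show "rep (cell v) \<in> W" using v by (auto simp: W_def)
    have w: "w \<in> euc_sphere n" "cell w = cell v" using rep[OF v] by (auto simp: w_def)
    have vw: "v \<in> euc n" "w \<in> euc n" using v w by (auto simp: euc_sphere_def)
    have "norm (real T *\<^sub>R (v - w)) \<le> real n"
    proof (rule norm_le_dim)
      fix i
      show "\<bar>coord (real T *\<^sub>R (v - w)) i\<bar> \<le> 1"
      proof (cases "i < n")
        case True
        have "coord (cell w) i = coord (cell v) i" using w by simp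
        hence "\<lfloor>real T * coord w i\<rfloor> = \<lfloor>real T * coord v i\<rfloor>"
          using True by (simp add: cell_def round_down_def coord_euc_vec)
        hence "\<bar>real T * coord v i - real T * coord w i\<bar> \<le> 1" by linarith
        thus ?thesis by (simp add: right_diff_distrib)
      next
        case False
        thus ?thesis using coord_zero_euc[OF vw(1), of i] coord_zero_euc[OF vw(2), of i] by simp
      qed
    qed (use vw in \<open>auto intro: euc_diff euc_scaleR\<close>)
    hence "norm (v - w) * real T \<le> real n" unfolding norm_scaleR by (simp add: mult.commute)
    thus "norm (v - rep (cell v)) \<le> real n / real T"
      using T by (simp add: w_def pos_le_divide_eq)
  qed
  show ?thesis
    by (rule exI[of _ W]) (use fin card close rep in \<open>auto simp: W_def\<close>)
qed

section \<open>Covering the sphere by caps\<close>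

text \<open>
  Double counting of the pairs \<open>(w, z)\<close> with \<open>C w z\<close>.
\<close>

lemma greedy_step:
  assumes Z: "finite Z" "Z \<noteq> {}" and W: "finite W"
    and p: "\<And>w. w \<in> W \<Longrightarrow> p * real (card Z) \<le> real (card {z \<in> Z. C w z})"
  shows "\<exists>z\<in>Z. p * real (card W) \<le> real (card {w \<in> W. C w z})"
proof (rule ccontr)
  assume "\<not> ?thesis"
  hence less: "real (card {w \<in> W. C w z}) < p * real (card W)" if "z \<in> Z" for z using that by force
  have "(\<Sum>z\<in>Z. card {w \<in> W. C w z}) = (\<Sum>w\<in>W. card {z \<in> Z. C w z})"
    by (rule sum_multicount_gen) (use Z W in auto)
  hence eq: "(\<Sum>z\<in>Z. real (card {w \<in> W. C w z})) = (\<Sum>w\<in>W. real (card {z \<in> Z. C w z}))"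
    by (metis (mono_tags, lifting) of_nat_sum sum.cong)
  have "(\<Sum>w\<in>W. p * real (card Z)) \<le> (\<Sum>w\<in>W. real (card {z \<in> Z. C w z}))"
    by (rule sum_mono) (rule p)
  also have "\<dots> < (\<Sum>z\<in>Z. p * real (card W))"
    unfolding eq[symmetric] using Z less by (intro sum_strict_mono) auto
  finally show False by (simp add: mult_ac)
qed

text \<open>
  Each greedy choice covers at least the share \<open>p\<close> of what is still uncovered, so after \<open>k\<close>
  choices at most \<open>(1 - p) ^ k * card W\<close> elements are left, and this is below \<open>1\<close> once
  \<open>k > ln (card W) / p\<close>.
\<close>

lemma greedy_cover:
  assumes Z: "finite Z" "Z \<noteq> {}" and W: "finite W" "W \<noteq> {}" and p: "0 < p" "p \<le> 1"
    and dens: "\<And>w. w \<in> W \<Longrightarrow> p * real (card Z) \<le> real (card {z \<in> Z. C w z})"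
  shows "\<exists>U\<subseteq>Z. (\<forall>w\<in>W. \<exists>u\<in>U. C w u) \<and> real (card U) \<le> ln (real (card W)) / p + 1"
proof -
  have step: "\<exists>U\<subseteq>Z. card U \<le> k \<and> real (card {w \<in> W. \<forall>u\<in>U. \<not> C w u}) \<le> (1 - p) ^ k * real (card W)" for k
  proof (induction k)
    case 0 show ?case by (rule exI[of _ "{}"]) auto
  next
    case (Suc k)
    then obtain U where U: "U \<subseteq> Z" "card U \<le> k"
      "real (card {w \<in> W. \<forall>u\<in>U. \<not> C w u}) \<le> (1 - p) ^ k * real (card W)" by blast
    define W' where "W' = {w \<in> W. \<forall>u\<in>U. \<not> C w u}"
    have W': "finite W'" using W by (simp add: W'_def)
    obtain z where z: "z \<in> Z" "p * real (card W') \<le> real (card {w \<in> W'. C w z})"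
      using greedy_step[OF Z W', of p C] dens by (auto simp: W'_def)
    have "{w \<in> W. \<forall>u\<in>insert z U. \<not> C w u} = W' - {w \<in> W'. C w z}" by (auto simp: W'_def)
    hence "real (card {w \<in> W. \<forall>u\<in>insert z U. \<not> C w u}) = real (card W') - real (card {w \<in> W'. C w z})"
      using W' by (simp add: card_Diff_subset of_nat_diff card_mono)
    also have "\<dots> \<le> (1 - p) * real (card W')" using z by (simp add: left_diff_distrib)
    also have "\<dots> \<le> (1 - p) * ((1 - p) ^ k * real (card W))"
      using U(3) p by (intro mult_left_mono) (auto simp: W'_def)
    finally have "real (card {w \<in> W. \<forall>u\<in>insert z U. \<not> C w u}) \<le> (1 - p) ^ Suc k * real (card W)"
      by (simp add: mult.assoc)
    moreover have "card (insert z U) \<le> Suc k"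
      using U(2) finite_subset[OF U(1) Z(1)] by (simp add: card_insert_if)
    ultimately show ?case using U(1) z(1) by (intro exI[of _ "insert z U"]) auto
  qed
  define m where "m = real (card W)"
  have m: "m \<ge> 1" using W by (simp add: m_def Suc_leI card_gt_0_iff)
  define k where "k = nat \<lfloor>ln m / p\<rfloor> + 1"
  have fl: "\<lfloor>ln m / p\<rfloor> \<ge> 0" using m p by simp
  have k: "real k > ln m / p" "real k \<le> ln m / p + 1"
    unfolding k_def using fl by (auto simp: of_nat_nat) linarith+
  obtain U where U: "U \<subseteq> Z" "card U \<le> k" "real (card {w \<in> W. \<forall>u\<in>U. \<not> C w u}) \<le> (1 - p) ^ k * m"
    using step unfolding m_def by blast
  have "(1 - p) ^ k \<le> exp (- p) ^ k"
    using p exp_ge_add_one_self[of "- p"] by (intro power_mono) auto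
  also have "\<dots> = exp (- (p * real k))" by (simp add: exp_of_nat_mult[symmetric] mult.commute)
  also have "\<dots> < exp (- ln m)" using k p by (simp add: field_simps)
  also have "\<dots> = 1 / m" using m by (simp add: exp_minus inverse_eq_divide)
  finally have "(1 - p) ^ k * m < 1" using m by (simp add: field_simps)
  hence "card {w \<in> W. \<forall>u\<in>U. \<not> C w u} = 0" using U(3) by linarith
  hence "\<forall>w\<in>W. \<exists>u\<in>U. C w u" using W by auto
  moreover have "real (card U) \<le> ln m / p + 1" using U(2) k(2) by linarith
  ultimately show ?thesis using U(1) unfolding m_def by blast
qed

text \<open>
  By volume, the balls of radius \<open>r R\<close> and \<open>R\<close> contain integer points in a ratio close to \<open>r ^ n\<close>.
  If the ratio were below \<open>q ^ n\<close> for all large \<open>R\<close>, then along the radii \<open>R0 / r ^ k\<close> the number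
  of points would grow like \<open>(1 / q) ^ (k n)\<close>, faster than the trivial bound of order
  \<open>(1 / r) ^ (k n)\<close>.
\<close>

lemma int_points_good_scale:
  assumes n: "n \<ge> 1" and q: "0 < q" "q < r" "r < 1" and R0: "R0 \<ge> 1"
  shows "\<exists>R\<ge>R0. q ^ n * real (card (int_points n R)) \<le> real (card (int_points n (r * R)))"
proof (rule ccontr)
  assume "\<not> ?thesis"
  hence bad: "real (card (int_points n (r * R))) < q ^ n * real (card (int_points n R))" if "R \<ge> R0" for R
    using that by force
  have ge: "R0 / r ^ k \<ge> R0" for k
    using q R0 power_le_one[of r k] by (simp add: pos_le_divide_eq mult_left_le)
  have grow: "(1 / q ^ k) ^ n \<le> real (card (int_points n (R0 / r ^ k)))" for k
  proof (induction k)
    case 0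
    thus ?case using card_int_points_ge_1[of R0 n] R0 by simp
  next
    case (Suc k)
    have "r * (R0 / r ^ Suc k) = R0 / r ^ k" using q by simp
    hence "real (card (int_points n (R0 / r ^ k))) < q ^ n * real (card (int_points n (R0 / r ^ Suc k)))"
      using bad[OF ge, of "Suc k"] by simp
    hence "(1 / q ^ k) ^ n / q ^ n \<le> real (card (int_points n (R0 / r ^ Suc k)))"
      using Suc q by (simp add: pos_divide_le_eq mult.commute)
    moreover have "(1 / q ^ Suc k) ^ n = (1 / q ^ k) ^ n / q ^ n"
      by (simp add: power_divide power_mult_distrib)
    ultimately show ?case by simp
  qed
  have "(r / q) ^ k \<le> 3 * R0" for k
  proof -
    have "(1 / q ^ k) ^ n \<le> (2 * (R0 / r ^ k) + 1) ^ n"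
      using grow[of k] card_int_points_le[of "R0 / r ^ k" n] ge[of k] R0 by linarith
    also have "\<dots> \<le> (3 * (R0 / r ^ k)) ^ n"
      using ge[of k] R0 by (intro power_mono) auto
    finally have "1 / q ^ k \<le> 3 * (R0 / r ^ k)"
      using ge[of k] R0 n q by (subst (asm) power_mono_iff) auto
    thus ?thesis using q by (simp add: power_divide field_simps)
  qed
  moreover obtain k where "3 * R0 < (r / q) ^ k"
    using real_arch_pow[of "r / q" "3 * R0"] q by auto
  ultimately show False using not_le by blast
qed

text \<open>
  The ball of radius \<open>r R\<close> is cut into slabs of thickness \<open>\<delta> R\<close> orthogonal to \<open>v\<close>. A suitable
  translation along \<open>v\<close>, rounded to an integer vector, puts a slab just above the height \<open>h R\<close>. Its
  points stay in the ball of radius \<open>R\<close>, since their parts orthogonal to \<open>v\<close> have length at most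
  \<open>r R\<close> and \<open>r\<^sup>2 + h\<^sup>2\<close> is less than \<open>1\<close> by a margin that absorbs thickness and rounding. So the cap
  has at least as many points as the fullest of the boundedly many slabs.
\<close>

lemma cap_density:
  assumes v: "v \<in> euc_sphere n" and h: "0 < h" and \<delta>: "0 < \<delta>" "\<delta> \<le> 1" and r: "0 \<le> r" "r \<le> 1"
    and fit: "r\<^sup>2 + (h + 2 * \<delta>)\<^sup>2 \<le> (1 - \<delta>)\<^sup>2" and R: "R > 0" "real n \<le> \<delta> * R"
  shows "real (card (int_points n (r * R))) \<le> (2 / \<delta> + 3) * real (card {z \<in> int_points n R. inner z v \<ge> h * R})"
proof -
  have vn: "v \<in> euc n" "norm v = 1" "inner v v = 1"
    using v sphere_inner by (auto simp: euc_sphere_def)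
  define K where "K = \<lceil>1 / \<delta>\<rceil>"
  define A where "A = {z \<in> int_points n R. inner z v \<ge> h * R}"
  define slab where "slab k = {z \<in> int_points n (r * R). \<lfloor>inner z v / (\<delta> * R)\<rfloor> = k}" for k
  have finA: "finite A" using finite_int_points by (simp add: A_def)
  have \<delta>R: "\<delta> * R > 0" using \<delta> R by simp
  have cover: "int_points n (r * R) \<subseteq> (\<Union>k\<in>{-K..K}. slab k)"
  proof
    fix z assume z: "z \<in> int_points n (r * R)"
    have "\<bar>inner z v\<bar> \<le> norm z * norm v" by (rule Cauchy_Schwarz_ineq2)
    also have "\<dots> \<le> r * R" using z vn by (simp add: int_points_def)
    also have "\<dots> \<le> R" using r R by (simp add: mult_left_le_one_le)
    finally have "\<bar>inner z v / (\<delta> * R)\<bar> \<le> 1 / \<delta>" using \<delta> R by (simp add: field_simps abs_mult)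
    hence b: "inner z v / (\<delta> * R) \<le> 1 / \<delta>" "- (1 / \<delta>) \<le> inner z v / (\<delta> * R)"
      unfolding abs_le_iff by (simp_all only: minus_le_iff)
    have "1 / \<delta> \<le> of_int K" by (simp add: K_def)
    hence "\<lfloor>inner z v / (\<delta> * R)\<rfloor> \<in> {-K..K}" using b by (auto simp: le_floor_iff floor_le_iff)
    thus "z \<in> (\<Union>k\<in>{-K..K}. slab k)" using z by (auto simp: slab_def)
  qed
  have slab: "card (slab k) \<le> card A" for k
  proof -
    \<comment> \<open>The shift by \<open>c\<close> moves the heights in slab \<open>k\<close> to the interval from \<open>(h + \<delta>) R\<close> to \<open>(h + 2 \<delta>) R\<close>.\<close>
    define c where "c = (h + \<delta> - of_int k * \<delta>) * R"
    define w where "w = round_down n (c *\<^sub>R v)"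
    have w: "w \<in> euc n" "norm (w - c *\<^sub>R v) \<le> \<delta> * R"
      using norm_round_down[of "c *\<^sub>R v" n] R vn by (auto simp: w_def round_down_in euc_scaleR)
    have "(\<lambda>z. z + w) ` slab k \<subseteq> A"
    proof (intro subsetI, elim imageE)
      fix y z assume z: "z \<in> slab k" and y: "y = z + w"
      define \<tau> where "\<tau> = inner z v"
      have "of_int k \<le> \<tau> / (\<delta> * R)" "\<tau> / (\<delta> * R) < of_int k + 1"
        using z by (auto simp: slab_def \<tau>_def floor_eq_iff)
      hence t: "of_int k * (\<delta> * R) \<le> \<tau>" "\<tau> < (of_int k + 1) * (\<delta> * R)"
        using \<delta>R by (simp_all add: pos_le_divide_eq pos_divide_less_eq)
      have tc: "(h + \<delta>) * R \<le> \<tau> + c" "\<tau> + c \<le> (h + 2 * \<delta>) * R"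
        using t unfolding c_def by (simp_all add: algebra_simps)
      have "(norm (z + c *\<^sub>R v))\<^sup>2 = (norm z)\<^sup>2 - \<tau>\<^sup>2 + (\<tau> + c)\<^sup>2"
        unfolding power2_norm_eq_inner \<tau>_def
        using vn by (simp add: inner_add_left inner_add_right inner_commute power2_eq_square algebra_simps)
      also have "\<dots> \<le> (r * R)\<^sup>2 + ((h + 2 * \<delta>) * R)\<^sup>2"
      proof -
        have "(norm z)\<^sup>2 \<le> (r * R)\<^sup>2" using z by (intro power_mono) (auto simp: slab_def int_points_def)
        moreover have "(\<tau> + c)\<^sup>2 \<le> ((h + 2 * \<delta>) * R)\<^sup>2"
        proof (rule power_mono)
          have "0 \<le> (h + \<delta>) * R" using h \<delta> R by simp
          thus "0 \<le> \<tau> + c" using tc by linarith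
        qed (rule tc)
        ultimately show ?thesis using zero_le_power2[of \<tau>] by linarith
      qed
      also have "\<dots> = (r\<^sup>2 + (h + 2 * \<delta>)\<^sup>2) * R\<^sup>2"
        by (simp only: power_mult_distrib distrib_right[of "r\<^sup>2" "(h + 2 * \<delta>)\<^sup>2"])
      also have "\<dots> \<le> (1 - \<delta>)\<^sup>2 * R\<^sup>2" using fit by (intro mult_right_mono) auto
      finally have "(norm (z + c *\<^sub>R v))\<^sup>2 \<le> ((1 - \<delta>) * R)\<^sup>2" by (simp add: power_mult_distrib)
      hence n1: "norm (z + c *\<^sub>R v) \<le> (1 - \<delta>) * R"
        by (rule power2_le_imp_le) (use \<delta> R in simp)
      have yy: "y = (z + c *\<^sub>R v) + (w - c *\<^sub>R v)" by (simp add: y)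
      have "norm y \<le> (1 - \<delta>) * R + \<delta> * R"
        unfolding yy using norm_triangle_mono[OF n1 w(2)] .
      hence ny: "norm y \<le> R" by (simp add: algebra_simps)
      have "\<bar>inner (w - c *\<^sub>R v) v\<bar> \<le> norm (w - c *\<^sub>R v) * norm v" by (rule Cauchy_Schwarz_ineq2)
      hence "inner (w - c *\<^sub>R v) v \<ge> - (\<delta> * R)" using w(2) vn(2) by simp
      moreover have "inner y v = (\<tau> + c) + inner (w - c *\<^sub>R v) v"
        using vn by (simp add: y \<tau>_def inner_add_left inner_diff_left)
      ultimately have "inner y v \<ge> h * R" using tc(1) by (simp add: algebra_simps)
      moreover have "y \<in> euc n" using z w y by (auto simp: slab_def int_points_def intro: euc_add)
      moreover have "coord y i \<in> \<int>" for i
        using z round_down_Ints by (auto simp: y slab_def int_points_def w_def)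
      ultimately show "y \<in> A" using ny by (simp add: A_def int_points_def)
    qed
    hence "card ((\<lambda>z. z + w) ` slab k) \<le> card A" using finA by (rule card_mono[rotated])
    thus ?thesis by (simp add: card_image)
  qed
  have "card (int_points n (r * R)) \<le> card (\<Union>k\<in>{-K..K}. slab k)"
    by (rule card_mono[OF _ cover]) (auto simp: slab_def finite_int_points)
  also have "\<dots> \<le> (\<Sum>k\<in>{-K..K}. card (slab k))" by (rule card_UN_le) simp
  also have "\<dots> \<le> (\<Sum>k\<in>{-K..K}. card A)" by (rule sum_mono) (rule slab)
  also have "\<dots> = nat (2 * K + 1) * card A" by (simp add: algebra_simps)
  finally have "real (card (int_points n (r * R))) \<le> real (nat (2 * K + 1)) * real (card A)"
    by (metis of_nat_le_iff of_nat_mult)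
  also have "\<dots> \<le> (2 / \<delta> + 3) * real (card A)"
  proof (rule mult_right_mono)
    have "1 / \<delta> > 0" using \<delta> by simp
    hence "K > 0" "of_int K \<le> 1 / \<delta> + 1" unfolding K_def by (auto simp: less_ceiling_iff) linarith?
    moreover have "2 / \<delta> = 2 * (1 / \<delta>)" by simp
    ultimately show "real (nat (2 * K + 1)) \<le> 2 / \<delta> + 3" by (simp add: of_nat_nat)
  qed simp
  finally show ?thesis unfolding A_def .
qed

text \<open>
  A cap of height slightly more than \<open>s\<close> contains about the share \<open>q ^ n\<close> of the integer points in
  a large ball, so greedy choice covers a net of the sphere by \<open>(1 / q) ^ n\<close> points times the logarithm of
  the size of the net. That logarithm is polynomial in \<open>n\<close>. The passage from the net to all unit
  vectors uses up the difference of heights.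
\<close>

theorem sphere_cap_cover:
  assumes s: "0 < s" and q: "0 < q" "q\<^sup>2 + s\<^sup>2 < 1"
  shows "\<exists>C>0. \<forall>n\<ge>1. \<exists>U. finite U \<and> U \<subseteq> euc_sphere n \<and>
           (\<forall>v\<in>euc_sphere n. \<exists>u\<in>U. inner u v > s) \<and> real (card U) \<le> C * (real n)\<^sup>2 * (1 / q) ^ n"
proof -
  have "((\<lambda>\<delta>. (1 - \<delta>)\<^sup>2 - ((q + \<delta>)\<^sup>2 + (s + \<delta> + 2 * \<delta>)\<^sup>2)) \<longlongrightarrow> (1 - 0)\<^sup>2 - ((q + 0)\<^sup>2 + (s + 0 + 2 * 0)\<^sup>2)) (at_right 0)"
    by (intro tendsto_intros)
  hence "\<forall>\<^sub>F \<delta> in at_right 0. 0 < (1 - \<delta>)\<^sup>2 - ((q + \<delta>)\<^sup>2 + (s + \<delta> + 2 * \<delta>)\<^sup>2)"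
    by (rule order_tendstoD(1)) (use q in auto)
  moreover have "\<forall>\<^sub>F \<delta> in at_right 0. \<delta> \<in> {0<..<1::real}"
    by (rule eventually_at_right_real) simp
  ultimately have "\<forall>\<^sub>F \<delta> in at_right 0. 0 < (1 - \<delta>)\<^sup>2 - ((q + \<delta>)\<^sup>2 + (s + \<delta> + 2 * \<delta>)\<^sup>2) \<and> \<delta> \<in> {0<..<1::real}"
    by (rule eventually_conj)
  then obtain \<delta> where \<delta>: "0 < \<delta>" "\<delta> < 1" "(q + \<delta>)\<^sup>2 + (s + \<delta> + 2 * \<delta>)\<^sup>2 < (1 - \<delta>)\<^sup>2"
    using eventually_happens[of _ "at_right (0::real)"] trivial_limit_at_right_real by force
  define r h where "r = q + \<delta>" and "h = s + \<delta>"
  have "r\<^sup>2 < (1 - \<delta>)\<^sup>2" 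
    unfolding r_def using add_increasing2[OF zero_le_power2 order_refl] \<delta>(3)
    by (rule order.strict_trans1)
  hence "r < 1 - \<delta>" by (rule power2_less_imp_less) (use \<delta> in simp)
  hence r: "q < r" "r < 1" "0 < r" using \<delta> q by (auto simp: r_def)
  obtain m :: nat where m: "1 / \<delta> < real m" using reals_Archimedean2 by blast
  have m1: "m \<ge> 1" using m \<delta> by (cases m) auto
  define B where "B = 2 / \<delta> + 3"
  have B: "B \<ge> 1" using \<delta> by (simp add: B_def)
  define C where "C = (2 * real m + 2) * B + 1"
  have C: "C > 0" unfolding C_def using B by (intro add_nonneg_pos mult_nonneg_nonneg) auto
  have "\<exists>U. finite U \<and> U \<subseteq> euc_sphere n \<and>
           (\<forall>v\<in>euc_sphere n. \<exists>u\<in>U. inner u v > s) \<and> real (card U) \<le> C * (real n)\<^sup>2 * (1 / q) ^ n"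
    if n: "n \<ge> 1" for n
  proof -
    \<comment> \<open>This mesh makes the net \<open>1 / m\<close>-dense, and \<open>1 / m < \<delta>\<close>.\<close>
    define T where "T = n * m"
    have T: "T \<ge> 1" "real n / real T < \<delta>"
      using n m m1 \<delta> by (auto simp: T_def field_simps Suc_le_eq)
    obtain W where W: "finite W" "W \<subseteq> euc_sphere n" "real (card W) \<le> (2 * (real T + real n) + 1) ^ n"
      "\<And>v. v \<in> euc_sphere n \<Longrightarrow> \<exists>w\<in>W. norm (v - w) \<le> real n / real T"
      using sphere_net[OF n T(1)] by blast
    define R0 where "R0 = max 1 (real n / \<delta>)"
    obtain R where R: "R \<ge> R0" "q ^ n * real (card (int_points n R)) \<le> real (card (int_points n (r * R)))"
      using int_points_good_scale[OF n q(1) r(1,2), of R0] by (auto simp: R0_def)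
    have R': "R > 0" "real n \<le> \<delta> * R" using R(1) \<delta> by (auto simp: R0_def field_simps)
    define p where "p = q ^ n / B"
    have q1: "q < 1" using r by linarith
    have p: "0 < p" "p \<le> 1"
      using q q1 B power_le_one[of q n] unfolding p_def by (auto simp: divide_le_eq)
    have dens: "p * real (card (int_points n R)) \<le> real (card {z \<in> int_points n R. inner z w \<ge> h * R})" if w: "w \<in> W" for w
    proof -
      have "q ^ n * real (card (int_points n R)) \<le> B * real (card {z \<in> int_points n R. inner z w \<ge> h * R})"
        unfolding B_def
        using R(2) cap_density[of w n h \<delta> r R] w W(2) s \<delta> r R' by (fastforce simp: h_def r_def)
      thus ?thesis unfolding p_def using B by (simp add: field_simps)
    qed
    have ne: "int_points n R \<noteq> {}" using card_int_points_ge_1[of R n] R' by auto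
    show ?thesis
    proof (cases "W = {}")
      case True
      hence "euc_sphere n = {}" using W(4) by auto
      thus ?thesis using C q by (intro exI[of _ "{}"]) auto
    next
      case False
      have "\<exists>U\<subseteq>int_points n R. (\<forall>w\<in>W. \<exists>u\<in>U. inner u w \<ge> h * R)
              \<and> real (card U) \<le> ln (real (card W)) / p + 1"
        by (rule greedy_cover[OF finite_int_points ne W(1) False p]) (rule dens)
      then obtain U where U: "U \<subseteq> int_points n R" "\<forall>w\<in>W. \<exists>u\<in>U. inner u w \<ge> h * R"
        "real (card U) \<le> ln (real (card W)) / p + 1" by (elim exE conjE)
      define U' where "U' = sgn ` (U - {0})"
      have finU: "finite U" using U(1) finite_int_points finite_subset by blast
      have "U' \<subseteq> euc_sphere n"
        using U(1) by (auto simp: U'_def euc_sphere_def int_points_def norm_sgn intro!: euc_sgn split: if_splits)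
      moreover have "\<exists>u\<in>U'. inner u v > s" if v: "v \<in> euc_sphere n" for v
      proof -
        obtain w where w: "w \<in> W" "norm (v - w) < \<delta>" using W(4)[OF v] T(2) by force
        obtain z where z: "z \<in> U" "inner z w \<ge> h * R" using U(2) w(1) by blast
        have hR: "h * R > 0" using R' s \<delta> by (simp add: h_def)
        hence z0: "z \<noteq> 0" using z by auto
        have nz: "norm z \<le> R" "norm z > 0" using z(1) U(1) z0 by (auto simp: int_points_def)
        have "h * norm z \<le> h * R" using nz s \<delta> by (intro mult_left_mono) (auto simp: h_def)
        hence "h \<le> inner (sgn z) w" using z(2) nz by (simp add: sgn_div_norm field_simps)
        moreover have "\<bar>inner (sgn z) (v - w)\<bar> \<le> norm (sgn z) * norm (v - w)" by (rule Cauchy_Schwarz_ineq2)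
        ultimately have "inner (sgn z) v > s"
          using w(2) z0 by (simp add: norm_sgn inner_diff_right h_def)
        thus ?thesis using z z0 by (auto simp: U'_def)
      qed
      moreover have "real (card U') \<le> C * (real n)\<^sup>2 * (1 / q) ^ n"
      proof -
        have cW: "real (card W) \<ge> 1" using W(1) False by (simp add: Suc_leI card_gt_0_iff)
        have "card U' \<le> card U"
          unfolding U'_def using card_image_le[of "U - {0}" sgn] card_mono[OF finU, of "U - {0}"] finU by auto
        hence "real (card U') \<le> ln (real (card W)) / p + 1" using U(3) by linarith
        also have "ln (real (card W)) \<le> ln ((2 * (real T + real n) + 1) ^ n)"
          using W(3) cW by (subst ln_le_cancel_iff) auto
        also have "\<dots> = real n * ln (1 + 2 * (real T + real n))"
          by (subst ln_realpow) (auto simp: add.commute)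
        also have "\<dots> \<le> real n * (2 * (real T + real n))"
          by (intro mult_left_mono ln_add_one_self_le_self) auto
        also have "\<dots> = (2 * real m + 2) * (real n)\<^sup>2"
          by (simp add: T_def power2_eq_square algebra_simps)
        finally have "real (card U') \<le> (2 * real m + 2) * (real n)\<^sup>2 / p + 1"
          using p by (simp add: divide_right_mono)
        also have "\<dots> = (2 * real m + 2) * B * (real n)\<^sup>2 * (1 / q) ^ n + 1"
          by (simp add: p_def power_divide)
        also have "\<dots> \<le> (2 * real m + 2) * B * (real n)\<^sup>2 * (1 / q) ^ n + (real n)\<^sup>2 * (1 / q) ^ n"
        proof -
          have "1 * 1 \<le> (real n)\<^sup>2 * (1 / q) ^ n"
            using n q q1 by (intro mult_mono one_le_power) auto
          thus ?thesis by simp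
        qed
        also have "\<dots> = C * (real n)\<^sup>2 * (1 / q) ^ n" by (simp add: C_def algebra_simps)
        finally show ?thesis .
      qed
      ultimately show ?thesis using finU by (intro exI[of _ U']) (auto simp: U'_def)
    qed
  qed
  thus ?thesis using C by blast
qed

section \<open>Spikes and the separation of wide caps\<close>

definition spike :: "nat \<Rightarrow> fseq \<Rightarrow> fseq set" where
  "spike n x = convex hull (euc_ball n \<union> {x})"

lemma spiky_eq: "spiky n X = (\<Union>x\<in>X. spike n x)"
  by (simp add: spiky_def spike_def)

lemma convex_euc: "convex (euc n)"
  by (rule convexI) (auto intro: euc_add euc_scaleR)

lemma convex_euc_ball: "convex (euc_ball n)"
  unfolding euc_ball_def by (intro convex_Int convex_cball convex_euc)

lemma euc_ball_0: "0 \<in> euc_ball n"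
  by (simp add: euc_ball_def euc_0)

lemma spike_iff: "z \<in> spike n x \<longleftrightarrow> (\<exists>b t. b \<in> euc_ball n \<and> 0 \<le> t \<and> t \<le> 1 \<and> z = (1 - t) *\<^sub>R x + t *\<^sub>R b)"
proof -
  have "euc_ball n \<noteq> {}" using euc_ball_0 by blast
  thus ?thesis
    unfolding spike_def Un_insert_right Un_empty_right convex_hull_insert_alt
      convex_hull_eq[THEN iffD2, OF convex_euc_ball] by auto
qed

lemma convex_spike: "convex (spike n x)"
  by (simp add: spike_def convex_convex_hull)

lemma ball_subset_spike: "euc_ball n \<subseteq> spike n x"
  unfolding spike_def using hull_subset[of "euc_ball n \<union> {x}" convex] by blast

lemma apex_in_spike: "x \<in> spike n x"
  unfolding spike_def using hull_subset[of "euc_ball n \<union> {x}" convex] by blast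

lemma spike_mono: "x \<in> spike n y \<Longrightarrow> spike n x \<subseteq> spike n y"
  unfolding spike_def[of n x] using ball_subset_spike convex_spike by (intro hull_minimal) auto

lemma spike_subset_euc: "x \<in> euc n \<Longrightarrow> spike n x \<subseteq> euc n"
  unfolding spike_def by (rule hull_minimal) (auto simp: euc_ball_def convex_euc)

text \<open>
  A spike is closed: \<open>f\<close> below measures how far \<open>x\<close> is from the ball of radius \<open>t\<close> that the spike
  contains around \<open>(1 - t) y\<close>, and it attains a positive minimum over \<open>t\<close>.
\<close>

lemma spike_avoids_nbhd:
  assumes x: "x \<in> euc n" "y \<in> euc n" "x \<notin> spike n y"
  shows "\<forall>\<^sub>F z in nhds x. z \<notin> spike n y"
proof -
  define f where "f t = norm (x - (1 - t) *\<^sub>R y) - t" for t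
  have "continuous_on {0..1} f" unfolding f_def by (intro continuous_intros)
  then obtain t0 where t0: "t0 \<in> {0..1}" "\<And>t. t \<in> {0..1} \<Longrightarrow> f t0 \<le> f t"
    using continuous_attains_inf[of "{0..1::real}" f] by auto
  have pos: "f t0 > 0"
  proof (rule ccontr)
    assume "\<not> f t0 > 0"
    hence le: "norm (x - (1 - t0) *\<^sub>R y) \<le> t0" by (simp add: f_def)
    define b where "b = (1 / t0) *\<^sub>R (x - (1 - t0) *\<^sub>R y)"
    have "x = (1 - t0) *\<^sub>R y + t0 *\<^sub>R b" using le by (cases "t0 = 0") (auto simp: b_def)
    moreover have "b \<in> euc_ball n"
      using le x t0(1) by (auto simp: b_def euc_ball_def divide_le_eq intro!: euc_scaleR euc_diff)
    ultimately have "x \<in> spike n y" using t0(1) unfolding spike_iff by force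
    thus False using x by blast
  qed
  have "z \<notin> spike n y" if "dist z x < f t0" for z
  proof
    assume "z \<in> spike n y"
    then obtain b t where bt: "b \<in> euc_ball n" "0 \<le> t" "t \<le> 1" "z = (1 - t) *\<^sub>R y + t *\<^sub>R b"
      unfolding spike_iff by blast
    have "norm (x - (1 - t) *\<^sub>R y) \<le> norm (x - z) + norm (t *\<^sub>R b)"
      using norm_triangle_ineq[of "x - z" "t *\<^sub>R b"] bt(4) by simp
    also have "norm (t *\<^sub>R b) \<le> t" using bt by (simp add: euc_ball_def mult_left_le)
    finally have "f t \<le> norm (x - z)" by (simp add: f_def)
    moreover have "f t0 \<le> f t" using t0 bt by auto
    ultimately show False using that by (simp add: dist_norm norm_minus_commute)
  qed
  thus ?thesis unfolding eventually_nhds_metric using pos by blast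
qed

lemma irredundant_apex:
  assumes "\<forall>x\<in>X. spiky n X \<noteq> spiky n (X - {x})" "x \<in> X" "y \<in> X" "x \<noteq> y"
  shows "x \<notin> spike n y"
proof
  assume "x \<in> spike n y"
  hence "spike n x \<subseteq> spike n y" by (rule spike_mono)
  hence "spiky n X = spiky n (X - {x})" unfolding spiky_eq using assms(2-4) by blast
  thus False using assms by blast
qed

text \<open>
  Points \<open>z\<close> of the segment close to \<open>x\<close> lie in the convex set \<open>spiky n X\<close>, hence in some spike. The
  spikes over the other vertices are closed and do not contain \<open>x\<close>, so \<open>z\<close> lies in the spike over
  \<open>x\<close>, which means that the ray from \<open>x\<close> through \<open>y\<close> meets the ball. It does so before it reaches
  \<open>y\<close>: otherwise \<open>y\<close> would belong to the spike over \<open>x\<close>.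
\<close>

lemma segment_meets_ball:
  assumes X: "finite X" "X \<subseteq> euc n - euc_ball n" and irr: "\<forall>x\<in>X. spiky n X \<noteq> spiky n (X - {x})"
    and conv: "convex (spiky n X)" and xy: "x \<in> X" "y \<in> X" "x \<noteq> y"
  shows "\<exists>s. 0 < s \<and> s < 1 \<and> norm ((1 - s) *\<^sub>R x + s *\<^sub>R y) \<le> 1"
proof -
  have xe: "x \<in> euc n" "y \<in> euc n" using X xy by auto
  have "\<forall>\<^sub>F z in nhds x. \<forall>w\<in>X - {x}. z \<notin> spike n w"
    using X xe xy(1) irredundant_apex[OF irr] by (intro eventually_ball_finite ballI spike_avoids_nbhd) auto
  then obtain \<epsilon> where \<epsilon>: "\<epsilon> > 0" "\<And>z w. dist z x < \<epsilon> \<Longrightarrow> w \<in> X - {x} \<Longrightarrow> z \<notin> spike n w"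
    unfolding eventually_nhds_metric by blast
  define d where "d = norm (y - x)"
  have d: "d > 0" using xy by (simp add: d_def)
  define e where "e = min (1 / 2) (\<epsilon> / (2 * d))"
  have e: "0 < e" "e < 1" "e * d < \<epsilon>"
  proof -
    show "0 < e" "e < 1" using \<epsilon> d by (auto simp: e_def)
    have "e * d \<le> \<epsilon> / (2 * d) * d" unfolding e_def using d by (intro mult_right_mono) auto
    thus "e * d < \<epsilon>" using d \<epsilon>(1) by simp
  qed
  define z where "z = (1 - e) *\<^sub>R x + e *\<^sub>R y"
  have zx: "z - x = e *\<^sub>R (y - x)" by (simp add: z_def algebra_simps)
  have "x \<in> spiky n X" "y \<in> spiky n X" using xy apex_in_spike by (auto simp: spiky_eq)
  hence "z \<in> spiky n X" unfolding z_def using conv e by (intro convexD) auto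
  moreover have "dist z x < \<epsilon>" using e by (simp add: dist_norm zx d_def)
  ultimately have "z \<in> spike n x" using \<epsilon>(2) unfolding spiky_eq by blast
  then obtain b t where bt: "b \<in> euc_ball n" "0 \<le> t" "t \<le> 1" "z = (1 - t) *\<^sub>R x + t *\<^sub>R b"
    unfolding spike_iff by blast
  have t0: "t > 0"
  proof (rule ccontr)
    assume "\<not> t > 0"
    hence "z = x" using bt by simp
    thus False using zx e xy by simp
  qed
  define s where "s = e / t"
  have "z - x = t *\<^sub>R (b - x)" using bt(4) by (simp add: algebra_simps)
  hence "t *\<^sub>R (b - x) = e *\<^sub>R (y - x)" using zx by simp
  hence "(1 / t) *\<^sub>R (t *\<^sub>R (b - x)) = (1 / t) *\<^sub>R (e *\<^sub>R (y - x))" by simp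
  hence b: "b = (1 - s) *\<^sub>R x + s *\<^sub>R y" using t0 by (simp add: s_def algebra_simps)
  have s0: "s > 0" using e t0 by (simp add: s_def)
  have "s < 1"
  proof (rule ccontr)
    assume "\<not> s < 1"
    hence s1: "s \<ge> 1" by simp
    have "(1 / s) *\<^sub>R b = (1 / s) *\<^sub>R ((1 - s) *\<^sub>R x) + y"
      unfolding b using s0 by (simp add: scaleR_add_right)
    hence "y = (1 / s) *\<^sub>R b - ((1 - s) / s) *\<^sub>R x" by simp
    also have "\<dots> = (1 - 1 / s) *\<^sub>R x + (1 / s) *\<^sub>R b"
      using s0 by (simp add: diff_divide_distrib scaleR_diff_left)
    finally have "y \<in> spike n x"
      unfolding spike_iff using s1 bt(1) by (intro exI[of _ b] exI[of _ "1 / s"]) auto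
    thus False using irredundant_apex[OF irr xy(2,1)] xy(3) by simp
  qed
  moreover have "norm b \<le> 1" using bt by (simp add: euc_ball_def)
  ultimately show ?thesis using s0 b by blast
qed

text \<open>
  With \<open>norm x = 1 / cos \<phi>\<close> and \<open>norm y = 1 / cos \<psi>\<close> the conclusion says that the angle between \<open>x\<close>
  and \<open>y\<close> is at least \<open>\<phi> + \<psi>\<close>: the two hidden caps do not overlap. The proof completes a square in
  the quadratic form that expresses the third condition on \<open>s\<close>.
\<close>

lemma inner_of_segment_meets_ball:
  fixes x y :: "'a :: real_inner"
  assumes n: "norm x \<ge> 1" "norm y \<ge> 1" and s: "0 < s" "s < 1" "norm ((1 - s) *\<^sub>R x + s *\<^sub>R y) \<le> 1"
  shows "inner x y \<le> 1 - sqrt ((norm x)\<^sup>2 - 1) * sqrt ((norm y)\<^sup>2 - 1)"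
proof -
  define u v where "u = sqrt ((norm x)\<^sup>2 - 1)" and "v = sqrt ((norm y)\<^sup>2 - 1)"
  have "(norm x)\<^sup>2 \<ge> 1" "(norm y)\<^sup>2 \<ge> 1" using n by auto
  hence uv: "inner x x = 1 + u\<^sup>2" "inner y y = 1 + v\<^sup>2"
    unfolding u_def v_def by (auto simp flip: power2_norm_eq_inner)
  have "(norm ((1 - s) *\<^sub>R x + s *\<^sub>R y))\<^sup>2 \<le> 1"
    using s(3) by (simp add: power_le_one)
  hence "(1 - s)\<^sup>2 * inner x x + 2 * s * (1 - s) * inner x y + s\<^sup>2 * inner y y \<le> 1"
    unfolding power2_norm_eq_inner
    by (simp add: inner_add_left inner_add_right inner_commute power2_eq_square algebra_simps)
  hence "((1 - s) * u - s * v)\<^sup>2 + 2 * s * (1 - s) * (inner x y - 1 + u * v) \<le> 0"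
    unfolding uv by (simp add: power2_eq_square algebra_simps)
  hence "2 * s * (1 - s) * (inner x y - 1 + u * v) \<le> 0"
    using zero_le_power2[of "(1 - s) * u - s * v"] by linarith
  moreover have "2 * s * (1 - s) > 0" using s by simp
  ultimately have "inner x y - 1 + u * v \<le> 0" by (meson mult_pos_pos not_le)
  thus ?thesis by (simp add: u_def v_def)
qed

lemma wide_caps_separated:
  fixes x y :: "'a :: real_inner"
  assumes \<alpha>: "0 < \<alpha>" "\<alpha> < pi / 2" and n: "1 \<le> norm x * cos \<alpha>" "1 \<le> norm y * cos \<alpha>"
    and s: "0 < s" "s < 1" "norm ((1 - s) *\<^sub>R x + s *\<^sub>R y) \<le> 1"
  shows "inner (sgn x) (sgn y) \<le> cos (2 * \<alpha>)"
proof -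
  have c: "0 < cos \<alpha>" "cos \<alpha> \<le> 1" "0 < sin \<alpha>"
    using \<alpha> by (auto intro!: cos_gt_zero sin_gt_zero)
  have one: "norm z \<ge> 1" if "1 \<le> norm z * cos \<alpha>" for z :: 'a
    using that mult_left_le[of "cos \<alpha>" "norm z"] c by simp
  have wide: "norm z * sin \<alpha> \<le> sqrt ((norm z)\<^sup>2 - 1)" if "1 \<le> norm z * cos \<alpha>" for z :: 'a
  proof (rule real_le_rsqrt)
    have "1 \<le> (norm z * cos \<alpha>)\<^sup>2" using that by simp
    moreover have "(norm z * sin \<alpha>)\<^sup>2 + (norm z * cos \<alpha>)\<^sup>2 = (norm z)\<^sup>2"
      by (simp add: power_mult_distrib flip: distrib_left)
    ultimately show "(norm z * sin \<alpha>)\<^sup>2 \<le> (norm z)\<^sup>2 - 1" by linarith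
  qed
  have "inner x y \<le> 1 - sqrt ((norm x)\<^sup>2 - 1) * sqrt ((norm y)\<^sup>2 - 1)"
    using one n s by (intro inner_of_segment_meets_ball) auto
  also have "\<dots> \<le> (norm x * cos \<alpha>) * (norm y * cos \<alpha>) - (norm x * sin \<alpha>) * (norm y * sin \<alpha>)"
  proof -
    have "1 * 1 \<le> (norm x * cos \<alpha>) * (norm y * cos \<alpha>)" using n by (intro mult_mono) auto
    moreover have "(norm x * sin \<alpha>) * (norm y * sin \<alpha>) \<le> sqrt ((norm x)\<^sup>2 - 1) * sqrt ((norm y)\<^sup>2 - 1)"
      using wide n c one[OF n(1)] by (intro mult_mono) auto
    ultimately show ?thesis by simp
  qed
  also have "\<dots> = norm x * norm y * cos (2 * \<alpha>)"
    unfolding cos_double by (simp add: power2_eq_square algebra_simps)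
  finally have "inner x y \<le> norm x * norm y * cos (2 * \<alpha>)" .
  moreover have "norm x > 0" "norm y > 0" using one n by (auto intro: less_le_trans[OF zero_less_one])
  ultimately show ?thesis by (simp add: sgn_div_norm field_simps)
qed

section \<open>Illumination of cap bodies\<close>

lemma euc_interiorI:
  assumes "z \<in> euc n" "\<rho> > 0" "\<And>y. y \<in> euc n \<Longrightarrow> dist z y < \<rho> \<Longrightarrow> y \<in> K"
  shows "z \<in> euc_interior n K"
proof -
  have "openin (top_of_set (euc n)) (euc n \<inter> ball z \<rho>)" by (intro openin_open_Int open_ball)
  moreover have "z \<in> euc n \<inter> ball z \<rho>" "euc n \<inter> ball z \<rho> \<subseteq> K" using assms by auto
  ultimately show ?thesis unfolding euc_interior_def interior_of_def by blast
qed

text \<open>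
  The ball of radius \<open>1 - norm w\<close> about \<open>w\<close> lies in \<open>K\<close>; scaled towards \<open>z\<close> by the factor \<open>e\<close>, it
  remains in \<open>K\<close> by convexity.
\<close>

lemma interior_towards_ball:
  assumes K: "convex K" "euc_ball n \<subseteq> K" and z: "z \<in> K" "z \<in> euc n" and w: "w \<in> euc n" "norm w < 1"
    and e: "0 < e" "e \<le> 1"
  shows "z + e *\<^sub>R (w - z) \<in> euc_interior n K"
proof (rule euc_interiorI)
  show "z + e *\<^sub>R (w - z) \<in> euc n" using z w by (intro euc_add euc_scaleR euc_diff)
  show "e * (1 - norm w) > 0" using e w by simp
  fix y assume y: "y \<in> euc n" "dist (z + e *\<^sub>R (w - z)) y < e * (1 - norm w)"
  define r where "r = (1 / e) *\<^sub>R (y - (z + e *\<^sub>R (w - z)))"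
  have "norm r * e < (1 - norm w) * e"
    using y(2) e by (simp add: r_def dist_norm norm_minus_commute mult.commute)
  hence "norm r < 1 - norm w" using e by simp
  hence "norm (w + r) \<le> 1" using norm_triangle_ineq[of w r] by simp
  moreover have "w + r \<in> euc n" unfolding r_def using w y z by (intro euc_add euc_scaleR euc_diff)
  ultimately have "w + r \<in> K" using K(2) by (auto simp: euc_ball_def)
  moreover have "y = (1 - e) *\<^sub>R z + e *\<^sub>R (w + r)" using e by (simp add: r_def algebra_simps)
  ultimately show "y \<in> K" using K(1) z e by (auto intro: convexD)
qed

lemma illuminates_if_enters_ball:
  assumes K: "convex K" "euc_ball n \<subseteq> K" and z: "z \<in> K" "z \<in> euc n" and u: "u \<in> euc_sphere n"
    and \<tau>: "\<tau> > 0" "norm (z + \<tau> *\<^sub>R u) < 1"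
  shows "illuminates n K u z"
  unfolding illuminates_def
proof (intro allI impI)
  fix \<delta> :: real assume \<delta>: "\<delta> > 0"
  have un: "u \<in> euc n" "norm u = 1" using u by (auto simp: euc_sphere_def)
  define e where "e = min 1 (\<delta> / (2 * \<tau>))"
  have e: "0 < e" "e \<le> 1" "e * \<tau> < \<delta>"
  proof -
    show "0 < e" "e \<le> 1" using \<tau> \<delta> by (auto simp: e_def)
    have "e * \<tau> \<le> \<delta> / (2 * \<tau>) * \<tau>" unfolding e_def using \<tau> by (intro mult_right_mono) auto
    thus "e * \<tau> < \<delta>" using \<tau> \<delta> by simp
  qed
  have "z + e *\<^sub>R ((z + \<tau> *\<^sub>R u) - z) \<in> euc_interior n K"
    using un z \<tau> e by (intro interior_towards_ball K euc_add euc_scaleR) auto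
  hence "z + (e * \<tau>) *\<^sub>R u \<in> euc_interior n K" by simp
  moreover have "dist z (z + (e * \<tau>) *\<^sub>R u) < \<delta>" using e \<tau> un by (simp add: dist_norm)
  ultimately show "\<exists>t\<ge>0. z + t *\<^sub>R u \<in> euc_interior n K \<and> dist z (z + t *\<^sub>R u) < \<delta>"
    using e \<tau> by (intro exI[of _ "e * \<tau>"]) auto
qed

text \<open>
  Let \<open>z = (1 - t) x + t b\<close> be a boundary point with \<open>b\<close> in the unit ball. If \<open>t < 1\<close>, then a direction
  that takes the vertex \<open>x\<close> into the open ball takes \<open>z\<close> there as well, after \<open>1 - t\<close> times the way,
  by convexity of the norm. If \<open>t = 1\<close>, then \<open>z = b\<close> is a unit vector, and a direction with \<open>u \<bullet> b < 0\<close>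
  enters the open ball at once.
\<close>

lemma spiky_illuminated:
  assumes X: "X \<subseteq> euc n" "X \<noteq> {}" and K: "K = spiky n X" "convex K" "compact K"
    and U: "U \<subseteq> euc_sphere n"
    and apex: "\<And>x. x \<in> X \<Longrightarrow> \<exists>u\<in>U. \<exists>\<tau>>0. norm (x + \<tau> *\<^sub>R u) < 1"
    and base: "\<And>b. b \<in> euc_sphere n \<Longrightarrow> \<exists>u\<in>U. inner u b < 0"
    and z: "z \<in> euc_boundary n K"
  shows "\<exists>u\<in>U. illuminates n K u z"
proof -
  have Ke: "K \<subseteq> euc n" using spike_subset_euc X(1) by (auto simp: K spiky_eq)
  have ballK: "euc_ball n \<subseteq> K" using ball_subset_spike X(2) by (force simp: K spiky_eq)
  have "closedin (top_of_set (euc n)) K"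
    using compact_imp_closed[OF K(3)] Ke by (simp add: closed_subset)
  hence zK: "z \<in> K" using z frontier_of_subset_closedin unfolding euc_boundary_def by blast
  have "\<exists>u\<in>U. \<exists>\<tau>>0. norm (z + \<tau> *\<^sub>R u) < 1"
  proof -
    obtain x where x: "x \<in> X" "z \<in> spike n x" using zK by (auto simp: K(1) spiky_eq)
    obtain b t where bt: "b \<in> euc_ball n" "0 \<le> t" "t \<le> 1"
      and zd: "z = (1 - t) *\<^sub>R x + t *\<^sub>R b"
      using x(2) unfolding spike_iff by blast
    have nb: "norm b \<le> 1" "b \<in> euc n" using bt by (auto simp: euc_ball_def)
    show ?thesis
    proof (cases "t < 1")
      case True
      obtain u \<tau> where u: "u \<in> U" "\<tau> > 0" "norm (x + \<tau> *\<^sub>R u) < 1" using apex[OF x(1)] by blast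
      have "z + ((1 - t) * \<tau>) *\<^sub>R u = (1 - t) *\<^sub>R (x + \<tau> *\<^sub>R u) + t *\<^sub>R b"
        by (simp add: zd scaleR_add_right)
      hence "norm (z + ((1 - t) * \<tau>) *\<^sub>R u) \<le> (1 - t) * norm (x + \<tau> *\<^sub>R u) + t * norm b"
        using norm_triangle_ineq[of "(1 - t) *\<^sub>R (x + \<tau> *\<^sub>R u)" "t *\<^sub>R b"] bt True by simp
      also have "\<dots> < (1 - t) * 1 + t * 1"
        using u(3) nb bt True by (intro add_less_le_mono mult_strict_left_mono mult_left_mono) auto
      finally show ?thesis using u(1,2) True by (intro bexI[of _ u] exI[of _ "(1 - t) * \<tau>"]) auto
    next
      case False
      hence zb: "z = b" using bt zd by simp
      have "norm b = 1"
      proof (rule ccontr)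
        assume "norm b \<noteq> 1"
        hence "norm z < 1" using nb zb by simp
        hence "z + 1 *\<^sub>R (z - z) \<in> euc_interior n K"
          using nb zb zK ballK K(2) by (intro interior_towards_ball) auto
        thus False using z by (simp add: euc_boundary_def euc_interior_def frontier_of_def)
      qed
      hence "b \<in> euc_sphere n" using nb by (simp add: euc_sphere_def)
      then obtain u where u: "u \<in> U" "inner u b < 0" using base by blast
      define \<tau> where "\<tau> = - inner u b"
      have uu: "inner u u = 1" using sphere_inner u(1) U by blast
      have "inner b b = 1" using \<open>norm b = 1\<close> by (simp add: norm_eq_1)
      hence "(norm (b + \<tau> *\<^sub>R u))\<^sup>2 = 1 - \<tau>\<^sup>2"
        unfolding power2_norm_eq_inner using uu
        by (simp add: inner_add_left inner_add_right inner_commute \<tau>_def power2_eq_square algebra_simps)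
      moreover have "\<tau>\<^sup>2 > 0" using u by (simp add: \<tau>_def)
      ultimately have "(norm (b + \<tau> *\<^sub>R u))\<^sup>2 < 1\<^sup>2" by simp
      hence "norm (b + \<tau> *\<^sub>R u) < 1" by (rule power2_less_imp_less) simp
      thus ?thesis using u zb by (intro bexI[of _ u] exI[of _ \<tau>]) (auto simp: \<tau>_def)
    qed
  qed
  then obtain u \<tau> where "u \<in> U" "\<tau> > 0" "norm (z + \<tau> *\<^sub>R u) < 1" by blast
  thus ?thesis using illuminates_if_enters_ball[OF K(2) ballK zK] zK Ke U by blast
qed

lemma unit_vector:
  assumes "i < n"
  defines "e \<equiv> euc_vec n (\<lambda>j. if j = i then 1 else 0)"
  shows "e \<in> euc_sphere n" "inner e b = coord b i"
proof -
  have in_e: "e \<in> euc n" by (simp add: e_def euc_vec_in)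
  show ib: "inner e b = coord b i" for b
    unfolding inner_euc[OF in_e] using assms(1)
    by (simp add: e_def coord_euc_vec if_distrib[of "\<lambda>t. t * _"] cong: if_cong)
  have "inner e e = 1" unfolding ib using assms(1) by (simp add: e_def coord_euc_vec)
  thus "e \<in> euc_sphere n" using in_e by (simp add: euc_sphere_def norm_eq_1)
qed

lemma axis_directions:
  "\<exists>A. finite A \<and> A \<subseteq> euc_sphere n \<and> card A \<le> 2 * n \<and> (\<forall>b\<in>euc_sphere n. \<exists>u\<in>A. inner u b < 0)"
proof -
  define e where "e i = euc_vec n (\<lambda>j. if j = i then 1 else 0)" for i
  define A where "A = e ` {..<n} \<union> uminus ` e ` {..<n}"
  have "card A \<le> card (e ` {..<n}) + card (uminus ` e ` {..<n})" unfolding A_def by (rule card_Un_le)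
  also have "\<dots> \<le> n + n"
    using card_image_le[of "{..<n}" e] card_image_le[of "e ` {..<n}" uminus] by auto
  finally have "card A \<le> 2 * n" by simp
  moreover have "A \<subseteq> euc_sphere n"
    using unit_vector(1)[of _ n] unfolding A_def e_def[symmetric] by (auto simp: euc_sphere_def euc_uminus)
  moreover have "\<exists>u\<in>A. inner u b < 0" if b: "b \<in> euc_sphere n" for b
  proof -
    have "b \<noteq> 0" using b by (auto simp: euc_sphere_def)
    then obtain i where i: "coord b i \<noteq> 0" by (auto simp: fseq_eq_iff)
    have "i < n" using b i coord_zero_euc by (auto simp: euc_sphere_def)
    hence "e i \<in> A" "- e i \<in> A" "inner (e i) b = coord b i"
      using unit_vector(2)[of i n b] by (auto simp: A_def e_def)
    moreover from this have "inner (- e i) b = - coord b i" by simp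
    ultimately show ?thesis using i by (metis linorder_neqE_linordered_idom neg_less_0_iff_less)
  qed
  ultimately show ?thesis by (intro exI[of _ A]) (auto simp: A_def)
qed

text \<open>
  The directions are the negatives of \<open>C\<close>, which serve the vertices whose hidden cap has radius
  less than \<open>\<alpha>\<close>, the inward directions \<open>- sgn x\<close> of the remaining vertices \<open>x\<close>, whose number is at most
  \<open>m\<close> because their normalisations form a code, and the \<open>2 n\<close> axis directions for the points on the
  unit sphere.
\<close>

theorem cap_illumination_bound:
  assumes \<alpha>: "0 < \<alpha>" "\<alpha> < pi / 2"
    and cover: "finite C" "C \<subseteq> euc_sphere n" "\<And>v. v \<in> euc_sphere n \<Longrightarrow> \<exists>u\<in>C. inner u v > sin \<alpha>"
    and code: "\<And>V. finite V \<Longrightarrow> V \<subseteq> euc_sphere n \<Longrightarrow>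
                 (\<forall>x\<in>V. \<forall>y\<in>V. x \<noteq> y \<longrightarrow> inner x y \<le> cos (2 * \<alpha>)) \<Longrightarrow> card V \<le> m"
  shows "cap_illumination_number n \<le> enat (card C + m + 2 * n)"
proof -
  have "illumination_number n K \<le> enat (card C + m + 2 * n)" if cap: "cap_body n K" for K
  proof -
    obtain X where X: "finite X" "X \<noteq> {}" "X \<subseteq> euc n - euc_ball n" "K = spiky n X"
        "\<forall>x\<in>X. spiky n X \<noteq> spiky n (X - {x})"
      and K: "convex K" "compact K"
      using cap unfolding cap_body_def spiky_ball_def by blast
    have X1: "x \<in> euc n" "norm x > 1" if "x \<in> X" for x
      using X(3) that by (auto simp: euc_ball_def)
    define B where "B = {x \<in> X. 1 \<le> norm x * cos \<alpha>}"
    have finB: "finite B" using X by (simp add: B_def)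
    have ca: "0 < cos \<alpha>" "0 < sin \<alpha>" using \<alpha> by (auto intro!: cos_gt_zero sin_gt_zero)
    have sgnX: "sgn x \<in> euc_sphere n" if "x \<in> X" for x
      using X1[OF that] by (auto simp: euc_sphere_def norm_sgn intro: euc_sgn)
    have sep: "inner (sgn x) (sgn y) \<le> cos (2 * \<alpha>)" if B: "x \<in> B" "y \<in> B" "x \<noteq> y" for x y
    proof -
      have xy: "x \<in> X" "y \<in> X" "1 \<le> norm x * cos \<alpha>" "1 \<le> norm y * cos \<alpha>" using B by (auto simp: B_def)
      obtain s where "0 < s" "s < 1" "norm ((1 - s) *\<^sub>R x + s *\<^sub>R y) \<le> 1"
        using segment_meets_ball[OF X(1,3,5) _ xy(1,2) B(3)] K X(4) by blast
      thus ?thesis using wide_caps_separated[OF \<alpha> xy(3,4)] by blast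
    qed
    have "card (sgn ` B) \<le> m"
    proof (rule code)
      show "sgn ` B \<subseteq> euc_sphere n" using sgnX by (auto simp: B_def)
      show "\<forall>x\<in>sgn ` B. \<forall>y\<in>sgn ` B. x \<noteq> y \<longrightarrow> inner x y \<le> cos (2 * \<alpha>)" using sep by blast
    qed (use finB in simp)
    from axis_directions[of n] obtain A where A: "finite A" "A \<subseteq> euc_sphere n" "card A \<le> 2 * n"
      "\<forall>b\<in>euc_sphere n. \<exists>u\<in>A. inner u b < 0" by (elim exE conjE)
    define U where "U = uminus ` C \<union> uminus ` sgn ` B \<union> A"
    have finU: "finite U" using cover A finB by (simp add: U_def)
    have "card U \<le> card (uminus ` C) + card (uminus ` sgn ` B) + card A"
      unfolding U_def by (rule order.trans[OF card_Un_le add_right_mono[OF card_Un_le]])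
    also have "\<dots> \<le> card C + m + 2 * n"
      using card_image_le[OF cover(1), of uminus] card_image_le[of "sgn ` B" uminus] finB A(3)
        \<open>card (sgn ` B) \<le> m\<close> by auto
    finally have cardU: "card U \<le> card C + m + 2 * n" .
    have US: "U \<subseteq> euc_sphere n"
      using cover(2) A(2) sgnX by (auto simp: U_def B_def euc_sphere_def euc_uminus)
    have "\<forall>z\<in>euc_boundary n K. \<exists>u\<in>U. illuminates n K u z"
    proof (intro ballI spiky_illuminated[OF _ X(2) X(4) K US])
      show "X \<subseteq> euc n" using X1 by blast
    next
      fix x assume x: "x \<in> X"
      show "\<exists>u\<in>U. \<exists>\<tau>>0. norm (x + \<tau> *\<^sub>R u) < 1"
      proof (cases "x \<in> B")
        case True
        have "norm x > 0" using X1(2)[OF x] by linarith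
        hence "x \<noteq> 0" by simp
        hence "x + norm x *\<^sub>R (- sgn x) = 0" by (simp add: sgn_div_norm)
        moreover have "- sgn x \<in> U" using True by (auto simp: U_def)
        ultimately show ?thesis using X1[OF x]
          by (intro bexI[of _ "- sgn x"] exI[of _ "norm x"]) auto
      next
        case False
        hence sm: "norm x * cos \<alpha> < 1" using x by (simp add: B_def)
        obtain u where u: "u \<in> C" "inner u (sgn x) > sin \<alpha>" using cover(3)[OF sgnX[OF x]] by blast
        have nx: "norm x > 0" using X1(2)[OF x] by linarith
        define \<tau> where "\<tau> = inner u x"
        have \<tau>: "\<tau> > norm x * sin \<alpha>" using u(2) nx by (simp add: \<tau>_def sgn_div_norm field_simps)
        have pos: "norm x * sin \<alpha> > 0" using nx ca by simp
        have uu: "inner u u = 1" using sphere_inner u(1) cover(2) by blast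
        have "(norm (x + \<tau> *\<^sub>R (- u)))\<^sup>2 = (norm x)\<^sup>2 - \<tau>\<^sup>2"
          unfolding power2_norm_eq_inner using uu
          by (simp add: inner_diff_left inner_diff_right inner_commute \<tau>_def power2_eq_square algebra_simps)
        also have "\<dots> < (norm x)\<^sup>2 - (norm x * sin \<alpha>)\<^sup>2"
          using \<tau> pos by (simp add: power_strict_mono)
        also have "\<dots> = (norm x * cos \<alpha>)\<^sup>2"
          by (simp add: power_mult_distrib cos_squared_eq algebra_simps)
        also have "\<dots> \<le> 1\<^sup>2" using sm nx ca by (intro power_mono) auto
        finally have "norm (x + \<tau> *\<^sub>R (- u)) < 1" by (rule power2_less_imp_less) simp
        moreover have "- u \<in> U" using u by (auto simp: U_def)
        ultimately show ?thesis using \<tau> pos by (intro bexI[of _ "- u"] exI[of _ \<tau>]) auto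
      qed
    next
      fix b assume "b \<in> euc_sphere n"
      thus "\<exists>u\<in>U. inner u b < 0" using A(4) by (auto simp: U_def)
    qed auto
    hence "illumination_number n K \<le> enat (card U)"
      unfolding illumination_number_def using finU US by (intro Inf_lower) blast
    also have "\<dots> \<le> enat (card C + m + 2 * n)" using cardU by simp
    finally show ?thesis .
  qed
  thus ?thesis unfolding cap_illumination_number_def by (intro SUP_least) auto
qed

section \<open>Numerical bounds\<close>

lemma sin_taylor:
  "\<bar>sin x - (x - x ^ 3 / 6 + x ^ 5 / 120 - x ^ 7 / 5040 + x ^ 9 / 362880 - x ^ 11 / 39916800)\<bar>
     \<le> \<bar>x\<bar> ^ 13 / 6227020800" for x :: real
proof -
  have S: "(\<Sum>m<13. sin_coeff m * x ^ m)
      = x - x ^ 3 / 6 + x ^ 5 / 120 - x ^ 7 / 5040 + x ^ 9 / 362880 - x ^ 11 / 39916800"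
    by (simp add: lessThan_nat_numeral sin_coeff_def fact_numeral)
  have f: "fact 13 = (6227020800 :: real)" by (simp add: fact_numeral)
  show ?thesis using Maclaurin_sin_bound[of x 13] unfolding S f divide_inverse[of "\<bar>x\<bar> ^ 13"]
    by (simp only: mult.commute)
qed

lemma cos_taylor:
  "\<bar>cos x - (1 - x ^ 2 / 2 + x ^ 4 / 24 - x ^ 6 / 720 + x ^ 8 / 40320)\<bar> \<le> \<bar>x\<bar> ^ 10 / 3628800" for x :: real
proof -
  obtain t where t: "cos x = (\<Sum>m<10. cos_coeff m * x ^ m) + cos (t + 1 / 2 * real 10 * pi) / fact 10 * x ^ 10"
    using Maclaurin_cos_expansion[of x 10] by blast
  have "(\<Sum>m<10. cos_coeff m * x ^ m) = 1 - x ^ 2 / 2 + x ^ 4 / 24 - x ^ 6 / 720 + x ^ 8 / 40320"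
    by (simp add: lessThan_nat_numeral cos_coeff_def fact_numeral)
  moreover have "\<bar>cos (t + 1 / 2 * real 10 * pi) / fact 10 * x ^ 10\<bar> \<le> \<bar>x\<bar> ^ 10 / 3628800"
  proof -
    have "\<bar>cos (t + 1 / 2 * real 10 * pi)\<bar> * \<bar>x\<bar> ^ 10 \<le> 1 * \<bar>x\<bar> ^ 10"
      by (intro mult_right_mono) auto
    hence "\<bar>cos (t + 1 / 2 * real 10 * pi)\<bar> * \<bar>x\<bar> ^ 10 / 3628800 \<le> 1 * \<bar>x\<bar> ^ 10 / 3628800"
      by (rule divide_right_mono) simp
    moreover have "fact 10 = (3628800 :: real)" by (simp add: fact_numeral)
    ultimately show ?thesis by (simp only: abs_mult abs_divide power_abs)
  qed
  ultimately show ?thesis using t by linarith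
qed

lemma sin_lessI:
  "x - x ^ 3 / 6 + x ^ 5 / 120 - x ^ 7 / 5040 + x ^ 9 / 362880 - x ^ 11 / 39916800 + \<bar>x\<bar> ^ 13 / 6227020800 < u
     \<Longrightarrow> sin x < u" for x :: real
  using sin_taylor[of x] by linarith

lemma sin_greaterI:
  "l < x - x ^ 3 / 6 + x ^ 5 / 120 - x ^ 7 / 5040 + x ^ 9 / 362880 - x ^ 11 / 39916800 - \<bar>x\<bar> ^ 13 / 6227020800
     \<Longrightarrow> l < sin x" for x :: real
  using sin_taylor[of x] by linarith

lemma cos_lessI:
  "1 - x ^ 2 / 2 + x ^ 4 / 24 - x ^ 6 / 720 + x ^ 8 / 40320 + \<bar>x\<bar> ^ 10 / 3628800 < u \<Longrightarrow> cos x < u" for x :: real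
  using cos_taylor[of x] by linarith

lemma cos_greaterI:
  "l < 1 - x ^ 2 / 2 + x ^ 4 / 24 - x ^ 6 / 720 + x ^ 8 / 40320 - \<bar>x\<bar> ^ 10 / 3628800 \<Longrightarrow> l < cos x" for x :: real
  using cos_taylor[of x] by linarith

text \<open>
  The partial sums of \<open>ln x = 2 * (\<Sum>k. y ^ (2 k + 1) / (2 k + 1))\<close> with \<open>y = (x - 1) / (x + 1)\<close>.
\<close>

lemma ln_geI:
  fixes x :: real
  assumes "x > 1" "l \<le> (\<Sum>k<n. 2 * ((x - 1) / (x + 1)) ^ (2 * k + 1) / real (2 * k + 1))"
  shows "l \<le> ln x"
  using ln_approx_bounds[OF assms(1), of n] assms(2) by simp

text \<open>
  The series argument may be replaced by a rational \<open>y\<close> with few digits, which keeps the numbers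
  in the evaluation small.
\<close>

lemma ln_leI:
  fixes x :: real
  assumes x: "x > 1" and y: "x - 1 \<le> y * (x + 1)" "y \<le> 1 / 2"
    and u: "(\<Sum>k<n. 2 * y ^ (2 * k + 1) / real (2 * k + 1)) + 3 * y ^ (2 * n + 1) / real (2 * n + 1) \<le> u"
  shows "ln x \<le> u"
proof -
  define z where "z = (x - 1) / (x + 1)"
  have "0 \<le> z" "z \<le> y" using x y by (auto simp: z_def pos_divide_le_eq)
  hence z: "0 \<le> z" "z \<le> y" "z \<le> 1 / 2" using y by auto
  have "z\<^sup>2 \<le> (1 / 2)\<^sup>2" using z by (intro power_mono)
  hence "1 - z\<^sup>2 \<ge> 2 / 3" by (simp add: power_divide)
  hence "z ^ (2 * n + 1) / (1 - z\<^sup>2) \<le> z ^ (2 * n + 1) / (2 / 3)"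
    using z by (intro divide_left_mono) auto
  also have "\<dots> \<le> y ^ (2 * n + 1) / (2 / 3)" using z by (intro divide_right_mono power_mono) auto
  finally have "z ^ (2 * n + 1) / (1 - z\<^sup>2) / real (2 * n + 1) \<le> y ^ (2 * n + 1) / (2 / 3) / real (2 * n + 1)"
    by (rule divide_right_mono) simp
  hence "2 * (z ^ (2 * n + 1) / (1 - z\<^sup>2) / real (2 * n + 1)) \<le> 2 * (y ^ (2 * n + 1) / (2 / 3) / real (2 * n + 1))"
    by (rule mult_left_mono) simp
  also have "2 * (y ^ (2 * n + 1) / (2 / 3) / real (2 * n + 1)) = 3 * y ^ (2 * n + 1) / real (2 * n + 1)"
  proof -
    have "2 * (w / (2 / 3) / m) = 3 * w / m" for w m :: real by simp
    thus ?thesis .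
  qed
  finally have "2 * (z ^ (2 * n + 1) / (1 - z\<^sup>2) / real (2 * n + 1)) \<le> 3 * y ^ (2 * n + 1) / real (2 * n + 1)" .
  moreover have "(\<Sum>k<n. 2 * z ^ (2 * k + 1) / real (2 * k + 1)) \<le> (\<Sum>k<n. 2 * y ^ (2 * k + 1) / real (2 * k + 1))"
    using z by (intro sum_mono divide_right_mono mult_left_mono power_mono) auto
  moreover have "ln x \<le> (\<Sum>k<n. 2 * z ^ (2 * k + 1) / real (2 * k + 1))
      + 2 * (z ^ (2 * n + 1) / (1 - z\<^sup>2) / real (2 * n + 1))"
    using ln_approx_bounds[OF x, of n] by (simp add: z_def)
  ultimately show ?thesis using u by linarith
qed

text \<open>
  The arguments here and in \<open>cos_num\<close> come from the ends of the interval that contains the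
  balanced angle, doubled for the sine.
\<close>

lemma sin_num: "sin (1.167615 :: real) < 0.919817471" "sin (1.167617 :: real) > 0.91981825"
  by (rule sin_lessI sin_greaterI, simp add: power_divide)+

lemma cos_num: "cos (0.5838075 :: real) > 0.834369989" "cos (0.5838085 :: real) < 0.83436945"
    "cos (0.5838085 :: real) > 0.83436943"
  by (rule cos_lessI cos_greaterI, simp add: power_divide)+

lemma ln2_num: "ln (2 :: real) \<ge> 0.69314718" "ln (2 :: real) \<le> 0.6931472"
  by (rule ln_geI[where n = 9], simp, simp add: lessThan_nat_numeral power_divide)
     (rule ln_leI[where n = 8 and y = "1 / 3"], simp, simp, simp, simp add: lessThan_nat_numeral power_divide)

lemma ln_num_lower:
  "ln (1.0435861 :: real) \<ge> 0.04266295" "ln (1 / (16 * 0.0435861) :: real) \<ge> 0.360428"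
  "ln (1 / 0.83436945 :: real) \<ge> 0.18107898"
  by (rule ln_geI[where n = 4], simp, simp add: lessThan_nat_numeral power_divide)+

lemma ln_num_upper:
  "ln (1 / 0.834369989 :: real) \<le> 0.18107835"
  "ln (1.0435857 :: real) \<le> 0.0426626"
  "ln (1 / (16 * 0.0435857) :: real) \<le> 0.360438"
  by (rule ln_leI[where n = 4 and y = "0.0902925866"], simp, simp, simp, simp add: lessThan_nat_numeral power_divide)
     (rule ln_leI[where n = 2 and y = "0.0213280510"], simp, simp, simp, simp add: lessThan_nat_numeral power_divide,
      rule ln_leI[where n = 4 and y = "0.178292645"], simp, simp, simp, simp add: lessThan_nat_numeral power_divide)

section \<open>The balanced angle\<close>

definition ln_kl_rate_formula :: "real \<Rightarrow> real" where
  "ln_kl_rate_formula \<rho> = (1 + \<rho>) * ln (1 + \<rho>) - \<rho> * ln \<rho>"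

lemma kl_rate_pos: "\<rho> > 0 \<Longrightarrow> kl_rate \<rho> > 0"
  by (simp add: kl_rate_def)

lemma ln_kl_rate: "\<rho> > 0 \<Longrightarrow> ln (kl_rate \<rho>) = ln_kl_rate_formula \<rho>"
  unfolding kl_rate_def by (subst ln_mult) (auto simp: ln_powr ln_div ln_kl_rate_formula_def algebra_simps)

lemma ln_kl_rate_strict_mono:
  assumes "0 < a" "a < b"
  shows "ln_kl_rate_formula a < ln_kl_rate_formula b"
proof (rule DERIV_pos_imp_increasing[OF assms(2)])
  fix x assume x: "a \<le> x" "x \<le> b"
  have "(ln_kl_rate_formula has_real_derivative (ln (1 + x) - ln x)) (at x)"
    unfolding ln_kl_rate_formula_def[abs_def] using assms x by (auto intro!: derivative_eq_intros)
  moreover have "ln (1 + x) - ln x > 0" using assms x by simp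
  ultimately show "\<exists>y. (ln_kl_rate_formula has_real_derivative y) (at x) \<and> y > 0" by blast
qed

text \<open>
  The positive solution \<open>\<rho>\<close> of \<open>2 * sqrt (\<rho> * (1 + \<rho>)) / (1 + 2 * \<rho>) = cos (2 * \<alpha>)\<close>, that is, the threshold
  of \<open>kabatiansky_levenshtein\<close> for codes of minimal angle \<open>2 * \<alpha>\<close>.
\<close>

definition kl_param :: "real \<Rightarrow> real" where
  "kl_param \<alpha> = (1 - sin (2 * \<alpha>)) / (2 * sin (2 * \<alpha>))"

lemma sin_double_range:
  assumes "0 < \<alpha>" "\<alpha> < pi / 4"
  shows "0 < sin (2 * \<alpha>)" "sin (2 * \<alpha>) < 1"
proof -
  show "0 < sin (2 * \<alpha>)" using assms by (intro sin_gt_zero) auto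
  have "sin (2 * \<alpha>) < sin (pi / 2)" using assms by (intro sin_monotone_2pi) auto
  thus "sin (2 * \<alpha>) < 1" by simp
qed

lemma kl_param_props:
  assumes "0 < \<alpha>" "\<alpha> < pi / 4"
  shows "kl_param \<alpha> > 0" "1 + kl_param \<alpha> = (1 + sin (2 * \<alpha>)) / (2 * sin (2 * \<alpha>))"
    "1 + 2 * kl_param \<alpha> = 1 / sin (2 * \<alpha>)"
proof -
  define S where "S = sin (2 * \<alpha>)"
  have S: "0 < S" "S < 1" using sin_double_range[OF assms] by (auto simp: S_def)
  show "kl_param \<alpha> > 0" "1 + kl_param \<alpha> = (1 + sin (2 * \<alpha>)) / (2 * sin (2 * \<alpha>))"
    "1 + 2 * kl_param \<alpha> = 1 / sin (2 * \<alpha>)"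
    unfolding kl_param_def S_def[symmetric] using S by (auto simp: field_simps)
qed

text \<open>
  The difference of the logarithms of the two sides of the equation in \<open>cap_angle\<close>.
\<close>

definition balance :: "real \<Rightarrow> real" where
  "balance \<alpha> = ln_kl_rate_formula (kl_param \<alpha>) + ln (cos \<alpha>)"

lemma cap_angle_balance:
  "cap_angle \<alpha> \<longleftrightarrow> 0 < \<alpha> \<and> \<alpha> < pi / 4 \<and> 1 / cos \<alpha> = kl_rate (kl_param \<alpha>)"
  "cap_angle \<alpha> \<longleftrightarrow> 0 < \<alpha> \<and> \<alpha> < pi / 4 \<and> balance \<alpha> = 0"
proof -
  have "((1 + sin (2 * \<alpha>)) / (2 * sin (2 * \<alpha>))) powr ((1 + sin (2 * \<alpha>)) / (2 * sin (2 * \<alpha>))) *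
       (2 * sin (2 * \<alpha>) / (1 - sin (2 * \<alpha>))) powr ((1 - sin (2 * \<alpha>)) / (2 * sin (2 * \<alpha>)))
       = kl_rate (kl_param \<alpha>) \<and> (1 / cos \<alpha> = kl_rate (kl_param \<alpha>) \<longleftrightarrow> balance \<alpha> = 0)"
    if \<alpha>: "0 < \<alpha>" "\<alpha> < pi / 4"
  proof -
    define \<rho> where "\<rho> = kl_param \<alpha>"
    have \<rho>: "\<rho> > 0" using kl_param_props[OF \<alpha>] by (simp add: \<rho>_def)
    have i: "2 * sin (2 * \<alpha>) / (1 - sin (2 * \<alpha>)) = 1 / \<rho>" by (simp add: \<rho>_def kl_param_def)
    have "(1 + \<rho>) powr (1 + \<rho>) * (1 / \<rho>) powr \<rho> = kl_rate \<rho>"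
      using \<rho> by (simp add: kl_rate_def powr_add powr_divide)
    moreover have "1 / cos \<alpha> = kl_rate \<rho> \<longleftrightarrow> balance \<alpha> = 0"
    proof -
      have c: "cos \<alpha> > 0" using \<alpha> by (intro cos_gt_zero) auto
      have "1 / cos \<alpha> = kl_rate \<rho> \<longleftrightarrow> ln (1 / cos \<alpha>) = ln (kl_rate \<rho>)"
        using c kl_rate_pos[OF \<rho>] by (subst ln_inj_iff) auto
      also have "\<dots> \<longleftrightarrow> balance \<alpha> = 0"
        using c ln_kl_rate[OF \<rho>] by (auto simp: ln_div balance_def \<rho>_def)
      finally show ?thesis .
    qed
    ultimately show ?thesis
      unfolding i kl_param_props(2)[OF \<alpha>, symmetric] kl_param_def[of \<alpha>, symmetric] \<rho>_def by blast
  qed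
  thus "cap_angle \<alpha> \<longleftrightarrow> 0 < \<alpha> \<and> \<alpha> < pi / 4 \<and> 1 / cos \<alpha> = kl_rate (kl_param \<alpha>)"
    "cap_angle \<alpha> \<longleftrightarrow> 0 < \<alpha> \<and> \<alpha> < pi / 4 \<and> balance \<alpha> = 0"
    unfolding cap_angle_def by auto
qed

lemma kl_param_antimono:
  assumes "0 < \<alpha>" "\<alpha> < \<beta>" "\<beta> < pi / 4"
  shows "kl_param \<beta> < kl_param \<alpha>"
proof -
  have "sin (2 * \<alpha>) < sin (2 * \<beta>)" using assms by (intro sin_monotone_2pi) auto
  hence "1 / sin (2 * \<beta>) < 1 / sin (2 * \<alpha>)"
    using sin_double_range[of \<alpha>] assms by (intro divide_strict_left_mono mult_pos_pos) auto
  thus ?thesis using kl_param_props(3)[of \<alpha>] kl_param_props(3)[of \<beta>] assms by linarith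
qed

lemma balance_antimono:
  assumes "0 < \<alpha>" "\<alpha> < \<beta>" "\<beta> < pi / 4"
  shows "balance \<beta> < balance \<alpha>"
proof -
  have "ln_kl_rate_formula (kl_param \<beta>) < ln_kl_rate_formula (kl_param \<alpha>)"
    using kl_param_antimono[OF assms] kl_param_props(1)[of \<beta>] assms by (intro ln_kl_rate_strict_mono) auto
  moreover have "cos \<beta> < cos \<alpha>" "cos \<beta> > 0"
    using assms by (auto intro!: cos_monotone_0_pi cos_gt_zero)
  hence "ln (cos \<beta>) < ln (cos \<alpha>)" by simp
  ultimately show ?thesis by (simp add: balance_def)
qed

text \<open>
  The value of \<open>balance\<close> is about \<open>1.5 * 10\<^sup>-\<^sup>7\<close> here. The constants \<open>r\<close> and \<open>c\<close> are lower bounds of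
  \<open>kl_param\<close> and of the cosine at this angle, sharp enough to keep the sign. As the series for the
  logarithm converges fast only near \<open>1\<close>, \<open>ln r\<close> is computed as \<open>ln (16 * r) - 4 * ln 2\<close>.
\<close>

lemma balance_left: "balance 0.5838075 > 0"
proof -
  define r c :: real where "r = 0.0435861" and "c = 0.834369989"
  define \<alpha> :: real where "\<alpha> = 0.5838075"
  have \<alpha>: "0 < \<alpha>" "\<alpha> < pi / 4" using pi_gt3 by (auto simp: \<alpha>_def)
  have "sin (2 * \<alpha>) < 0.919817471" using sin_num(1) by (simp add: \<alpha>_def)
  hence "1 / 0.919817471 \<le> 1 / sin (2 * \<alpha>)"
    using sin_double_range[OF \<alpha>] by (intro divide_left_mono) auto
  hence "r < kl_param \<alpha>" using kl_param_props(3)[OF \<alpha>] by (simp add: r_def)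
  hence 1: "ln_kl_rate_formula r < ln_kl_rate_formula (kl_param \<alpha>)" by (intro ln_kl_rate_strict_mono) (simp add: r_def)
  have "c < cos \<alpha>" using cos_num(1) by (simp add: \<alpha>_def c_def)
  hence 2: "ln c < ln (cos \<alpha>)" by (subst ln_less_cancel_iff) (auto simp: c_def)
  have l: "ln (1 / (16 * r)) = - (4 * ln 2) - ln r"
  proof -
    have r0: "r > 0" by (simp add: r_def)
    hence "ln (2 ^ 4 * r) = ln (2 ^ 4) + ln r" by (intro ln_mult_pos) auto
    moreover have "ln (16 :: real) = 4 * ln 2" using ln_realpow[of 2 4] by simp
    ultimately show ?thesis using r0 by (simp add: ln_div)
  qed
  have lc: "ln c \<ge> - 0.18107835"
    using ln_num_upper(1) by (simp add: ln_div c_def)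
  have "- ln r \<ge> 0.360428 + 4 * 0.69314718"
    using l ln_num_lower(2) ln2_num(1) unfolding r_def[symmetric] by linarith
  hence h2: "r * (- ln r) \<ge> r * (0.360428 + 4 * 0.69314718)"
    by (intro mult_left_mono) (auto simp: r_def)
  have h1: "(1 + r) * ln (1 + r) \<ge> (1 + r) * 0.04266295"
    using ln_num_lower(1) by (intro mult_left_mono) (auto simp: r_def)
  have h3: "(1 + r) * 0.04266295 + r * (0.360428 + 4 * 0.69314718) > 0.18107835"
    by (simp add: r_def)
  have "0 < A + B + l" if "a \<le> A" "b \<le> B" "k < a + b" "- k \<le> l" for a b k l A B :: real
    using that by linarith
  from this[OF h1 h2 h3 lc] have "ln_kl_rate_formula r + ln c > 0" unfolding ln_kl_rate_formula_def by simp
  thus ?thesis using 1 2 unfolding balance_def \<alpha>_def by linarith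
qed

lemma balance_right: "balance 0.5838085 < 0"
proof -
  define r c :: real where "r = 0.0435857" and "c = 0.83436945"
  define \<alpha> :: real where "\<alpha> = 0.5838085"
  have \<alpha>: "0 < \<alpha>" "\<alpha> < pi / 4" using pi_gt3 by (auto simp: \<alpha>_def)
  have "sin (2 * \<alpha>) > 0.91981825" using sin_num(2) by (simp add: \<alpha>_def)
  hence "1 / sin (2 * \<alpha>) \<le> 1 / 0.91981825"
    using sin_double_range[OF \<alpha>] by (intro divide_left_mono) auto
  hence "kl_param \<alpha> < r" using kl_param_props(3)[OF \<alpha>] by (simp add: r_def)
  hence 1: "ln_kl_rate_formula (kl_param \<alpha>) < ln_kl_rate_formula r" using kl_param_props(1)[OF \<alpha>] by (intro ln_kl_rate_strict_mono)
  have "cos \<alpha> < c" using cos_num(2) by (simp add: \<alpha>_def c_def)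
  moreover have "cos \<alpha> > 0" using \<alpha> by (intro cos_gt_zero) auto
  ultimately have 2: "ln (cos \<alpha>) < ln c" by (subst ln_less_cancel_iff) (auto simp: c_def)
  have l: "ln (1 / (16 * r)) = - (4 * ln 2) - ln r"
  proof -
    have r0: "r > 0" by (simp add: r_def)
    hence "ln (2 ^ 4 * r) = ln (2 ^ 4) + ln r" by (intro ln_mult_pos) auto
    moreover have "ln (16 :: real) = 4 * ln 2" using ln_realpow[of 2 4] by simp
    ultimately show ?thesis using r0 by (simp add: ln_div)
  qed
  have lc: "ln c \<le> - 0.18107898"
    using ln_num_lower(3) by (simp add: ln_div c_def)
  have "- ln r \<le> 0.360438 + 4 * 0.6931472"
    using l ln_num_upper(3) ln2_num(2) unfolding r_def[symmetric] by linarith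
  hence h2: "r * (- ln r) \<le> r * (0.360438 + 4 * 0.6931472)"
    by (intro mult_left_mono) (auto simp: r_def)
  have h1: "(1 + r) * ln (1 + r) \<le> (1 + r) * 0.0426626"
    using ln_num_upper(2) by (intro mult_left_mono) (auto simp: r_def)
  have h3: "(1 + r) * 0.0426626 + r * (0.360438 + 4 * 0.6931472) < 0.18107898"
    by (simp add: r_def)
  have "A + B + l < 0" if "A \<le> a" "B \<le> b" "a + b < k" "l \<le> - k" for a b k l A B :: real
    using that by linarith
  from this[OF h1 h2 h3 lc] have "ln_kl_rate_formula r + ln c < 0" unfolding ln_kl_rate_formula_def by simp
  thus ?thesis using 1 2 unfolding balance_def \<alpha>_def by linarith
qed

lemma cap_angle_bounds:
  assumes "cap_angle \<alpha>"
  shows "0.5838075 < \<alpha>" "\<alpha> < 0.5838085"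
proof -
  have \<alpha>: "0 < \<alpha>" "\<alpha> < pi / 4" "balance \<alpha> = 0" using assms cap_angle_balance(2) by auto
  show "0.5838075 < \<alpha>"
  proof (rule ccontr)
    assume "\<not> 0.5838075 < \<alpha>"
    hence "\<alpha> = 0.5838075 \<or> \<alpha> < 0.5838075" by linarith
    hence "balance 0.5838075 \<le> balance \<alpha>"
    proof
      assume "\<alpha> < 0.5838075"
      thus ?thesis using balance_antimono[of \<alpha> "0.5838075"] \<alpha>(1) pi_gt3 by simp
    qed (simp only: order_refl)
    thus False using balance_left \<alpha>(3) by simp
  qed
  show "\<alpha> < 0.5838085"
  proof (rule ccontr)
    assume "\<not> \<alpha> < 0.5838085"
    hence "\<alpha> = 0.5838085 \<or> 0.5838085 < \<alpha>" by linarith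
    hence "balance \<alpha> \<le> balance 0.5838085"
    proof
      assume "0.5838085 < \<alpha>"
      thus ?thesis using balance_antimono[of "0.5838085" \<alpha>] \<alpha>(2) by simp
    qed (simp only: order_refl)
    thus False using balance_right \<alpha>(3) by simp
  qed
qed

lemma cap_angle_unique: "\<exists>!\<alpha>. cap_angle \<alpha>"
proof -
  let ?I = "{0.5838075..0.5838085 :: real}"
  have I: "0 < \<alpha>" "\<alpha> < pi / 4" if "\<alpha> \<in> ?I" for \<alpha> using that pi_gt3 by auto
  have nz: "sin (2 * \<alpha>) \<noteq> 0" "kl_param \<alpha> > 0" "cos \<alpha> > 0" if "\<alpha> \<in> ?I" for \<alpha>
    using sin_double_range(1)[OF I[OF that]] kl_param_props(1)[OF I[OF that]] I[OF that]
    by (auto intro!: cos_gt_zero)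
  have "continuous_on ?I kl_param" unfolding kl_param_def[abs_def]
    using nz by (intro continuous_intros) auto
  hence "continuous_on ?I balance" unfolding balance_def[abs_def] ln_kl_rate_formula_def
    by (intro continuous_intros) (use nz in \<open>force+\<close>)
  hence "\<exists>\<alpha>. 0.5838075 \<le> \<alpha> \<and> \<alpha> \<le> 0.5838085 \<and> balance \<alpha> = 0"
    using balance_left balance_right by (intro IVT2') auto
  then obtain \<alpha> where \<alpha>: "\<alpha> \<in> ?I" "balance \<alpha> = 0" by auto
  have "cap_angle \<alpha>" using cap_angle_balance(2) \<alpha> I by blast
  moreover have "\<beta> = \<alpha>" if "cap_angle \<beta>" for \<beta>
    using cap_angle_balance(2)[of \<beta>] cap_angle_balance(2)[of \<alpha>] that calculation
      balance_antimono[of \<alpha> \<beta>] balance_antimono[of \<beta> \<alpha>]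
    by (cases \<alpha> \<beta> rule: linorder_cases) auto
  ultimately show ?thesis by blast
qed

section \<open>The asymptotic estimate\<close>

lemma kl_threshold:
  assumes \<alpha>: "0 < \<alpha>" "\<alpha> < pi / 4" and \<rho>: "kl_param \<alpha> < \<rho>"
  shows "cos (2 * \<alpha>) < 2 * sqrt (\<rho> * (1 + \<rho>)) / (1 + 2 * \<rho>)"
proof (rule power2_less_imp_less)
  have \<rho>0: "\<rho> > 0" using kl_param_props(1)[OF \<alpha>] \<rho> by simp
  show "0 \<le> 2 * sqrt (\<rho> * (1 + \<rho>)) / (1 + 2 * \<rho>)" using \<rho>0 by simp
  have S: "0 < sin (2 * \<alpha>)" using sin_double_range[OF \<alpha>] by simp
  have "1 / sin (2 * \<alpha>) < 1 + 2 * \<rho>" using kl_param_props(3)[OF \<alpha>] \<rho> by simp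
  hence "1 / (1 + 2 * \<rho>) < sin (2 * \<alpha>)" using S \<rho>0 by (simp add: field_simps)
  hence "(1 / (1 + 2 * \<rho>))\<^sup>2 < (sin (2 * \<alpha>))\<^sup>2" using \<rho>0 by (intro power_strict_mono) auto
  hence "(cos (2 * \<alpha>))\<^sup>2 < 1 - (1 / (1 + 2 * \<rho>))\<^sup>2" using sin_cos_squared_add[of "2 * \<alpha>"] by linarith
  also have "\<dots> = ((1 + 2 * \<rho>)\<^sup>2 - 1) / (1 + 2 * \<rho>)\<^sup>2"
    using \<rho>0 by (simp add: power_divide diff_divide_distrib)
  also have "(1 + 2 * \<rho>)\<^sup>2 - 1 = (2 * sqrt (\<rho> * (1 + \<rho>)))\<^sup>2"
    using \<rho>0 by (simp add: power_mult_distrib) (simp add: power2_eq_square algebra_simps)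
  finally show "(cos (2 * \<alpha>))\<^sup>2 < (2 * sqrt (\<rho> * (1 + \<rho>)) / (1 + 2 * \<rho>))\<^sup>2"
    by (simp only: power_divide)
qed

text \<open>
  Choose \<open>q\<close> just below \<open>cos \<alpha>\<close> for the covering and \<open>\<rho>\<close> just above \<open>kl_param \<alpha>\<close> for the code. At the
  balanced angle both exponential rates, \<open>1 / q\<close> and \<open>kl_rate \<rho>\<close>, are then below \<open>x\<close>. The summand
  \<open>1\<close> in the conclusion leaves room for a strict inequality between \<open>n\<close>-th roots.
\<close>

theorem cap_illumination_rate:
  assumes \<alpha>: "cap_angle \<alpha>" and x: "1 / cos \<alpha> < x"
  shows "\<forall>\<^sub>F n in sequentially. \<exists>N. cap_illumination_number n \<le> enat N \<and> real N + 1 < x ^ n"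
proof -
  have \<alpha>r: "0 < \<alpha>" "\<alpha> < pi / 4" "\<alpha> < pi / 2" and eq: "1 / cos \<alpha> = kl_rate (kl_param \<alpha>)"
    using \<alpha> cap_angle_balance(1) by auto
  have c: "cos \<alpha> > 0" "sin \<alpha> > 0" using \<alpha>r by (auto intro!: cos_gt_zero sin_gt_zero)
  have "1 / cos \<alpha> \<ge> 1" using c by simp
  hence x1: "x > 1" using x by linarith
  have "1 / x < cos \<alpha>" using x c x1 by (simp add: field_simps)
  then obtain q where q: "1 / x < q" "q < cos \<alpha>" using dense by blast
  have q0: "q > 0" using q(1) x1 by (auto intro: less_trans[of 0 "1 / x"])
  have "q\<^sup>2 < (cos \<alpha>)\<^sup>2" using q q0 by (intro power_strict_mono) auto
  hence "q\<^sup>2 + (sin \<alpha>)\<^sup>2 < 1" using sin_cos_squared_add[of \<alpha>] by linarith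
  from sphere_cap_cover[OF c(2) q0 this] obtain C where C: "C > 0"
    "\<And>n. n \<ge> 1 \<Longrightarrow> \<exists>U. finite U \<and> U \<subseteq> euc_sphere n \<and>
           (\<forall>v\<in>euc_sphere n. \<exists>u\<in>U. inner u v > sin \<alpha>) \<and> real (card U) \<le> C * (real n)\<^sup>2 * (1 / q) ^ n"
    by blast
  define \<rho>0 where "\<rho>0 = kl_param \<alpha>"
  have \<rho>0: "\<rho>0 > 0" using kl_param_props(1) \<alpha>r by (simp add: \<rho>0_def)
  have "isCont kl_rate \<rho>0" unfolding kl_rate_def[abs_def]
    using \<rho>0 by (intro continuous_intros) auto
  hence "(kl_rate \<longlongrightarrow> kl_rate \<rho>0) (at_right \<rho>0)"
    unfolding isCont_def by (rule filterlim_mono) (auto simp: at_le)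
  hence "\<forall>\<^sub>F \<rho> in at_right \<rho>0. kl_rate \<rho> < x"
    using x eq by (intro order_tendstoD(2)) (auto simp: \<rho>0_def)
  hence "\<forall>\<^sub>F \<rho> in at_right \<rho>0. kl_rate \<rho> < x \<and> \<rho> > \<rho>0"
    using eventually_at_right_less by (rule eventually_conj)
  then obtain \<rho> where \<rho>: "kl_rate \<rho> < x" "\<rho> > \<rho>0"
    using eventually_happens[of _ "at_right \<rho>0"] trivial_limit_at_right_real by blast
  have \<rho>': "\<rho> > 0" using \<rho> \<rho>0 by simp
  define s where "s = cos (2 * \<alpha>)"
  have s: "0 \<le> s" "s < 2 * sqrt (\<rho> * (1 + \<rho>)) / (1 + 2 * \<rho>)"
    using kl_threshold[OF \<alpha>r(1,2)] \<rho>(2) \<alpha>r by (auto simp: s_def \<rho>0_def intro!: cos_ge_zero)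
  from kabatiansky_levenshtein[OF \<rho>' s] obtain D where D: "D > 0"
    "\<forall>\<^sub>F n in sequentially. \<forall>V. finite V \<longrightarrow> V \<subseteq> euc_sphere n \<longrightarrow>
           (\<forall>x\<in>V. \<forall>y\<in>V. x \<noteq> y \<longrightarrow> inner x y \<le> s) \<longrightarrow> real (card V) \<le> D * kl_rate \<rho> ^ n"
    by (elim exE conjE)
  have kp: "kl_rate \<rho> > 0" by (rule kl_rate_pos[OF \<rho>'])
  \<comment> \<open>The square root splits \<open>n\<^sup>2 * (1 / (q * x)) ^ n\<close> into the square of \<open>n * u ^ n\<close>, which tends to \<open>0\<close>.\<close>
  define u where "u = sqrt (1 / (q * x))"
  have qx: "q * x > 1" using q(1) x1 by (simp add: field_simps)
  have u: "0 < u" "u < 1" using qx q0 x1 by (auto simp: u_def)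
  have u2: "u\<^sup>2 = 1 / (q * x)" using q0 x1 by (simp add: u_def)
  have "(\<lambda>n. C * (real n * u ^ n)\<^sup>2 + D * (kl_rate \<rho> / x) ^ n + 2 * (real n * (1 / x) ^ n) + (1 / x) ^ n)
      \<longlonglongrightarrow> C * 0\<^sup>2 + D * 0 + 2 * 0 + 0"
    using u \<rho>(1) kp x1
    by (intro tendsto_intros powser_times_n_limit_0 LIMSEQ_power_zero) auto
  hence "\<forall>\<^sub>F n in sequentially.
      C * (real n * u ^ n)\<^sup>2 + D * (kl_rate \<rho> / x) ^ n + 2 * (real n * (1 / x) ^ n) + (1 / x) ^ n < 1"
    by (rule order_tendstoD(2)) simp
  moreover have "\<forall>\<^sub>F n in sequentially. n \<ge> (1::nat)" by (rule eventually_ge_at_top)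
  ultimately show ?thesis using D(2)
  proof eventually_elim
    case (elim n)
    from C(2)[OF elim(2)] obtain U where U: "finite U" "U \<subseteq> euc_sphere n"
      "\<And>v. v \<in> euc_sphere n \<Longrightarrow> \<exists>u\<in>U. inner u v > sin \<alpha>" "real (card U) \<le> C * (real n)\<^sup>2 * (1 / q) ^ n"
      by (elim exE conjE) blast
    define m where "m = nat \<lfloor>D * kl_rate \<rho> ^ n\<rfloor>"
    have Dk: "D * kl_rate \<rho> ^ n \<ge> 0" using D(1) kp by simp
    have m: "real m \<le> D * kl_rate \<rho> ^ n" unfolding m_def using Dk by (simp add: of_nat_nat)
    have code: "card V \<le> m" if "finite V" "V \<subseteq> euc_sphere n"
      "\<forall>x\<in>V. \<forall>y\<in>V. x \<noteq> y \<longrightarrow> inner x y \<le> cos (2 * \<alpha>)" for V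
    proof -
      have "real (card V) \<le> D * kl_rate \<rho> ^ n" using elim(3) that unfolding s_def by blast
      thus ?thesis unfolding m_def by (simp add: le_nat_floor)
    qed
    have "cap_illumination_number n \<le> enat (card U + m + 2 * n)"
      by (rule cap_illumination_bound[OF \<alpha>r(1,3) U(1-3) code])
    moreover have "real (card U + m + 2 * n) + 1 < x ^ n"
    proof -
      have xn: "x ^ n > 0" using x1 by simp
      have "x ^ n * (C * (real n * u ^ n)\<^sup>2 + D * (kl_rate \<rho> / x) ^ n + 2 * (real n * (1 / x) ^ n) + (1 / x) ^ n)
          < x ^ n * 1"
        using elim(1) xn by (intro mult_strict_left_mono)
      also have "x ^ n * (C * (real n * u ^ n)\<^sup>2 + D * (kl_rate \<rho> / x) ^ n + 2 * (real n * (1 / x) ^ n) + (1 / x) ^ n)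
          = C * (real n)\<^sup>2 * (1 / q) ^ n + D * kl_rate \<rho> ^ n + 2 * real n + 1"
      proof -
        have "(u ^ n)\<^sup>2 = (1 / (q * x)) ^ n" by (metis u2 power_mult mult.commute)
        hence "x ^ n * (u ^ n)\<^sup>2 = (1 / q) ^ n" using x1 by (simp add: power_divide power_mult_distrib)
        hence "x ^ n * (C * (real n * u ^ n)\<^sup>2) = C * (real n)\<^sup>2 * (1 / q) ^ n"
          by (simp add: power_mult_distrib mult_ac)
        moreover have "x ^ n * (D * (kl_rate \<rho> / x) ^ n) = D * kl_rate \<rho> ^ n"
          "x ^ n * (2 * (real n * (1 / x) ^ n)) = 2 * real n" "x ^ n * (1 / x) ^ n = 1"
          using x1 by (auto simp: power_divide)
        ultimately show ?thesis by (simp only: distrib_left)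
      qed
      finally show ?thesis using U(4) m by simp
    qed
    ultimately show ?case by blast
  qed
qed

lemma less_ereal_of_enat_le:
  assumes "c \<le> enat N" "real N < r"
  shows "ereal_of_enat c < ereal r"
proof -
  have "ereal_of_enat c \<le> ereal_of_enat (enat N)" using assms(1) by (simp only: ereal_of_enat_le_iff)
  also have "\<dots> < ereal r" using assms(2) by simp
  finally show ?thesis .
qed

theorem theorem5:
  shows "(\<exists>!\<alpha>. cap_angle \<alpha>) \<and>
    (\<forall>\<alpha>. cap_angle \<alpha> \<longrightarrow>
       \<bar>\<alpha> - 0.583808\<bar> \<le> 0.0000005 \<and>
       (\<exists>\<epsilon> :: nat \<Rightarrow> real. \<epsilon> \<longlonglongrightarrow> 0 \<and>
          (\<forall>\<^sub>F n in sequentially.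
             ereal_of_enat (cap_illumination_number n) < ereal ((1 / cos \<alpha> + \<epsilon> n) ^ n)))) \<and>
    (\<exists>n\<^sub>0. \<forall>n\<ge>n\<^sub>0. ereal_of_enat (cap_illumination_number n) < ereal (1.19851 ^ n))"
proof (intro conjI allI impI)
  show "\<exists>!\<alpha>. cap_angle \<alpha>" by (rule cap_angle_unique)
next
  fix \<alpha> assume \<alpha>: "cap_angle \<alpha>"
  show "\<bar>\<alpha> - 0.583808\<bar> \<le> 0.0000005" using cap_angle_bounds[OF \<alpha>] by (simp add: abs_if)
  define I where "I n = real (the_enat (cap_illumination_number n))" for n
  define c where "c = 1 / cos \<alpha>"
  \<comment> \<open>This makes \<open>(c + \<epsilon> n) ^ n\<close> at least \<open>I n + 1\<close>; due to the maximum, convergence needs upper bounds only.\<close>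
  define \<epsilon> where "\<epsilon> n = max 0 (root n (I n + 1) - c)" for n
  have rate: "\<forall>\<^sub>F n in sequentially. n > 0 \<and> cap_illumination_number n = enat (the_enat (cap_illumination_number n))
      \<and> I n + 1 < x ^ n" if "c < x" for x
  proof -
    have "\<forall>\<^sub>F n in sequentially. \<exists>N. cap_illumination_number n \<le> enat N \<and> real N + 1 < x ^ n"
      using cap_illumination_rate[OF \<alpha>] that by (simp add: c_def)
    thus ?thesis using eventually_gt_at_top[of 0]
    proof eventually_elim
      case (elim n)
      then obtain N where N: "cap_illumination_number n \<le> enat N" "real N + 1 < x ^ n" by blast
      then obtain k where k: "cap_illumination_number n = enat k" by (cases "cap_illumination_number n") auto
      thus ?case using N elim by (simp add: I_def)
    qed
  qed
  have "0 < \<alpha>" "\<alpha> < pi / 2" using \<alpha> by (auto simp: cap_angle_def)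
  hence c0: "c > 0" by (simp add: c_def cos_gt_zero)
  have "\<epsilon> \<longlonglongrightarrow> 0"
  proof (rule order_tendstoI)
    fix a :: real assume "a < 0"
    hence "a < \<epsilon> n" for n unfolding \<epsilon>_def by (rule less_le_trans) simp
    thus "\<forall>\<^sub>F n in sequentially. a < \<epsilon> n" by simp
  next
    fix a :: real assume a: "0 < a"
    have "c < c + a" using a by simp
    from rate[OF this] show "\<forall>\<^sub>F n in sequentially. \<epsilon> n < a"
    proof (eventually_elim)
      case (elim n)
      hence "root n (I n + 1) < root n ((c + a) ^ n)" using a by simp
      also have "\<dots> = c + a" using elim a c0 by (simp add: real_root_power_cancel)
      finally show ?case using a by (simp add: \<epsilon>_def)
    qed
  qed
  moreover have "c < c + 1" by simp
  from rate[OF this]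
  have "\<forall>\<^sub>F n in sequentially. ereal_of_enat (cap_illumination_number n) < ereal ((c + \<epsilon> n) ^ n)"
  proof (eventually_elim)
    case (elim n)
    have "I n + 1 = root n (I n + 1) ^ n" using elim by (simp add: I_def)
    also have "\<dots> \<le> (c + \<epsilon> n) ^ n"
      by (intro power_mono) (auto simp: \<epsilon>_def I_def intro!: real_root_ge_zero)
    finally show ?case using elim
      by (intro less_ereal_of_enat_le[of _ "the_enat (cap_illumination_number n)"]) (auto simp: I_def)
  qed
  ultimately show "\<exists>\<epsilon> :: nat \<Rightarrow> real. \<epsilon> \<longlonglongrightarrow> 0 \<and>
          (\<forall>\<^sub>F n in sequentially.
             ereal_of_enat (cap_illumination_number n) < ereal ((1 / cos \<alpha> + \<epsilon> n) ^ n))"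
    unfolding c_def by blast
next
  obtain \<alpha> where \<alpha>: "cap_angle \<alpha>" using cap_angle_unique by blast
  have "cos 0.5838085 < cos \<alpha>"
    using cap_angle_bounds[OF \<alpha>] pi_gt3 by (intro cos_monotone_0_pi) auto
  hence "cos \<alpha> > 0.83436943" using cos_num(3) by linarith
  hence "1 / cos \<alpha> < 1 / 0.83436943" by (intro divide_strict_left_mono) auto
  also have "\<dots> < (1.19851 :: real)" by simp
  finally have "\<forall>\<^sub>F n in sequentially. \<exists>N. cap_illumination_number n \<le> enat N \<and> real N + 1 < 1.19851 ^ n"
    by (rule cap_illumination_rate[OF \<alpha>])
  hence "\<forall>\<^sub>F n in sequentially. ereal_of_enat (cap_illumination_number n) < ereal (1.19851 ^ n)"
  proof eventually_elim
    case (elim n)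
    then obtain N where "cap_illumination_number n \<le> enat N" "real N + 1 < 1.19851 ^ n" by blast
    thus ?case by (intro less_ereal_of_enat_le[of _ N]) auto
  qed
  thus "\<exists>n\<^sub>0. \<forall>n\<ge>n\<^sub>0. ereal_of_enat (cap_illumination_number n) < ereal (1.19851 ^ n)"
    unfolding eventually_sequentially .
qed

end
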